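(* Let $R=\mathbb{Q}[V,X,Y,Z]/I$, where $\mathbb{Q}$ is the field of rational numbers and $I$ is the ideal generated by $V^2,\ Z^2,\ XY,\ VX+2XZ,\ VY+YZ,\ VX+Y^2,\ VY-X^2$. Let $f: R^2\rightarrow R^2$ denote the map given by the matrix $\begin{pmatrix} v & 2x\\ y & z\end{pmatrix}$, where $v,x,y,z$ denote the residue classes of the variables $V,X,Y,Z$ modulo $I$. Let $M=\mathrm{Coker} f$ and $N=\mathrm{Im} f$. Then there exists an exact sequence $0\rightarrow N\rightarrow R^2\rightarrow M\rightarrow 0$ such that $M$ is $\infty$-torsionfree and $N$ is not $n$-torsionfree for any $n\geq 2$.
   Context: Matrices act on column vectors, so $f(1,0)=(v,y)$ and $f(0,1)=(2x,z)$. For a finitely presented module $A$ over the commutative ring $R$ with finitely generated projective presentation $P_1\xrightarrow{g}P_0\to A\to 0$, the Auslander transpose is $\mathrm{Tr}\,A=\mathrm{Coker}\big(\mathrm{Hom}_R(g,R):\mathrm{Hom}_R(P_0,R)\to\mathrm{Hom}_R(P_1,R)\big)$ (well defined up to projective summands). $A$ is $n$-torsionfree ($n\ge1$) if $\mathrm{Ext}_R^i(\mathrm{Tr}\,A,R)=0$ for all $1\le i\le n$, and $\infty$-torsionfree if it is $n$-torsionfree for all $n$. *)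

theory Defs
  imports
    "HOL-Algebra.Algebraic_Closure_Type"
    "HOL-Algebra.Module"
    "HOL-Algebra.QuotRing"
    "HOL-Library.Poly_Mapping"
    "HOL-Library.FuncSet"
begin

section \<open>Modules over a commutative ring\<close>

text \<open>
  The record type of modules extends that of rings, so it has the fields \<open>mult\<close> and
  \<open>one\<close>, which mean nothing for a module and are ignored by the locale \<open>module\<close>.
  Homomorphisms are extensional, i.e. \<open>undefined\<close> outside the carrier of their domain,
  so that equality of functions is equality of homomorphisms.
\<close>

definition mod_hom :: "('r, 'x) ring_scheme \<Rightarrow> ('r, 'a, 'y) module_scheme \<Rightarrow>
    ('r, 'b, 'z) module_scheme \<Rightarrow> ('a \<Rightarrow> 'b) set" where
  "mod_hom R A B = {h \<in> carrier A \<rightarrow>\<^sub>E carrier B.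
     (\<forall>x\<in>carrier A. \<forall>y\<in>carrier A. h (x \<oplus>\<^bsub>A\<^esub> y) = h x \<oplus>\<^bsub>B\<^esub> h y) \<and>
     (\<forall>a\<in>carrier R. \<forall>x\<in>carrier A. h (a \<odot>\<^bsub>A\<^esub> x) = a \<odot>\<^bsub>B\<^esub> h x)}"

definition hom_module :: "('r, 'x) ring_scheme \<Rightarrow> ('r, 'a) module \<Rightarrow> ('r, 'b) module \<Rightarrow>
    ('r, 'a \<Rightarrow> 'b) module" where
  "hom_module R A B =
     \<lparr>carrier = mod_hom R A B, monoid.mult = undefined, one = undefined,
      zero = (\<lambda>x\<in>carrier A. \<zero>\<^bsub>B\<^esub>),
      add = (\<lambda>h k. \<lambda>x\<in>carrier A. h x \<oplus>\<^bsub>B\<^esub> k x),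
      module.smult = (\<lambda>a h. \<lambda>x\<in>carrier A. a \<odot>\<^bsub>B\<^esub> h x)\<rparr>"

text \<open>\<open>hom_map R g A A' B\<close> is \<open>Hom(g, B) : Hom(A', B) \<rightarrow> Hom(A, B)\<close> for \<open>g : A \<rightarrow> A'\<close>.\<close>

definition hom_map :: "('r, 'x) ring_scheme \<Rightarrow> ('a \<Rightarrow> 'c) \<Rightarrow> ('r, 'a) module \<Rightarrow>
    ('r, 'c) module \<Rightarrow> ('r, 'b) module \<Rightarrow> ('c \<Rightarrow> 'b) \<Rightarrow> ('a \<Rightarrow> 'b)" where
  "hom_map R g A A' B = (\<lambda>h\<in>mod_hom R A' B. compose (carrier A) h g)"

definition regular_module :: "('r, 'x) ring_scheme \<Rightarrow> ('r, 'r) module" where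
  "regular_module R =
     \<lparr>carrier = carrier R, monoid.mult = (\<otimes>\<^bsub>R\<^esub>), one = \<one>\<^bsub>R\<^esub>, zero = \<zero>\<^bsub>R\<^esub>, add = (\<oplus>\<^bsub>R\<^esub>),
      module.smult = (\<otimes>\<^bsub>R\<^esub>)\<rparr>"

definition free_module :: "('r, 'x) ring_scheme \<Rightarrow> 'i set \<Rightarrow> ('r, 'i \<Rightarrow> 'r) module" where
  "free_module R S =
     \<lparr>carrier = {u \<in> S \<rightarrow>\<^sub>E carrier R. finite {i \<in> S. u i \<noteq> \<zero>\<^bsub>R\<^esub>}},
      monoid.mult = undefined, one = undefined,
      zero = (\<lambda>i\<in>S. \<zero>\<^bsub>R\<^esub>),
      add = (\<lambda>u w. \<lambda>i\<in>S. u i \<oplus>\<^bsub>R\<^esub> w i),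
      module.smult = (\<lambda>a u. \<lambda>i\<in>S. a \<otimes>\<^bsub>R\<^esub> u i)\<rparr>"

definition quot_module :: "('r, 'a) module \<Rightarrow> 'a set \<Rightarrow> ('r, 'a set) module" where
  "quot_module A H =
     \<lparr>carrier = a_rcosets\<^bsub>A\<^esub> H, monoid.mult = undefined, one = undefined,
      zero = H,
      add = set_add A,
      module.smult = (\<lambda>a C. \<Union>x\<in>C. H +>\<^bsub>A\<^esub> (a \<odot>\<^bsub>A\<^esub> x))\<rparr>"

definition coker :: "('r, 'a) module \<Rightarrow> ('r, 'b) module \<Rightarrow> ('a \<Rightarrow> 'b) \<Rightarrow> ('r, 'b set) module" where
  "coker A B h = quot_module B (h ` carrier A)"

definition image_module :: "('r, 'a) module \<Rightarrow> ('r, 'b) module \<Rightarrow> ('a \<Rightarrow> 'b) \<Rightarrow> ('r, 'b) module" where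
  "image_module A B h = B\<lparr>carrier := h ` carrier A\<rparr>"

definition ses :: "('r, 'x) ring_scheme \<Rightarrow> ('r, 'a) module \<Rightarrow> ('r, 'b) module \<Rightarrow> ('r, 'c) module \<Rightarrow>
    ('a \<Rightarrow> 'b) \<Rightarrow> ('b \<Rightarrow> 'c) \<Rightarrow> bool" where
  "ses R A B C i p \<longleftrightarrow>
     module R A \<and> module R B \<and> module R C \<and>
     i \<in> mod_hom R A B \<and> p \<in> mod_hom R B C \<and>
     inj_on i (carrier A) \<and> i ` carrier A = a_kernel B C p \<and> p ` carrier B = carrier C"

definition fin_gen :: "('r, 'x) ring_scheme \<Rightarrow> ('r, 'a) module \<Rightarrow> bool" where
  "fin_gen R A \<longleftrightarrow> (\<exists>S. finite S \<and> S \<subseteq> carrier A \<and>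
     (\<forall>x\<in>carrier A. \<exists>c\<in>S \<rightarrow> carrier R. x = (\<Oplus>\<^bsub>A\<^esub>s\<in>S. c s \<odot>\<^bsub>A\<^esub> s)))"

text \<open>
  Projective modules are the direct summands of free modules. It is no restriction that the
  index set \<open>S\<close> of the free module has the type of the elements of \<open>P\<close>: if \<open>P\<close> is projective,
  then it is a summand of the free module on the set \<open>carrier P\<close>.
\<close>

definition projective :: "('r, 'x) ring_scheme \<Rightarrow> ('r, 'p) module \<Rightarrow> bool" where
  "projective R P \<longleftrightarrow> module R P \<and>
     (\<exists>(S :: 'p set) s r.
        s \<in> mod_hom R P (free_module R S) \<and> r \<in> mod_hom R (free_module R S) P \<and>
        (\<forall>x\<in>carrier P. r (s x) = x))"


section \<open>Ext\<close>

definition proj_resolution :: "('r, 'x) ring_scheme \<Rightarrow> ('r, 'a) module \<Rightarrow>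
    (nat \<Rightarrow> ('r, 'p) module) \<Rightarrow> (nat \<Rightarrow> 'p \<Rightarrow> 'p) \<Rightarrow> ('p \<Rightarrow> 'a) \<Rightarrow> bool" where
  "proj_resolution R A P d e \<longleftrightarrow>
     (\<forall>n. projective R (P n)) \<and>
     (\<forall>n. d n \<in> mod_hom R (P (Suc n)) (P n)) \<and>
     e \<in> mod_hom R (P 0) A \<and>
     e ` carrier (P 0) = carrier A \<and>
     d 0 ` carrier (P 1) = a_kernel (P 0) A e \<and>
     (\<forall>n. d (Suc n) ` carrier (P (Suc (Suc n))) = a_kernel (P (Suc n)) (P n) (d n))"

text \<open>
  The terms of the chosen resolution are carried by a type which depends only on the types of
  the elements of \<open>R\<close> and of the module. Its index type \<open>('a + 'r + nat) list\<close> is infinite and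
  at least as large as both of these types, hence at least as large as the set of finitely
  supported functions from it to \<open>'r\<close>. So every module carried by \<open>'a\<close> has a resolution by free
  modules on subsets of the index type.
\<close>

type_synonym ('r, 'a) resolution_elt = "('a + 'r + nat) list \<Rightarrow> 'r"

definition the_resolution :: "('r, 'x) ring_scheme \<Rightarrow> ('r, 'a) module \<Rightarrow>
    (nat \<Rightarrow> ('r, ('r, 'a) resolution_elt) module) \<times>
    (nat \<Rightarrow> ('r, 'a) resolution_elt \<Rightarrow> ('r, 'a) resolution_elt)" where
  "the_resolution R A = (SOME (P, d). \<exists>e. proj_resolution R A P d e)"

definition hom_complex_cohomology :: "('r, 'x) ring_scheme \<Rightarrow> (nat \<Rightarrow> ('r, 'p) module) \<Rightarrow>
    (nat \<Rightarrow> 'p \<Rightarrow> 'p) \<Rightarrow> ('r, 'b) module \<Rightarrow> nat \<Rightarrow> ('r, ('p \<Rightarrow> 'b) set) module" where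
  "hom_complex_cohomology R P d B i =
     (let C = (\<lambda>j. hom_module R (P j) B);
          \<delta> = (\<lambda>j. hom_map R (d j) (P (Suc j)) (P j) B)
      in quot_module
           ((C i)\<lparr>carrier := a_kernel (C i) (C (Suc i)) (\<delta> i)\<rparr>)
           (case i of 0 \<Rightarrow> {\<zero>\<^bsub>C 0\<^esub>} | Suc j \<Rightarrow> \<delta> j ` carrier (C j)))"

definition Ext :: "('r, 'x) ring_scheme \<Rightarrow> nat \<Rightarrow> ('r, 'a) module \<Rightarrow> ('r, 'b) module \<Rightarrow>
    ('r, (('r, 'a) resolution_elt \<Rightarrow> 'b) set) module" where
  "Ext R i A B = (case the_resolution R A of (P, d) \<Rightarrow> hom_complex_cohomology R P d B i)"


section \<open>The Auslander transpose and \<open>n\<close>-torsionfree modules\<close>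

definition fg_proj_presentation :: "('r, 'x) ring_scheme \<Rightarrow> ('r, 'a) module \<Rightarrow>
    ('r, 'p) module \<Rightarrow> ('r, 'q) module \<Rightarrow> ('p \<Rightarrow> 'q) \<Rightarrow> ('q \<Rightarrow> 'a) \<Rightarrow> bool" where
  "fg_proj_presentation R A P1 P0 g p \<longleftrightarrow>
     projective R P1 \<and> fin_gen R P1 \<and> projective R P0 \<and> fin_gen R P0 \<and>
     g \<in> mod_hom R P1 P0 \<and> p \<in> mod_hom R P0 A \<and>
     g ` carrier P1 = a_kernel P0 A p \<and> p ` carrier P0 = carrier A"

text \<open>
  Every finitely generated projective module is isomorphic to one carried by \<open>nat \<Rightarrow> 'r\<close>,
  namely to a submodule of some \<open>free_module R {..<n}\<close>. The transpose is meaningful only for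
  finitely presented \<open>A\<close>, i.e. when some presentation exists.
\<close>

definition the_presentation :: "('r, 'x) ring_scheme \<Rightarrow> ('r, 'a) module \<Rightarrow>
    ('r, nat \<Rightarrow> 'r) module \<times> ('r, nat \<Rightarrow> 'r) module \<times> ((nat \<Rightarrow> 'r) \<Rightarrow> (nat \<Rightarrow> 'r))" where
  "the_presentation R A = (SOME (P1, P0, g). \<exists>p. fg_proj_presentation R A P1 P0 g p)"

definition Tr :: "('r, 'x) ring_scheme \<Rightarrow> ('r, 'a) module \<Rightarrow>
    ('r, ((nat \<Rightarrow> 'r) \<Rightarrow> 'r) set) module" where
  "Tr R A = (case the_presentation R A of (P1, P0, g) \<Rightarrow>
     coker (hom_module R P0 (regular_module R)) (hom_module R P1 (regular_module R))
       (hom_map R g P1 P0 (regular_module R)))"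

definition n_torsionfree :: "('r, 'x) ring_scheme \<Rightarrow> nat \<Rightarrow> ('r, 'a) module \<Rightarrow> bool" where
  "n_torsionfree R n A \<longleftrightarrow>
     (\<forall>i. 1 \<le> i \<and> i \<le> n \<longrightarrow>
        carrier (Ext R i (Tr R A) (regular_module R)) =
          {\<zero>\<^bsub>Ext R i (Tr R A) (regular_module R)\<^esub>})"

definition infinity_torsionfree :: "('r, 'x) ring_scheme \<Rightarrow> ('r, 'a) module \<Rightarrow> bool" where
  "infinity_torsionfree R A \<longleftrightarrow> (\<forall>n\<ge>1. n_torsionfree R n A)"


section \<open>The ring and the two modules\<close>

datatype indet = Ind_V | Ind_X | Ind_Y | Ind_Z

text \<open>Polynomials over the rationals: finitely supported functions from exponent vectors.\<close>

type_synonym rat_poly = "(indet \<Rightarrow>\<^sub>0 nat) \<Rightarrow>\<^sub>0 rat"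

definition indet_poly :: "indet \<Rightarrow> rat_poly" where
  "indet_poly i = Poly_Mapping.single (Poly_Mapping.single i 1) 1"

abbreviation "pV \<equiv> indet_poly Ind_V"
abbreviation "pX \<equiv> indet_poly Ind_X"
abbreviation "pY \<equiv> indet_poly Ind_Y"
abbreviation "pZ \<equiv> indet_poly Ind_Z"

definition poly_ring_VXYZ :: "rat_poly ring" where
  "poly_ring_VXYZ = ring_of_type_algebra"

definition ideal_I :: "rat_poly set" where
  "ideal_I = Idl\<^bsub>poly_ring_VXYZ\<^esub>
     {pV ^ 2, pZ ^ 2, pX * pY, pV * pX + 2 * pX * pZ, pV * pY + pY * pZ,
      pV * pX + pY ^ 2, pV * pY - pX ^ 2}"

definition ring_R :: "rat_poly set ring" where
  "ring_R = poly_ring_VXYZ Quot ideal_I"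

definition residue_class :: "rat_poly \<Rightarrow> rat_poly set" where
  "residue_class p = ideal_I +>\<^bsub>poly_ring_VXYZ\<^esub> p"

text \<open>Rows and columns are counted from 0; matrices act on column vectors.\<close>

definition matrix_map :: "('r, 'x) ring_scheme \<Rightarrow> nat \<Rightarrow> nat \<Rightarrow> (nat \<Rightarrow> nat \<Rightarrow> 'r) \<Rightarrow>
    (nat \<Rightarrow> 'r) \<Rightarrow> (nat \<Rightarrow> 'r)" where
  "matrix_map R m n A = (\<lambda>u\<in>carrier (free_module R {..<n}).
     \<lambda>i\<in>{..<m}. \<Oplus>\<^bsub>R\<^esub>j\<in>{..<n}. A i j \<otimes>\<^bsub>R\<^esub> u j)"

definition R_squared :: "(rat_poly set, nat \<Rightarrow> rat_poly set) module" where
  "R_squared = free_module ring_R {..<2}"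

definition map_f :: "(nat \<Rightarrow> rat_poly set) \<Rightarrow> (nat \<Rightarrow> rat_poly set)" where
  "map_f = matrix_map ring_R 2 2
     (\<lambda>i j. [[residue_class pV, residue_class (2 * pX)],
             [residue_class pY, residue_class pZ]] ! i ! j)"

definition module_M :: "(rat_poly set, (nat \<Rightarrow> rat_poly set) set) module" where
  "module_M = coker R_squared R_squared map_f"

definition module_N :: "(rat_poly set, nat \<Rightarrow> rat_poly set) module" where
  "module_N = image_module R_squared R_squared map_f"

end

(*
  Let d(c) be the matrix with rows (v, c x) and (y, z), so f = d(2). In the basis 1, v, x, y, z, vz,
  xz, yz of R one computes Ker d(2c) = Im d(c) for c >= 1 and, for the transposes,
  Ker d(c)^T = Im d(2c)^T for c >= 2; the latter fails for c = 1, where the kernel has the further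
  generator (x, y). Hence M = Coker d(2) and N = Im d(2) = Coker d(1), and the powers of 2 give a free
  resolution of Tr M with matrices d(2)^T, d(4)^T, ... whose R-dual is exact.

  Ext^(j+1)(T, R) vanishes iff every homomorphism to R from the j-th syzygy, the image of d_j in P_j,
  extends to P_j. This condition passes to stable retracts, and stable retracts pass to syzygies, so
  it can be tested on the matrices above whatever presentation and resolution have been chosen.
  For N it fails at the kernel of d(1)^T.
*)
theory Submission
  imports Defs
begin

section \<open>Homomorphisms and linear combinations\<close>

text \<open>The parameter c doubles from one matrix to the next, and the transposed sequence is
  exact for c \<ge> 2 but not at c = 1. The powers 2, 4, 8, ... never return to 1, so everything
  built from M avoids the exceptional value, while the syzygy N of M is presented by d(1). The
  obstacle is that \<open>Tr\<close> and \<open>Ext\<close> use an unspecified presentation and an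
  unspecified resolution, carried by other types than the matrices. A lifting property quantified
  over modules of all types cannot be a hypothesis, so projectivity is used through dual bases,
  which give lifts into modules of any type. In place of the independence of Ext from the
  resolution, one-sided comparisons of syzygies suffice: for M from the matrices to the chosen
  resolution, for N in the opposite direction. The exactness statements are rational linear algebra
  in eight coordinates. This requires that R be identified with an explicit algebra, which also
  shows that the ideal is no larger than expected.\<close>

lemma mod_hom_restrictI:
  assumes "module R A"
    and "\<And>x. x \<in> carrier A \<Longrightarrow> f x \<in> carrier B"
    and "\<And>x y. x \<in> carrier A \<Longrightarrow> y \<in> carrier A \<Longrightarrow> f (x \<oplus>\<^bsub>A\<^esub> y) = f x \<oplus>\<^bsub>B\<^esub> f y"
    and "\<And>a x. a \<in> carrier R \<Longrightarrow> x \<in> carrier A \<Longrightarrow> f (a \<odot>\<^bsub>A\<^esub> x) = a \<odot>\<^bsub>B\<^esub> f x"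
  shows "(\<lambda>x\<in>carrier A. f x) \<in> mod_hom R A B"
proof -
  interpret A: module R A by fact
  show ?thesis using assms by (auto simp: mod_hom_def)
qed

lemma mod_hom_closed: "h \<in> mod_hom R A B \<Longrightarrow> x \<in> carrier A \<Longrightarrow> h x \<in> carrier B"
  by (auto simp: mod_hom_def)

lemma mod_hom_add:
  "h \<in> mod_hom R A B \<Longrightarrow> x \<in> carrier A \<Longrightarrow> y \<in> carrier A \<Longrightarrow> h (x \<oplus>\<^bsub>A\<^esub> y) = h x \<oplus>\<^bsub>B\<^esub> h y"
  by (auto simp: mod_hom_def)

lemma mod_hom_smult:
  "h \<in> mod_hom R A B \<Longrightarrow> a \<in> carrier R \<Longrightarrow> x \<in> carrier A \<Longrightarrow> h (a \<odot>\<^bsub>A\<^esub> x) = a \<odot>\<^bsub>B\<^esub> h x"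
  by (auto simp: mod_hom_def)

lemma mod_hom_eqI:
  assumes "h \<in> mod_hom R A B" "k \<in> mod_hom R A B" "\<And>x. x \<in> carrier A \<Longrightarrow> h x = k x"
  shows "h = k"
  by (rule extensionalityI[of h "carrier A" k]) (use assms in \<open>auto simp: mod_hom_def PiE_def\<close>)

lemma mod_hom_zero:
  assumes "module R A" "module R B" "h \<in> mod_hom R A B"
  shows "h \<zero>\<^bsub>A\<^esub> = \<zero>\<^bsub>B\<^esub>"
proof -
  interpret A: module R A by fact
  interpret B: module R B by fact
  have "h \<zero>\<^bsub>A\<^esub> = h (\<zero>\<^bsub>R\<^esub> \<odot>\<^bsub>A\<^esub> \<zero>\<^bsub>A\<^esub>)" by simp
  also have "\<dots> = \<zero>\<^bsub>R\<^esub> \<odot>\<^bsub>B\<^esub> h \<zero>\<^bsub>A\<^esub>"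
    using assms(3) by (intro mod_hom_smult) auto
  also have "\<dots> = \<zero>\<^bsub>B\<^esub>" using mod_hom_closed[OF assms(3)] by simp
  finally show ?thesis .
qed

text \<open>Negatives become multiples by the scalar -1, so a homomorphism respects them because it
  respects scalars.\<close>

lemma a_inv_eq_smult:
  assumes "module R A" "x \<in> carrier A"
  shows "\<ominus>\<^bsub>A\<^esub> x = (\<ominus>\<^bsub>R\<^esub> \<one>\<^bsub>R\<^esub>) \<odot>\<^bsub>A\<^esub> x"
proof -
  interpret A: module R A by fact
  show ?thesis using assms(2) by (simp add: A.smult_l_minus)
qed

lemma mod_hom_a_inv:
  assumes "module R A" "module R B" "h \<in> mod_hom R A B" "x \<in> carrier A"
  shows "h (\<ominus>\<^bsub>A\<^esub> x) = \<ominus>\<^bsub>B\<^esub> h x"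
proof -
  interpret A: module R A by fact
  show ?thesis
    using assms mod_hom_closed[OF assms(3,4)]
    by (simp add: a_inv_eq_smult[of R A] a_inv_eq_smult[of R B] mod_hom_smult)
qed

lemma mod_hom_compose:
  assumes "module R A" "h \<in> mod_hom R A B" "k \<in> mod_hom R B C"
  shows "compose (carrier A) k h \<in> mod_hom R A C"
  unfolding compose_def
  by (rule mod_hom_restrictI[OF assms(1)])
     (use assms in \<open>auto simp: mod_hom_closed mod_hom_add mod_hom_smult\<close>)

lemma mod_hom_sum:
  assumes "module R A" "module R B" "h \<in> mod_hom R A B" "k \<in> mod_hom R A B"
  shows "(\<lambda>x\<in>carrier A. h x \<oplus>\<^bsub>B\<^esub> k x) \<in> mod_hom R A B"
proof -
  interpret B: module R B by fact
  show ?thesis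
    by (rule mod_hom_restrictI[OF assms(1)])
       (use assms in \<open>auto simp: mod_hom_closed mod_hom_add mod_hom_smult B.smult_r_distr
          B.a_ac\<close>)
qed

lemma mod_hom_uminus:
  assumes "module R A" "module R B" "h \<in> mod_hom R A B"
  shows "(\<lambda>x\<in>carrier A. \<ominus>\<^bsub>B\<^esub> h x) \<in> mod_hom R A B"
proof -
  interpret B: module R B by fact
  show ?thesis
    by (rule mod_hom_restrictI[OF assms(1)])
       (use assms in \<open>auto simp: mod_hom_closed mod_hom_add mod_hom_smult B.smult_r_minus
          B.minus_add B.a_comm\<close>)
qed

lemma mod_hom_id: "module R A \<Longrightarrow> (\<lambda>x\<in>carrier A. x) \<in> mod_hom R A A"
  by (rule mod_hom_restrictI) auto

lemma mod_hom_finsum: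
  assumes "module R A" "module R B" "h \<in> mod_hom R A B" "finite F" "g \<in> F \<rightarrow> carrier A"
  shows "h (\<Oplus>\<^bsub>A\<^esub>i\<in>F. g i) = (\<Oplus>\<^bsub>B\<^esub>i\<in>F. h (g i))"
proof -
  interpret A: module R A by fact
  interpret B: module R B by fact
  show ?thesis using assms(4,5)
  proof (induction F rule: finite_induct)
    case empty
    show ?case using mod_hom_zero[OF assms(1-3)] by simp
  next
    case (insert i F)
    have *: "g \<in> F \<rightarrow> carrier A" "g i \<in> carrier A" using insert.prems by auto
    then have "(\<lambda>i. h (g i)) \<in> F \<rightarrow> carrier B" "h (g i) \<in> carrier B"
      using mod_hom_closed[OF assms(3)] by auto
    then have "(\<Oplus>\<^bsub>B\<^esub>i\<in>insert i F. h (g i)) = h (g i) \<oplus>\<^bsub>B\<^esub> (\<Oplus>\<^bsub>B\<^esub>i\<in>F. h (g i))"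
      using insert.hyps by (intro B.finsum_insert) auto
    moreover have "(\<Oplus>\<^bsub>A\<^esub>i\<in>insert i F. g i) = g i \<oplus>\<^bsub>A\<^esub> (\<Oplus>\<^bsub>A\<^esub>i\<in>F. g i)"
      using insert.hyps * by (intro A.finsum_insert) auto
    moreover have "h (g i \<oplus>\<^bsub>A\<^esub> (\<Oplus>\<^bsub>A\<^esub>i\<in>F. g i)) = h (g i) \<oplus>\<^bsub>B\<^esub> h (\<Oplus>\<^bsub>A\<^esub>i\<in>F. g i)"
      using * by (intro mod_hom_add[OF assms(3)] A.finsum_closed)
    moreover have "h (\<Oplus>\<^bsub>A\<^esub>i\<in>F. g i) = (\<Oplus>\<^bsub>B\<^esub>i\<in>F. h (g i))"
      using *(1) by (rule insert.IH)
    ultimately show ?case by (simp only:)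
  qed
qed

section \<open>Kernels, images and submodules as modules\<close>

lemma submodule_kernel:
  assumes "module R A" "module R B" "h \<in> mod_hom R A B"
  shows "submodule (a_kernel A B h) R A"
proof -
  interpret A: module R A by fact
  interpret B: module R B by fact
  show ?thesis
    by (rule A.submoduleI)
       (use assms in \<open>auto simp: a_kernel_def' mod_hom_zero mod_hom_a_inv mod_hom_add mod_hom_smult\<close>)
qed

lemma submodule_image:
  assumes "module R A" "module R B" "h \<in> mod_hom R A B"
  shows "submodule (h ` carrier A) R B"
proof -
  interpret A: module R A by fact
  interpret B: module R B by fact
  show ?thesis
  proof (rule B.submoduleI)
    show "h ` carrier A \<subseteq> carrier B" using mod_hom_closed[OF assms(3)] by auto
    show "\<zero>\<^bsub>B\<^esub> \<in> h ` carrier A"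
      using mod_hom_zero[OF assms] by (metis A.zero_closed imageI)
    show "\<ominus>\<^bsub>B\<^esub> a \<in> h ` carrier A" if a: "a \<in> h ` carrier A" for a
    proof -
      obtain x where "x \<in> carrier A" "a = h x" using a by (rule imageE) auto
      then show ?thesis using mod_hom_a_inv[OF assms, of x] by (intro image_eqI[of _ _ "\<ominus>\<^bsub>A\<^esub> x"]) auto
    qed
    show "a \<oplus>\<^bsub>B\<^esub> b \<in> h ` carrier A" if ab: "a \<in> h ` carrier A" "b \<in> h ` carrier A" for a b
    proof -
      obtain x y where "x \<in> carrier A" "y \<in> carrier A" "a = h x" "b = h y" using ab by auto
      then show ?thesis using mod_hom_add[OF assms(3), of x y]
        by (intro image_eqI[of _ _ "x \<oplus>\<^bsub>A\<^esub> y"]) auto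
    qed
    show "a \<odot>\<^bsub>B\<^esub> x \<in> h ` carrier A" if ax: "a \<in> carrier R" "x \<in> h ` carrier A" for a x
    proof -
      obtain y where "y \<in> carrier A" "x = h y" using ax by auto
      then show ?thesis using mod_hom_smult[OF assms(3) ax(1), of y] ax(1)
        by (intro image_eqI[of _ _ "a \<odot>\<^bsub>A\<^esub> y"]) auto
    qed
  qed
qed

lemma submodule_carrier_update:
  assumes "submodule H R A" "module R A"
  shows "module R (A\<lparr>carrier := H\<rparr>)"
  using assms by (rule submodule.submodule_is_module)

lemma submodule_subset: "submodule H R A \<Longrightarrow> H \<subseteq> carrier A"
  by (auto simp: submodule_def subgroup_def)

text \<open>Homomorphisms are extensional, so a smaller domain calls for
  \<open>restrict\<close>.\<close>

lemma mod_hom_restrict_domain: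
  assumes "submodule K R A" "module R A" "h \<in> mod_hom R A B"
  shows "restrict h K \<in> mod_hom R (A\<lparr>carrier := K\<rparr>) B"
  using mod_hom_restrictI[OF submodule_carrier_update[OF assms(1,2)], of h B]
    submodule_subset[OF assms(1)] assms(3)
  by (auto simp: mod_hom_closed mod_hom_add mod_hom_smult subsetD)

lemma mod_hom_codomain:
  "K \<subseteq> carrier B \<Longrightarrow> h \<in> mod_hom R A (B\<lparr>carrier := K\<rparr>) \<Longrightarrow> h \<in> mod_hom R A B"
  by (auto simp: mod_hom_def)

lemma mod_hom_codomain_restrict:
  "h \<in> mod_hom R A B \<Longrightarrow> h ` carrier A \<subseteq> K \<Longrightarrow> h \<in> mod_hom R A (B\<lparr>carrier := K\<rparr>)"
  by (auto simp: mod_hom_def)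

text \<open>The sum over the support makes sense for infinite \<open>J\<close> too, where \<open>finsum\<close> is zero.\<close>

definition lin_comb :: "('r, 'x) ring_scheme \<Rightarrow> ('r, 'a) module \<Rightarrow> 'j set \<Rightarrow> ('j \<Rightarrow> 'r) \<Rightarrow>
    ('j \<Rightarrow> 'a) \<Rightarrow> 'a" where
  "lin_comb R A J c y = (\<Oplus>\<^bsub>A\<^esub>j\<in>{j \<in> J. c j \<noteq> \<zero>\<^bsub>R\<^esub>}. c j \<odot>\<^bsub>A\<^esub> y j)"

text \<open>The support changes when coefficients are added or scaled, so the defining sums run over
  different index sets. Any finite set that contains the supports serves as a common one, the extra
  terms being zero.\<close>

lemma lin_comb_superset:
  assumes "module R A" "finite F" "F \<subseteq> J" "{j \<in> J. c j \<noteq> \<zero>\<^bsub>R\<^esub>} \<subseteq> F"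
    "c \<in> J \<rightarrow> carrier R" "y \<in> J \<rightarrow> carrier A"
  shows "lin_comb R A J c y = (\<Oplus>\<^bsub>A\<^esub>j\<in>F. c j \<odot>\<^bsub>A\<^esub> y j)"
proof -
  interpret A: module R A by fact
  show ?thesis unfolding lin_comb_def
    by (rule A.add.finprod_mono_neutral_cong_left) (use assms in \<open>auto simp: Pi_iff subset_iff\<close>)
qed

lemma lin_comb_finite:
  assumes "module R A" "finite J" "c \<in> J \<rightarrow> carrier R" "y \<in> J \<rightarrow> carrier A"
  shows "lin_comb R A J c y = (\<Oplus>\<^bsub>A\<^esub>j\<in>J. c j \<odot>\<^bsub>A\<^esub> y j)"
  by (rule lin_comb_superset) (use assms in auto)

lemma lin_comb_closed:
  assumes "module R A" "c \<in> J \<rightarrow> carrier R" "y \<in> J \<rightarrow> carrier A"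
  shows "lin_comb R A J c y \<in> carrier A"
proof -
  interpret A: module R A by fact
  show ?thesis unfolding lin_comb_def
    by (rule A.finsum_closed) (use assms in auto)
qed

lemma lin_comb_add:
  assumes "module R A" "finite {j \<in> J. c j \<noteq> \<zero>\<^bsub>R\<^esub>}" "finite {j \<in> J. d j \<noteq> \<zero>\<^bsub>R\<^esub>}"
    "c \<in> J \<rightarrow> carrier R" "d \<in> J \<rightarrow> carrier R" "y \<in> J \<rightarrow> carrier A"
  shows "lin_comb R A J (\<lambda>j. c j \<oplus>\<^bsub>R\<^esub> d j) y = lin_comb R A J c y \<oplus>\<^bsub>A\<^esub> lin_comb R A J d y"
proof -
  interpret A: module R A by fact
  let ?F = "{j \<in> J. c j \<noteq> \<zero>\<^bsub>R\<^esub>} \<union> {j \<in> J. d j \<noteq> \<zero>\<^bsub>R\<^esub>}"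
  have "lin_comb R A J (\<lambda>j. c j \<oplus>\<^bsub>R\<^esub> d j) y = (\<Oplus>\<^bsub>A\<^esub>j\<in>?F. (c j \<oplus>\<^bsub>R\<^esub> d j) \<odot>\<^bsub>A\<^esub> y j)"
    by (rule lin_comb_superset) (use assms in auto)
  also have "\<dots> = (\<Oplus>\<^bsub>A\<^esub>j\<in>?F. c j \<odot>\<^bsub>A\<^esub> y j \<oplus>\<^bsub>A\<^esub> d j \<odot>\<^bsub>A\<^esub> y j)"
    by (rule A.finsum_cong') (use assms in \<open>auto simp: Pi_iff A.smult_l_distr\<close>)
  also have "\<dots> = (\<Oplus>\<^bsub>A\<^esub>j\<in>?F. c j \<odot>\<^bsub>A\<^esub> y j) \<oplus>\<^bsub>A\<^esub> (\<Oplus>\<^bsub>A\<^esub>j\<in>?F. d j \<odot>\<^bsub>A\<^esub> y j)"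
    by (rule A.finsum_addf) (use assms in \<open>auto simp: Pi_iff\<close>)
  also have "(\<Oplus>\<^bsub>A\<^esub>j\<in>?F. c j \<odot>\<^bsub>A\<^esub> y j) = lin_comb R A J c y"
    by (rule lin_comb_superset[symmetric]) (use assms in auto)
  also have "(\<Oplus>\<^bsub>A\<^esub>j\<in>?F. d j \<odot>\<^bsub>A\<^esub> y j) = lin_comb R A J d y"
    by (rule lin_comb_superset[symmetric]) (use assms in auto)
  finally show ?thesis .
qed

lemma lin_comb_smult:
  assumes "module R A" "finite {j \<in> J. c j \<noteq> \<zero>\<^bsub>R\<^esub>}" "a \<in> carrier R"
    "c \<in> J \<rightarrow> carrier R" "y \<in> J \<rightarrow> carrier A"
  shows "lin_comb R A J (\<lambda>j. a \<otimes>\<^bsub>R\<^esub> c j) y = a \<odot>\<^bsub>A\<^esub> lin_comb R A J c y"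
proof -
  interpret A: module R A by fact
  let ?F = "{j \<in> J. c j \<noteq> \<zero>\<^bsub>R\<^esub>}"
  have "lin_comb R A J (\<lambda>j. a \<otimes>\<^bsub>R\<^esub> c j) y = (\<Oplus>\<^bsub>A\<^esub>j\<in>?F. (a \<otimes>\<^bsub>R\<^esub> c j) \<odot>\<^bsub>A\<^esub> y j)"
    by (rule lin_comb_superset) (use assms in auto)
  also have "\<dots> = (\<Oplus>\<^bsub>A\<^esub>j\<in>?F. a \<odot>\<^bsub>A\<^esub> (c j \<odot>\<^bsub>A\<^esub> y j))"
    by (rule A.finsum_cong') (use assms in \<open>auto simp: Pi_iff A.smult_assoc1\<close>)
  also have "\<dots> = a \<odot>\<^bsub>A\<^esub> lin_comb R A J c y"
    unfolding lin_comb_def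
    by (rule A.finsum_smult_ldistr[symmetric]) (use assms in \<open>auto simp: Pi_iff\<close>)
  finally show ?thesis .
qed

lemma mod_hom_lin_comb:
  assumes "module R A" "module R B" "h \<in> mod_hom R A B" "finite {j \<in> J. c j \<noteq> \<zero>\<^bsub>R\<^esub>}"
    "c \<in> J \<rightarrow> carrier R" "y \<in> J \<rightarrow> carrier A"
  shows "h (lin_comb R A J c y) = lin_comb R B J c (\<lambda>j. h (y j))"
proof -
  interpret A: module R A by fact
  interpret B: module R B by fact
  have "h (lin_comb R A J c y) = (\<Oplus>\<^bsub>B\<^esub>j\<in>{j \<in> J. c j \<noteq> \<zero>\<^bsub>R\<^esub>}. h (c j \<odot>\<^bsub>A\<^esub> y j))"
    unfolding lin_comb_def by (rule mod_hom_finsum) (use assms in \<open>auto simp: Pi_iff\<close>)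
  also have "\<dots> = lin_comb R B J c (\<lambda>j. h (y j))"
    unfolding lin_comb_def
    by (rule B.finsum_cong')
       (use assms in \<open>auto simp: Pi_iff mod_hom_smult mod_hom_closed\<close>)
  finally show ?thesis .
qed

text \<open>Serves to move a dual basis to an index set in another type.\<close>

lemma lin_comb_reindex:
  assumes "module R A" "inj_on k J" "c \<in> k ` J \<rightarrow> carrier R" "y \<in> k ` J \<rightarrow> carrier A"
  shows "lin_comb R A (k ` J) c y = lin_comb R A J (\<lambda>j. c (k j)) (\<lambda>j. y (k j))"
proof -
  interpret A: module R A by fact
  have "{i \<in> k ` J. c i \<noteq> \<zero>\<^bsub>R\<^esub>} = k ` {j \<in> J. c (k j) \<noteq> \<zero>\<^bsub>R\<^esub>}" by auto
  then show ?thesis unfolding lin_comb_def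
    using A.finsum_reindex[of "\<lambda>i. c i \<odot>\<^bsub>A\<^esub> y i" k "{j \<in> J. c (k j) \<noteq> \<zero>\<^bsub>R\<^esub>}"] assms
    by (auto simp: Pi_iff inj_on_def)
qed

lemma lin_comb_cong:
  assumes "module R A" "\<And>j. j \<in> J \<Longrightarrow> c j = c' j" "\<And>j. j \<in> J \<Longrightarrow> y j = y' j"
    "c' \<in> J \<rightarrow> carrier R" "y' \<in> J \<rightarrow> carrier A"
  shows "lin_comb R A J c y = lin_comb R A J c' y'"
proof -
  interpret A: module R A by fact
  show ?thesis unfolding lin_comb_def
    by (rule A.finsum_cong') (use assms in \<open>auto simp: Pi_iff\<close>)
qed


section \<open>Standard modules\<close>

lemma regular_module_simps [simp]:
  "carrier (regular_module R) = carrier R" "add (regular_module R) = add R"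
  "zero (regular_module R) = zero R" "module.smult (regular_module R) = monoid.mult R"
  by (simp_all add: regular_module_def)

lemma module_regular:
  assumes "cring R"
  shows "module R (regular_module R)"
proof -
  interpret R: cring R by fact
  show ?thesis
  proof (rule moduleI[OF assms])
    show "abelian_group (regular_module R)"
      by (rule abelian_groupI) (auto simp: R.a_ac intro: R.l_neg)
  qed (auto simp: R.l_distr R.r_distr R.m_assoc)
qed

lemma finsum_regular: "finsum (regular_module R) f A = finsum R f A"
  by (simp add: finsum_def finprod_def)

lemma hom_module_simps [simp]:
  "carrier (hom_module R A B) = mod_hom R A B"
  "zero (hom_module R A B) = (\<lambda>x\<in>carrier A. \<zero>\<^bsub>B\<^esub>)"
  "h \<oplus>\<^bsub>hom_module R A B\<^esub> k = (\<lambda>x\<in>carrier A. h x \<oplus>\<^bsub>B\<^esub> k x)"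
  "a \<odot>\<^bsub>hom_module R A B\<^esub> h = (\<lambda>x\<in>carrier A. a \<odot>\<^bsub>B\<^esub> h x)"
  by (simp_all add: hom_module_def)

text \<open>Commutativity of the ring enters here: linearity of a h amounts to a (b h(x)) = b (a
  h(x)).\<close>

lemma mod_hom_smult_map:
  assumes "module R A" "module R B" "h \<in> mod_hom R A B" "a \<in> carrier R"
  shows "(\<lambda>x\<in>carrier A. a \<odot>\<^bsub>B\<^esub> h x) \<in> mod_hom R A B"
proof -
  interpret B: module R B by fact
  show ?thesis
  proof (rule mod_hom_restrictI[OF assms(1)])
    fix b x assume *: "b \<in> carrier R" "x \<in> carrier A"
    then have "a \<odot>\<^bsub>B\<^esub> (b \<odot>\<^bsub>B\<^esub> h x) = b \<odot>\<^bsub>B\<^esub> (a \<odot>\<^bsub>B\<^esub> h x)"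
      using assms(4) mod_hom_closed[OF assms(3)]
      by (metis B.smult_assoc1 B.R.m_comm)
    with * show "a \<odot>\<^bsub>B\<^esub> h (b \<odot>\<^bsub>A\<^esub> x) = b \<odot>\<^bsub>B\<^esub> (a \<odot>\<^bsub>B\<^esub> h x)"
      by (simp add: mod_hom_smult[OF assms(3)])
  qed (use assms in \<open>auto simp: mod_hom_closed mod_hom_add B.smult_r_distr\<close>)
qed

lemma mod_hom_zero_map:
  assumes "module R A" "module R B"
  shows "(\<lambda>x\<in>carrier A. \<zero>\<^bsub>B\<^esub>) \<in> mod_hom R A B"
proof -
  interpret B: module R B by fact
  show ?thesis by (rule mod_hom_restrictI[OF assms(1)]) auto
qed

lemma module_hom_module:
  assumes "module R A" "module R B"
  shows "module R (hom_module R A B)"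
proof -
  interpret A: module R A by fact
  interpret B: module R B by fact
  note cl = mod_hom_closed[of _ R A B]
  \<comment> \<open>The zero map and the pointwise sums are restricted to the carrier, so laws such
    as 0 + h = h have to be checked outside it as well, where both sides are
    \<open>undefined\<close>.\<close>
  have ext: "undefined = h x" if "h \<in> mod_hom R A B" "x \<notin> carrier A" for h x
    using that by (auto simp: mod_hom_def PiE_def extensional_def)
  show ?thesis
  proof (rule moduleI[OF A.R.cring_axioms])
    show "abelian_group (hom_module R A B)"
    proof (rule abelian_groupI)
      show "\<exists>y\<in>carrier (hom_module R A B). y \<oplus>\<^bsub>hom_module R A B\<^esub> x = \<zero>\<^bsub>hom_module R A B\<^esub>"
        if "x \<in> carrier (hom_module R A B)" for x
        using that cl
        by (intro bexI[of _ "\<lambda>t\<in>carrier A. \<ominus>\<^bsub>B\<^esub> x t"])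
           (auto intro!: mod_hom_uminus[OF assms] B.l_neg simp: fun_eq_iff)
    qed (use cl ext in \<open>auto intro!: mod_hom_sum[OF assms] mod_hom_zero_map[OF assms]
           simp: fun_eq_iff ext B.a_ac\<close>)
  qed (use cl ext in \<open>auto intro!: mod_hom_smult_map[OF assms] simp: fun_eq_iff ext
        B.smult_l_distr B.smult_r_distr B.smult_assoc1\<close>)
qed

lemma free_module_simps [simp]:
  "carrier (free_module R S) = {u \<in> S \<rightarrow>\<^sub>E carrier R. finite {i \<in> S. u i \<noteq> \<zero>\<^bsub>R\<^esub>}}"
  "zero (free_module R S) = (\<lambda>i\<in>S. \<zero>\<^bsub>R\<^esub>)"
  "u \<oplus>\<^bsub>free_module R S\<^esub> w = (\<lambda>i\<in>S. u i \<oplus>\<^bsub>R\<^esub> w i)"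
  "a \<odot>\<^bsub>free_module R S\<^esub> u = (\<lambda>i\<in>S. a \<otimes>\<^bsub>R\<^esub> u i)"
  by (simp_all add: free_module_def)

lemma module_free:
  assumes "cring R"
  shows "module R (free_module R S)"
proof -
  interpret R: cring R by fact
  have fin_add: "finite {i \<in> S. u i \<oplus>\<^bsub>R\<^esub> w i \<noteq> \<zero>\<^bsub>R\<^esub>}"
    if "finite {i \<in> S. u i \<noteq> \<zero>\<^bsub>R\<^esub>}" "finite {i \<in> S. w i \<noteq> \<zero>\<^bsub>R\<^esub>}" for u w
    by (rule finite_subset[OF _ finite_UnI[OF that]]) auto
  have fin_smult: "finite {i \<in> S. a \<otimes>\<^bsub>R\<^esub> u i \<noteq> \<zero>\<^bsub>R\<^esub>}"
    if "finite {i \<in> S. u i \<noteq> \<zero>\<^bsub>R\<^esub>}" "a \<in> carrier R" for u a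
    by (rule finite_subset[OF _ that(1)]) (use that in auto)
  have fin_neg: "finite {i \<in> S. \<ominus>\<^bsub>R\<^esub> u i \<noteq> \<zero>\<^bsub>R\<^esub>}"
    if "finite {i \<in> S. u i \<noteq> \<zero>\<^bsub>R\<^esub>}" for u
    by (rule finite_subset[OF _ that(1)]) auto
  \<comment> \<open>The supports of restricted functions appear with the membership test repeated;
    these equations remove the repetition.\<close>
  have fin_eq: "{i \<in> S. (i \<in> S \<longrightarrow> P i) \<and> i \<in> S} = {i \<in> S. P i}"
    "{i. i \<in> S \<and> (i \<in> S \<longrightarrow> P i)} = {i \<in> S. P i}" for P by auto
  show ?thesis
  proof (rule moduleI[OF assms])
    show "abelian_group (free_module R S)"
    proof (rule abelian_groupI)
      show "\<exists>y\<in>carrier (free_module R S). y \<oplus>\<^bsub>free_module R S\<^esub> x = \<zero>\<^bsub>free_module R S\<^esub>"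
        if "x \<in> carrier (free_module R S)" for x
      proof -
        have *: "x i \<in> carrier R" if "i \<in> S" for i
          using that \<open>x \<in> carrier (free_module R S)\<close> by auto
        show ?thesis
          by (rule bexI[of _ "\<lambda>i\<in>S. \<ominus>\<^bsub>R\<^esub> x i"])
             (use that fin_neg[of x] in \<open>auto simp: restrict_def fun_eq_iff R.l_neg * fin_eq
                PiE_iff extensional_def cong: conj_cong\<close>)
      qed
    qed (use fin_add in \<open>auto simp: R.a_ac fin_eq PiE_iff restrict_def fun_eq_iff extensional_def cong: conj_cong\<close>)
  qed (use fin_smult in \<open>auto simp: fin_eq PiE_iff restrict_def fun_eq_iff extensional_def
        R.l_distr R.r_distr R.m_assoc cong: conj_cong\<close>)
qed


lemma module_cring: "module R P \<Longrightarrow> cring R"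
  by (simp add: module_def)

text \<open>The existence half of the universal property of the free module. It supplies the
  retraction in \<open>dual_basis_projective\<close> and the surjection in
  \<open>free_cover\<close>.\<close>

lemma lin_comb_mod_hom:
  assumes A: "module R A" and y: "y \<in> S \<rightarrow> carrier A"
  shows "(\<lambda>u\<in>carrier (free_module R S). lin_comb R A S u y) \<in> mod_hom R (free_module R S) A"
proof (rule mod_hom_restrictI[OF module_free[OF module_cring[OF A]]])
  interpret A: module R A by fact
  show "lin_comb R A S u y \<in> carrier A" if "u \<in> carrier (free_module R S)" for u
    by (rule lin_comb_closed[OF A _ y]) (use that in auto)
  show "lin_comb R A S (u \<oplus>\<^bsub>free_module R S\<^esub> w) y = lin_comb R A S u y \<oplus>\<^bsub>A\<^esub> lin_comb R A S w y"
    if "u \<in> carrier (free_module R S)" "w \<in> carrier (free_module R S)" for u w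
  proof -
    have cl: "u i \<in> carrier R" "w i \<in> carrier R" if "i \<in> S" for i
      using that \<open>u \<in> _\<close> \<open>w \<in> _\<close> by auto
    have "lin_comb R A S (u \<oplus>\<^bsub>free_module R S\<^esub> w) y = lin_comb R A S (\<lambda>i. u i \<oplus>\<^bsub>R\<^esub> w i) y"
      by (rule lin_comb_cong[OF A]) (use cl y in auto)
    also have "\<dots> = lin_comb R A S u y \<oplus>\<^bsub>A\<^esub> lin_comb R A S w y"
      by (rule lin_comb_add[OF A]) (use that cl y in auto)
    finally show ?thesis .
  qed
  show "lin_comb R A S (a \<odot>\<^bsub>free_module R S\<^esub> u) y = a \<odot>\<^bsub>A\<^esub> lin_comb R A S u y"
    if "a \<in> carrier R" "u \<in> carrier (free_module R S)" for a u
  proof -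
    have cl: "u i \<in> carrier R" if "i \<in> S" for i
      using that \<open>u \<in> _\<close> by auto
    have "lin_comb R A S (a \<odot>\<^bsub>free_module R S\<^esub> u) y = lin_comb R A S (\<lambda>i. a \<otimes>\<^bsub>R\<^esub> u i) y"
      by (rule lin_comb_cong[OF A]) (use cl that y in auto)
    also have "\<dots> = a \<odot>\<^bsub>A\<^esub> lin_comb R A S u y"
      by (rule lin_comb_smult[OF A]) (use that cl y in auto)
    finally show ?thesis .
  qed
qed


section \<open>Dual bases and projectivity\<close>

text \<open>The dual basis form of projectivity. The index type is independent of the type of the
  elements, so that the dual of a module can keep the index set of the module.\<close>

definition dual_basis :: "('r, 'x) ring_scheme \<Rightarrow> ('r, 'p) module \<Rightarrow> 'j set \<Rightarrow> ('j \<Rightarrow> 'p) \<Rightarrow>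
    ('j \<Rightarrow> 'p \<Rightarrow> 'r) \<Rightarrow> bool" where
  "dual_basis R P J x f \<longleftrightarrow>
     x \<in> J \<rightarrow> carrier P \<and> (\<forall>j\<in>J. f j \<in> mod_hom R P (regular_module R)) \<and>
     (\<forall>p\<in>carrier P. finite {j \<in> J. f j p \<noteq> \<zero>\<^bsub>R\<^esub>} \<and> p = lin_comb R P J (\<lambda>j. f j p) x)"

lemma dual_basis_coeff_closed:
  "dual_basis R P J x f \<Longrightarrow> p \<in> carrier P \<Longrightarrow> (\<lambda>j. f j p) \<in> J \<rightarrow> carrier R"
proof
  fix j assume "dual_basis R P J x f" "p \<in> carrier P" "j \<in> J"
  then show "f j p \<in> carrier R"
    using mod_hom_closed[of "f j" R P "regular_module R" p] by (simp add: dual_basis_def)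
qed

text \<open>Preimages y_j of the g(x_j) under e are chosen, and p is sent to the sum of the f_j(p)
  y_j. Since e has to reach only the image of g, the target C may be an ambient module instead of a
  syzygy inside it.\<close>

lemma dual_basis_lift:
  fixes A :: "('r, 'a) module" and C :: "('r, 'c) module"
  assumes db: "dual_basis R P J x f" and mods: "module R P" "module R A" "module R C"
    and e: "e \<in> mod_hom R A C" and g: "g \<in> mod_hom R P C"
    and sub: "g ` carrier P \<subseteq> e ` carrier A"
  shows "\<exists>l\<in>mod_hom R P A. \<forall>p\<in>carrier P. e (l p) = g p"
proof -
  interpret P: module R P by fact
  have "\<forall>j\<in>J. \<exists>a. a \<in> carrier A \<and> e a = g (x j)"
    using sub db unfolding dual_basis_def by (fastforce simp: Pi_iff)
  then obtain y where y: "\<And>j. j \<in> J \<Longrightarrow> y j \<in> carrier A" "\<And>j. j \<in> J \<Longrightarrow> e (y j) = g (x j)"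
    by metis
  have yA: "y \<in> J \<rightarrow> carrier A" using y by auto
  have f: "f j \<in> mod_hom R P (regular_module R)" if "j \<in> J" for j
    using that db by (auto simp: dual_basis_def)
  have fcl: "(\<lambda>j. f j p) \<in> J \<rightarrow> carrier R" if "p \<in> carrier P" for p
    by (rule dual_basis_coeff_closed[OF db that])
  have fin: "finite {j \<in> J. f j p \<noteq> \<zero>\<^bsub>R\<^esub>}" if "p \<in> carrier P" for p
    using that db by (auto simp: dual_basis_def)
  let ?l = "\<lambda>p\<in>carrier P. lin_comb R A J (\<lambda>j. f j p) y"
  have l: "?l \<in> mod_hom R P A"
  proof (rule mod_hom_restrictI[OF mods(1)])
    show "lin_comb R A J (\<lambda>j. f j p) y \<in> carrier A" if "p \<in> carrier P" for p
      by (rule lin_comb_closed[OF mods(2) fcl[OF that] yA])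
    show "lin_comb R A J (\<lambda>j. f j (p \<oplus>\<^bsub>P\<^esub> q)) y
        = lin_comb R A J (\<lambda>j. f j p) y \<oplus>\<^bsub>A\<^esub> lin_comb R A J (\<lambda>j. f j q) y"
      if pq: "p \<in> carrier P" "q \<in> carrier P" for p q
    proof -
      have "lin_comb R A J (\<lambda>j. f j (p \<oplus>\<^bsub>P\<^esub> q)) y = lin_comb R A J (\<lambda>j. f j p \<oplus>\<^bsub>R\<^esub> f j q) y"
        by (rule lin_comb_cong[OF mods(2)])
           (use pq yA fcl[OF pq(1)] fcl[OF pq(2)] in \<open>auto simp: mod_hom_add[OF f] Pi_iff\<close>)
      also have "\<dots> = lin_comb R A J (\<lambda>j. f j p) y \<oplus>\<^bsub>A\<^esub> lin_comb R A J (\<lambda>j. f j q) y"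
        by (rule lin_comb_add) (use pq mods fin fcl yA in auto)
      finally show ?thesis .
    qed
    show "lin_comb R A J (\<lambda>j. f j (a \<odot>\<^bsub>P\<^esub> p)) y = a \<odot>\<^bsub>A\<^esub> lin_comb R A J (\<lambda>j. f j p) y"
      if ap: "a \<in> carrier R" "p \<in> carrier P" for a p
    proof -
      have "lin_comb R A J (\<lambda>j. f j (a \<odot>\<^bsub>P\<^esub> p)) y = lin_comb R A J (\<lambda>j. a \<otimes>\<^bsub>R\<^esub> f j p) y"
        by (rule lin_comb_cong[OF mods(2)])
           (use ap yA fcl[OF ap(2)] in \<open>auto simp: mod_hom_smult[OF f] Pi_iff\<close>)
      also have "\<dots> = a \<odot>\<^bsub>A\<^esub> lin_comb R A J (\<lambda>j. f j p) y"
        by (rule lin_comb_smult) (use ap mods fin fcl yA in auto)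
      finally show ?thesis .
    qed
  qed
  have "e (?l p) = g p" if p: "p \<in> carrier P" for p
  proof -
    have "e (?l p) = lin_comb R C J (\<lambda>j. f j p) (\<lambda>j. e (y j))"
      using p mod_hom_lin_comb[OF mods(2,3) e fin[OF p] fcl[OF p] yA] by simp
    also have "\<dots> = lin_comb R C J (\<lambda>j. f j p) (\<lambda>j. g (x j))"
      by (rule lin_comb_cong[OF mods(3)])
         (use p fcl[OF p] y db mod_hom_closed[OF g] in \<open>auto simp: dual_basis_def Pi_iff\<close>)
    also have "\<dots> = g (lin_comb R P J (\<lambda>j. f j p) x)"
      using db by (intro mod_hom_lin_comb[OF mods(1,3) g fin[OF p] fcl[OF p], symmetric])
         (auto simp: dual_basis_def)
    also have "lin_comb R P J (\<lambda>j. f j p) x = p"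
      using db p by (auto simp: dual_basis_def)
    finally show ?thesis .
  qed
  with l show ?thesis by blast
qed

definition std_vec :: "('r, 'x) ring_scheme \<Rightarrow> 'i set \<Rightarrow> 'i \<Rightarrow> 'i \<Rightarrow> 'r" where
  "std_vec R S i = (\<lambda>j\<in>S. if j = i then \<one>\<^bsub>R\<^esub> else \<zero>\<^bsub>R\<^esub>)"

lemma std_vec_closed:
  assumes "cring R" "i \<in> S"
  shows "std_vec R S i \<in> carrier (free_module R S)"
proof -
  interpret R: cring R by fact
  have "finite {j \<in> S. std_vec R S i j \<noteq> \<zero>\<^bsub>R\<^esub>}"
    by (rule finite_subset[of _ "{i}"]) (auto simp: std_vec_def split: if_splits)
  then show ?thesis by (auto simp: std_vec_def)
qed

lemma mod_hom_coordinate: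
  assumes "cring R" "i \<in> S"
  shows "(\<lambda>u\<in>carrier (free_module R S). u i) \<in> mod_hom R (free_module R S) (regular_module R)"
  by (rule mod_hom_restrictI[OF module_free[OF assms(1)]]) (use assms in auto)

lemma dual_basis_free:
  assumes "cring R"
  shows "dual_basis R (free_module R S) S (std_vec R S) (\<lambda>i. \<lambda>u\<in>carrier (free_module R S). u i)"
proof -
  interpret R: cring R by fact
  let ?F = "free_module R S"
  note mods = module_free[OF assms, of S] module_regular[OF assms]
  have sv: "std_vec R S \<in> S \<rightarrow> carrier ?F" by (rule Pi_I) (rule std_vec_closed[OF assms])
  have eq: "u = lin_comb R ?F S (\<lambda>i. (\<lambda>u\<in>carrier ?F. u i) u) (std_vec R S)"
    if u: "u \<in> carrier ?F" for u
  proof (rule extensionalityI[of _ S])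
    have cl: "u \<in> S \<rightarrow> carrier R" and fin: "finite {i \<in> S. u i \<noteq> \<zero>\<^bsub>R\<^esub>}" using u by auto
    have lc: "lin_comb R ?F S u (std_vec R S) \<in> carrier ?F"
      by (rule lin_comb_closed[OF mods(1) cl sv])
    have *: "(\<lambda>i. (\<lambda>u\<in>carrier ?F. u i) u) = u" by (rule ext) (simp only: restrict_apply' u)
    show "lin_comb R ?F S (\<lambda>i. (\<lambda>u\<in>carrier ?F. u i) u) (std_vec R S) \<in> extensional S"
      using lc unfolding * by (auto simp: PiE_def)
    show "u \<in> extensional S" using u by (auto simp: PiE_def)
    show "u i = lin_comb R ?F S (\<lambda>i. (\<lambda>u\<in>carrier ?F. u i) u) (std_vec R S) i" if i: "i \<in> S" for i
    proof -
      \<comment> \<open>Taking the coordinate i is itself a homomorphism, so it passes through the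
        linear combination.\<close>
      have "lin_comb R ?F S u (std_vec R S) i
          = (\<lambda>u\<in>carrier ?F. u i) (lin_comb R ?F S u (std_vec R S))"
        using lc by simp
      also have "\<dots> = lin_comb R (regular_module R) S u (\<lambda>j. (\<lambda>u\<in>carrier ?F. u i) (std_vec R S j))"
        by (rule mod_hom_lin_comb[OF mods mod_hom_coordinate[OF assms i] fin cl sv])
      also have "\<dots> = lin_comb R (regular_module R) S u (\<lambda>j. if i = j then \<one>\<^bsub>R\<^esub> else \<zero>\<^bsub>R\<^esub>)"
        by (rule lin_comb_cong[OF mods(2)])
           (use cl sv i in \<open>auto simp: std_vec_def Pi_iff\<close>)
      \<comment> \<open>The index i is added to the support because u i may be zero, and the sum
        with a single nonzero term needs i in its range.\<close>
      also have "\<dots> = (\<Oplus>\<^bsub>regular_module R\<^esub>j\<in>insert i {j \<in> S. u j \<noteq> \<zero>\<^bsub>R\<^esub>}.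
          u j \<odot>\<^bsub>regular_module R\<^esub> (if i = j then \<one>\<^bsub>R\<^esub> else \<zero>\<^bsub>R\<^esub>))"
        by (rule lin_comb_superset[OF mods(2)]) (use fin cl i in auto)
      also have "\<dots> = (\<Oplus>\<^bsub>R\<^esub>j\<in>insert i {j \<in> S. u j \<noteq> \<zero>\<^bsub>R\<^esub>}. if i = j then u j else \<zero>\<^bsub>R\<^esub>)"
        unfolding finsum_regular by (rule R.finsum_cong') (use cl i in \<open>auto simp: Pi_iff\<close>)
      also have "\<dots> = u i"
        by (rule R.finsum_singleton) (use cl i fin in auto)
      finally show ?thesis unfolding * by simp
    qed
  qed
  show ?thesis unfolding dual_basis_def
  proof (intro conjI ballI)
    show "finite {j \<in> S. (\<lambda>u\<in>carrier ?F. u j) p \<noteq> \<zero>\<^bsub>R\<^esub>}" if "p \<in> carrier ?F" for p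
      using that by auto
  qed (use sv eq mod_hom_coordinate[OF assms] in auto)
qed

text \<open>Vectors are pushed forward along the retraction r, functionals are pulled back along the
  section s.\<close>

lemma dual_basis_retract:
  assumes "dual_basis R F J x f" "module R F" "module R P"
    and s: "s \<in> mod_hom R P F" and r: "r \<in> mod_hom R F P" and rs: "\<And>p. p \<in> carrier P \<Longrightarrow> r (s p) = p"
  shows "dual_basis R P J (\<lambda>j. r (x j)) (\<lambda>j. compose (carrier P) (f j) s)"
proof -
  have db: "x \<in> J \<rightarrow> carrier F" "\<And>j. j \<in> J \<Longrightarrow> f j \<in> mod_hom R F (regular_module R)"
    "\<And>p. p \<in> carrier F \<Longrightarrow> finite {j \<in> J. f j p \<noteq> \<zero>\<^bsub>R\<^esub>} \<and> p = lin_comb R F J (\<lambda>j. f j p) x"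
    using assms(1) by (auto simp: dual_basis_def)
  show ?thesis unfolding dual_basis_def
  proof (intro conjI ballI)
    fix p assume p: "p \<in> carrier P"
    then have sp: "s p \<in> carrier F" using mod_hom_closed[OF s] by blast
    show "finite {j \<in> J. compose (carrier P) (f j) s p \<noteq> \<zero>\<^bsub>R\<^esub>}"
      using db(3)[OF sp] p by (simp add: compose_def)
    have "r (s p) = r (lin_comb R F J (\<lambda>j. f j (s p)) x)"
      using db(3)[OF sp] by simp
    also have "\<dots> = lin_comb R P J (\<lambda>j. f j (s p)) (\<lambda>j. r (x j))"
      using db(3)[OF sp] dual_basis_coeff_closed[OF assms(1) sp] db(1)
      by (intro mod_hom_lin_comb[OF assms(2,3) r]) auto
    finally show "p = lin_comb R P J (\<lambda>j. compose (carrier P) (f j) s p) (\<lambda>j. r (x j))"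
      using p rs[OF p] by (simp add: compose_def)
  qed (use db in \<open>auto intro: mod_hom_closed[OF r] mod_hom_compose[OF assms(3) s]\<close>)
qed

lemma projective_module: "projective R P \<Longrightarrow> module R P"
  by (simp add: projective_def)

lemma projective_dual_basis:
  fixes P :: "('r, 'p) module"
  assumes "projective R P"
  shows "\<exists>(J :: 'p set) x f. dual_basis R P J x f"
proof -
  obtain S :: "'p set" and s r where
    "s \<in> mod_hom R P (free_module R S)" "r \<in> mod_hom R (free_module R S) P"
    "\<And>x. x \<in> carrier P \<Longrightarrow> r (s x) = x"
    using assms unfolding projective_def by blast
  moreover have "module R P" "cring R"
    using projective_module[OF assms] module_cring by auto
  ultimately show ?thesis
    using dual_basis_retract[OF dual_basis_free] module_free by blast
qed

lemma dual_basis_reindex: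
  assumes db: "dual_basis R P J x f" and "module R P" "inj_on k J"
  shows "dual_basis R P (k ` J) (\<lambda>i. x (inv_into J k i)) (\<lambda>i. f (inv_into J k i))"
proof -
  have *: "inv_into J k (k j) = j" if "j \<in> J" for j using that assms(3) by simp
  have db': "x \<in> J \<rightarrow> carrier P" "\<And>j. j \<in> J \<Longrightarrow> f j \<in> mod_hom R P (regular_module R)"
    "\<And>p. p \<in> carrier P \<Longrightarrow> finite {j \<in> J. f j p \<noteq> \<zero>\<^bsub>R\<^esub>} \<and> p = lin_comb R P J (\<lambda>j. f j p) x"
    using assms(1) by (auto simp: dual_basis_def)
  show ?thesis unfolding dual_basis_def
  proof (intro conjI ballI)
    fix p assume p: "p \<in> carrier P"
    have "{i \<in> k ` J. f (inv_into J k i) p \<noteq> \<zero>\<^bsub>R\<^esub>} = k ` {j \<in> J. f j p \<noteq> \<zero>\<^bsub>R\<^esub>}"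
      using * by auto
    with db'(3)[OF p] show "finite {i \<in> k ` J. f (inv_into J k i) p \<noteq> \<zero>\<^bsub>R\<^esub>}" by simp
    have "lin_comb R P (k ` J) (\<lambda>i. f (inv_into J k i) p) (\<lambda>i. x (inv_into J k i))
        = lin_comb R P J (\<lambda>j. f (inv_into J k (k j)) p) (\<lambda>j. x (inv_into J k (k j)))"
      by (rule lin_comb_reindex[OF assms(2,3)])
         (use * db' dual_basis_coeff_closed[OF db p] in auto)
    also have "\<dots> = lin_comb R P J (\<lambda>j. f j p) x"
      by (rule lin_comb_cong[OF assms(2)])
         (use * db' dual_basis_coeff_closed[OF db p] in auto)
    also have "\<dots> = p" using db'(3)[OF p] by simp
    finally show "p = lin_comb R P (k ` J) (\<lambda>i. f (inv_into J k i) p) (\<lambda>i. x (inv_into J k i))" ..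
  qed (use * db' in auto)
qed

text \<open>\<open>projective\<close> wants the index set inside the element type of P, hence the
  injection k. The section sends p to its coordinates, the retraction is the linear combination of
  the vectors.\<close>

lemma dual_basis_projective:
  fixes P :: "('r, 'p) module" and k :: "'j \<Rightarrow> 'p"
  assumes "dual_basis R P J x f" "module R P" "inj_on k J"
  shows "projective R P"
proof -
  define S where "S = k ` J"
  obtain y g where db: "dual_basis R P S y g"
    using dual_basis_reindex[OF assms] unfolding S_def by blast
  note cr = module_cring[OF assms(2)]
  interpret R: cring R by (rule cr)
  have db': "y \<in> S \<rightarrow> carrier P" "\<And>j. j \<in> S \<Longrightarrow> g j \<in> mod_hom R P (regular_module R)"
    "\<And>p. p \<in> carrier P \<Longrightarrow> finite {j \<in> S. g j p \<noteq> \<zero>\<^bsub>R\<^esub>} \<and> p = lin_comb R P S (\<lambda>j. g j p) y"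
    using db by (auto simp: dual_basis_def)
  have gcl: "g i p \<in> carrier R" if "i \<in> S" "p \<in> carrier P" for i p
    using mod_hom_closed[OF db'(2)[OF that(1)] that(2)] by simp
  let ?s = "\<lambda>p\<in>carrier P. \<lambda>i\<in>S. g i p"
  let ?r = "\<lambda>u\<in>carrier (free_module R S). lin_comb R P S u y"
  have s: "?s \<in> mod_hom R P (free_module R S)"
    by (rule mod_hom_restrictI[OF assms(2)])
       (use gcl db' mod_hom_add[OF db'(2)] mod_hom_smult[OF db'(2)] in
         \<open>auto simp: fun_eq_iff cong: conj_cong\<close>)
  have r: "?r \<in> mod_hom R (free_module R S) P"
    by (rule lin_comb_mod_hom[OF assms(2) db'(1)])
  have rs: "?r (?s p) = p" if p: "p \<in> carrier P" for p
  proof -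
    have "?s p \<in> carrier (free_module R S)" using mod_hom_closed[OF s p] .
    then have "?r (?s p) = lin_comb R P S (?s p) y" by simp
    also have "\<dots> = lin_comb R P S (\<lambda>i. g i p) y"
      by (rule lin_comb_cong[OF assms(2)]) (use p gcl db' in auto)
    also have "\<dots> = p" using db'(3)[OF p] by simp
    finally show ?thesis .
  qed
  show ?thesis unfolding projective_def using assms(2) s r rs by blast
qed

text \<open>In \<open>fin_gen\<close> the sum runs over a set of elements and not over a family, so
  repeated vectors would be counted once; this is why x has to be injective on J.\<close>

lemma dual_basis_fin_gen:
  assumes "dual_basis R P J x f" "module R P" "finite J" "inj_on x J"
  shows "fin_gen R P"
  unfolding fin_gen_def
proof (intro exI conjI ballI)
  show "finite (x ` J)" using assms(3) by simp
  show "x ` J \<subseteq> carrier P" using assms(1) by (auto simp: dual_basis_def)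
  fix p assume p: "p \<in> carrier P"
  interpret P: module R P by fact
  have x: "x \<in> J \<rightarrow> carrier P" using assms(1) by (auto simp: dual_basis_def)
  have cl: "(\<lambda>j. f j p) \<in> J \<rightarrow> carrier R" by (rule dual_basis_coeff_closed[OF assms(1) p])
  show "\<exists>c\<in>x ` J \<rightarrow> carrier R. p = (\<Oplus>\<^bsub>P\<^esub>s\<in>x ` J. c s \<odot>\<^bsub>P\<^esub> s)"
  proof (rule bexI[of _ "\<lambda>s. f (inv_into J x s) p"])
    have "(\<Oplus>\<^bsub>P\<^esub>s\<in>x ` J. f (inv_into J x s) p \<odot>\<^bsub>P\<^esub> s)
        = (\<Oplus>\<^bsub>P\<^esub>j\<in>J. f (inv_into J x (x j)) p \<odot>\<^bsub>P\<^esub> x j)"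
      by (rule P.finsum_reindex) (use assms(4) cl x in \<open>auto simp: Pi_iff\<close>)
    also have "\<dots> = (\<Oplus>\<^bsub>P\<^esub>j\<in>J. f j p \<odot>\<^bsub>P\<^esub> x j)"
      by (rule P.finsum_cong') (use assms(4) cl x in \<open>auto simp: Pi_iff\<close>)
    also have "\<dots> = lin_comb R P J (\<lambda>j. f j p) x"
      by (rule lin_comb_finite[OF assms(2,3) cl x, symmetric])
    also have "\<dots> = p" using assms(1) p by (auto simp: dual_basis_def)
    finally show "p = (\<Oplus>\<^bsub>P\<^esub>s\<in>x ` J. f (inv_into J x s) p \<odot>\<^bsub>P\<^esub> s)" ..
    show "(\<lambda>s. f (inv_into J x s) p) \<in> x ` J \<rightarrow> carrier R"
      using cl assms(4) by auto
  qed
qed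

text \<open>A functional f_j that vanishes on a generating set is zero. Each of the finitely many
  generators has finitely many nonzero coordinates, so only finitely many f_j survive.\<close>

lemma fin_gen_dual_basis_finite:
  assumes db: "dual_basis R P J x f" and P: "module R P" and fg: "fin_gen R P"
  obtains J' where "finite J'" "dual_basis R P J' x f"
proof -
  interpret P: module R P by fact
  obtain G where G: "finite G" "G \<subseteq> carrier P"
    "\<And>p. p \<in> carrier P \<Longrightarrow> \<exists>c\<in>G \<rightarrow> carrier R. p = (\<Oplus>\<^bsub>P\<^esub>s\<in>G. c s \<odot>\<^bsub>P\<^esub> s)"
    using fg unfolding fin_gen_def by blast
  have db': "x \<in> J \<rightarrow> carrier P" "\<And>j. j \<in> J \<Longrightarrow> f j \<in> mod_hom R P (regular_module R)"
    "\<And>p. p \<in> carrier P \<Longrightarrow> finite {j \<in> J. f j p \<noteq> \<zero>\<^bsub>R\<^esub>} \<and> p = lin_comb R P J (\<lambda>j. f j p) x"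
    using db by (auto simp: dual_basis_def)
  note reg = module_regular[OF P.R.cring_axioms]
  define J' where "J' = (\<Union>s\<in>G. {j \<in> J. f j s \<noteq> \<zero>\<^bsub>R\<^esub>})"
  have fin: "finite J'" unfolding J'_def using G db' by blast
  have J': "J' \<subseteq> J" by (auto simp: J'_def)
  have zero: "f j p = \<zero>\<^bsub>R\<^esub>" if j: "j \<in> J" "j \<notin> J'" and p: "p \<in> carrier P" for j p
  proof -
    obtain c where c: "c \<in> G \<rightarrow> carrier R" "p = (\<Oplus>\<^bsub>P\<^esub>s\<in>G. c s \<odot>\<^bsub>P\<^esub> s)"
      using G(3)[OF p] by blast
    have "f j p = (\<Oplus>\<^bsub>regular_module R\<^esub>s\<in>G. f j (c s \<odot>\<^bsub>P\<^esub> s))"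
      unfolding c(2) by (rule mod_hom_finsum[OF P reg db'(2)[OF j(1)] G(1)]) (use c G in auto)
    also have "\<dots> = (\<Oplus>\<^bsub>R\<^esub>s\<in>G. \<zero>\<^bsub>R\<^esub>)" unfolding finsum_regular
    proof (rule P.R.finsum_cong')
      fix s assume s: "s \<in> G"
      then have "f j s = \<zero>\<^bsub>R\<^esub>" using j by (auto simp: J'_def)
      then show "f j (c s \<odot>\<^bsub>P\<^esub> s) = \<zero>\<^bsub>R\<^esub>"
        using mod_hom_smult[OF db'(2)[OF j(1)], of "c s" s] s c G by auto
    qed auto
    finally show ?thesis by simp
  qed
  have supp: "{j \<in> J. f j p \<noteq> \<zero>\<^bsub>R\<^esub>} = {j \<in> J'. f j p \<noteq> \<zero>\<^bsub>R\<^esub>}" if "p \<in> carrier P" for p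
    using zero that J' by auto
  have "dual_basis R P J' x f"
    unfolding dual_basis_def
  proof (intro conjI ballI)
    fix p assume p: "p \<in> carrier P"
    show "p = lin_comb R P J' (\<lambda>j. f j p) x"
      using db'(3)[OF p] supp[OF p] by (simp add: lin_comb_def)
  qed (use db' J' fin in auto)
  with fin show ?thesis by (rule that)
qed

abbreviation dual_module :: "('r, 'x) ring_scheme \<Rightarrow> ('r, 'p) module \<Rightarrow> ('r, 'p \<Rightarrow> 'r) module" where
  "dual_module R P \<equiv> hom_module R P (regular_module R)"

text \<open>Vectors and functionals exchange roles: h is the sum of the h(x_j) f_j over the finite
  set J, which is checked by evaluation at each p. This makes the dual usable in lifting
  arguments.\<close>

lemma dual_basis_dual:
  assumes db: "dual_basis R P J x f" and P: "module R P" and J: "finite J"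
  shows "dual_basis R (dual_module R P) J f (\<lambda>j. \<lambda>h\<in>carrier (dual_module R P). h (x j))"
proof -
  interpret P: module R P by fact
  note cr = P.R.cring_axioms
  note reg = module_regular[OF cr]
  note D = module_hom_module[OF P reg]
  have db': "x \<in> J \<rightarrow> carrier P" "\<And>j. j \<in> J \<Longrightarrow> f j \<in> mod_hom R P (regular_module R)"
    "\<And>p. p \<in> carrier P \<Longrightarrow> p = lin_comb R P J (\<lambda>j. f j p) x"
    using db by (auto simp: dual_basis_def)
  have ev: "(\<lambda>h\<in>carrier (dual_module R P). h p) \<in> mod_hom R (dual_module R P) (regular_module R)"
    if p: "p \<in> carrier P" for p
    by (rule mod_hom_restrictI[OF D]) (use p in \<open>auto dest: mod_hom_closed\<close>)
  have fJ: "f \<in> J \<rightarrow> carrier (dual_module R P)" using db' by auto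
  show ?thesis unfolding dual_basis_def
  proof (intro conjI ballI)
    fix h assume h: "h \<in> carrier (dual_module R P)"
    then have h': "h \<in> mod_hom R P (regular_module R)" by simp
    note hc = mod_hom_closed[OF h', simplified]
    let ?c = "\<lambda>j. h (x j)"
    have ceq: "(\<lambda>j. (\<lambda>h\<in>carrier (dual_module R P). h (x j)) h) = ?c" using h by auto
    have cc: "?c \<in> J \<rightarrow> carrier R" using hc db'(1) by (simp add: Pi_iff)
    have lc: "lin_comb R (dual_module R P) J ?c f \<in> carrier (dual_module R P)"
      by (rule lin_comb_closed[OF D cc fJ])
    show "h = lin_comb R (dual_module R P) J (\<lambda>j. (\<lambda>h\<in>carrier (dual_module R P). h (x j)) h) f"
      unfolding ceq
    proof (rule mod_hom_eqI[OF h' lc[unfolded hom_module_simps(1)]])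
      fix p assume p: "p \<in> carrier P"
      have fp: "(\<lambda>j. f j p) \<in> J \<rightarrow> carrier R" by (rule dual_basis_coeff_closed[OF db p])
      have "lin_comb R (dual_module R P) J ?c f p
          = (\<lambda>h\<in>carrier (dual_module R P). h p) (lin_comb R (dual_module R P) J ?c f)"
        using lc by simp
      also have "\<dots> = lin_comb R (regular_module R) J ?c (\<lambda>j. (\<lambda>h\<in>carrier (dual_module R P). h p) (f j))"
        by (rule mod_hom_lin_comb[OF D reg ev[OF p]]) (use J cc fJ in auto)
      also have "\<dots> = (\<Oplus>\<^bsub>R\<^esub>j\<in>J. ?c j \<otimes>\<^bsub>R\<^esub> (\<lambda>h\<in>carrier (dual_module R P). h p) (f j))"
        using fp db'(2)
        by (subst lin_comb_finite[OF reg J cc]) (auto simp: finsum_regular Pi_iff)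
      also have "\<dots> = (\<Oplus>\<^bsub>R\<^esub>j\<in>J. f j p \<otimes>\<^bsub>R\<^esub> h (x j))"
        using fp db' hc h by (intro P.R.finsum_cong') (auto simp: P.R.m_comm Pi_iff)
      also have "\<dots> = lin_comb R (regular_module R) J (\<lambda>j. f j p) (\<lambda>j. h (x j))"
        using fp db' hc
        by (subst lin_comb_finite[OF reg J fp]) (auto simp: finsum_regular Pi_iff)
      also have "\<dots> = h (lin_comb R P J (\<lambda>j. f j p) x)"
        by (rule mod_hom_lin_comb[OF P reg h' _ fp db'(1), symmetric]) (use J in auto)
      also have "\<dots> = h p" using db'(3)[OF p] by simp
      finally show "h p = lin_comb R (dual_module R P) J ?c f p" ..
    qed
  qed (use J fJ ev db' in auto)
qed


section \<open>Stable retracts\<close>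

text \<open>
  The identity of \<open>K\<close> is \<open>\<alpha> \<beta>\<close> up to a map which factors through \<open>P\<close>. So if \<open>P\<close> is
  projective, then \<open>K\<close> is a direct summand of \<open>K'\<close> up to projective summands.
\<close>

definition stable_retract :: "('r, 'x) ring_scheme \<Rightarrow> ('r, 'p) module \<Rightarrow> 'p set \<Rightarrow>
    ('r, 'q) module \<Rightarrow> 'q set \<Rightarrow> bool" where
  "stable_retract R P K P' K' \<longleftrightarrow>
     (\<exists>\<alpha>\<in>mod_hom R P' P. \<exists>\<beta>\<in>mod_hom R P P'. \<exists>h\<in>mod_hom R P P.
        \<beta> ` K \<subseteq> K' \<and> \<alpha> ` K' \<subseteq> K \<and> h ` carrier P \<subseteq> K \<and> (\<forall>x\<in>K. x = \<alpha> (\<beta> x) \<oplus>\<^bsub>P\<^esub> h x))"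

text \<open>For projective P and a submodule K this is the vanishing of Ext^1(P/K, B). The submodule
  is a bare set, which gets its structure by a change of the carrier of P.\<close>

definition homs_extend :: "('r, 'x) ring_scheme \<Rightarrow> ('r, 'p) module \<Rightarrow> 'p set \<Rightarrow>
    ('r, 'b) module \<Rightarrow> bool" where
  "homs_extend R P K B \<longleftrightarrow>
     (\<forall>\<theta>\<in>mod_hom R (P\<lparr>carrier := K\<rparr>) B. \<exists>\<Theta>\<in>mod_hom R P B. \<forall>x\<in>K. \<Theta> x = \<theta> x)"

lemma stable_retractE:
  assumes "stable_retract R P K P' K'"
  obtains \<alpha> \<beta> h where "\<alpha> \<in> mod_hom R P' P" "\<beta> \<in> mod_hom R P P'" "h \<in> mod_hom R P P"
    "\<beta> ` K \<subseteq> K'" "\<alpha> ` K' \<subseteq> K" "h ` carrier P \<subseteq> K" "\<And>x. x \<in> K \<Longrightarrow> x = \<alpha> (\<beta> x) \<oplus>\<^bsub>P\<^esub> h x"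
  using assms unfolding stable_retract_def
  by (elim bexE conjE) (rule that, assumption+, erule (1) bspec)

lemma stable_retractI:
  assumes "\<alpha> \<in> mod_hom R P' P" "\<beta> \<in> mod_hom R P P'" "h \<in> mod_hom R P P"
    "\<beta> ` K \<subseteq> K'" "\<alpha> ` K' \<subseteq> K" "h ` carrier P \<subseteq> K" "\<And>x. x \<in> K \<Longrightarrow> x = \<alpha> (\<beta> x) \<oplus>\<^bsub>P\<^esub> h x"
  shows "stable_retract R P K P' K'"
  unfolding stable_retract_def by (intro bexI conjI ballI) (fact assms)+

text \<open>Substituting y = \<alpha>' (\<beta>' y) + h' y at y = \<beta> x yields the new error
  term \<alpha> h' \<beta> + h. It maps P into K because h' maps all of P' into K' and \<alpha> maps
  K' into K.\<close>

lemma stable_retract_trans: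
  assumes mods: "module R P" "module R P'" "module R P''"
    and K: "submodule K R P" and K': "K' \<subseteq> carrier P'" "K'' \<subseteq> carrier P''"
    and "stable_retract R P K P' K'" "stable_retract R P' K' P'' K''"
  shows "stable_retract R P K P'' K''"
proof -
  interpret P: module R P by fact
  obtain \<alpha> \<beta> h where 1: "\<alpha> \<in> mod_hom R P' P" "\<beta> \<in> mod_hom R P P'" "h \<in> mod_hom R P P"
    "\<beta> ` K \<subseteq> K'" "\<alpha> ` K' \<subseteq> K" "h ` carrier P \<subseteq> K" "\<And>x. x \<in> K \<Longrightarrow> x = \<alpha> (\<beta> x) \<oplus>\<^bsub>P\<^esub> h x"
    by (rule stable_retractE[OF assms(7)]) (rule that)
  obtain \<alpha>' \<beta>' h' where 2: "\<alpha>' \<in> mod_hom R P'' P'" "\<beta>' \<in> mod_hom R P' P''" "h' \<in> mod_hom R P' P'"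
    "\<beta>' ` K' \<subseteq> K''" "\<alpha>' ` K'' \<subseteq> K'" "h' ` carrier P' \<subseteq> K'"
    "\<And>x. x \<in> K' \<Longrightarrow> x = \<alpha>' (\<beta>' x) \<oplus>\<^bsub>P'\<^esub> h' x"
    by (rule stable_retractE[OF assms(8)]) (rule that)
  note cl = mod_hom_closed[OF 1(1)] mod_hom_closed[OF 1(2)] mod_hom_closed[OF 1(3)]
    mod_hom_closed[OF 2(1)] mod_hom_closed[OF 2(2)] mod_hom_closed[OF 2(3)]
  note Ksub = submodule_subset[OF K]
  let ?a = "compose (carrier P'') \<alpha> \<alpha>'"
  let ?b = "compose (carrier P) \<beta>' \<beta>"
  let ?h1 = "compose (carrier P) \<alpha> (compose (carrier P) h' \<beta>)"
  let ?h = "\<lambda>x\<in>carrier P. ?h1 x \<oplus>\<^bsub>P\<^esub> h x"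
  have "?a \<in> mod_hom R P'' P" "?b \<in> mod_hom R P P''"
    using mod_hom_compose[OF mods(3) 2(1) 1(1)] mod_hom_compose[OF mods(1) 1(2) 2(2)] by auto
  moreover have "?h \<in> mod_hom R P P"
    using mod_hom_sum[OF mods(1,1)
      mod_hom_compose[OF mods(1) mod_hom_compose[OF mods(1) 1(2) 2(3)] 1(1)] 1(3)] .
  moreover have "?b ` K \<subseteq> K''" using 1(4) 2(4) Ksub by (auto simp: compose_def)
  moreover have "?a ` K'' \<subseteq> K"
    using K'(2) 1(5) 2(5) by (auto simp: compose_def image_subset_iff subset_iff)
  moreover have "?h ` carrier P \<subseteq> K"
    using 1(5,6) 2(6) cl P.submoduleE(5)[OF K] by (simp add: compose_def image_subset_iff)
  moreover have "x = ?a (?b x) \<oplus>\<^bsub>P\<^esub> ?h x" if x: "x \<in> K" for x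
  proof -
    have xP: "x \<in> carrier P" and bK: "\<beta> x \<in> K'" using x Ksub 1(4) by auto
    then have bP: "\<beta> x \<in> carrier P'" using K' by auto
    have "x = \<alpha> (\<beta> x) \<oplus>\<^bsub>P\<^esub> h x" by (rule 1(7)[OF x])
    also have "\<alpha> (\<beta> x) = \<alpha> (\<alpha>' (\<beta>' (\<beta> x)) \<oplus>\<^bsub>P'\<^esub> h' (\<beta> x))" using 2(7)[OF bK] by simp
    also have "\<dots> = \<alpha> (\<alpha>' (\<beta>' (\<beta> x))) \<oplus>\<^bsub>P\<^esub> \<alpha> (h' (\<beta> x))"
      by (rule mod_hom_add[OF 1(1)]) (use bP cl in auto)
    finally show ?thesis using xP bP cl by (simp add: compose_def P.a_assoc)
  qed
  ultimately show ?thesis by (intro stable_retractI)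
qed

text \<open>A homomorphism \<theta> on K is pulled back along \<alpha> and extended from K' to
  \<Theta> on P'; then \<Theta> \<beta> + \<theta> h extends \<theta>. The second term is defined on
  all of P because h maps P into K.\<close>

lemma homs_extend_stable_retract:
  assumes mods: "module R P" "module R P'" "module R B"
    and K: "submodule K R P" and K': "submodule K' R P'"
    and sr: "stable_retract R P K P' K'" and ext: "homs_extend R P' K' B"
  shows "homs_extend R P K B"
  unfolding homs_extend_def
proof
  interpret P: module R P by fact
  interpret P': module R P' by fact
  obtain \<alpha> \<beta> h where 1: "\<alpha> \<in> mod_hom R P' P" "\<beta> \<in> mod_hom R P P'" "h \<in> mod_hom R P P"
    "\<beta> ` K \<subseteq> K'" "\<alpha> ` K' \<subseteq> K" "h ` carrier P \<subseteq> K" "\<And>x. x \<in> K \<Longrightarrow> x = \<alpha> (\<beta> x) \<oplus>\<^bsub>P\<^esub> h x"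
    by (rule stable_retractE[OF sr]) (rule that)
  fix \<theta> assume \<theta>: "\<theta> \<in> mod_hom R (P\<lparr>carrier := K\<rparr>) B"
  note Ksub = submodule_subset[OF K] submodule_subset[OF K']
  note PK = submodule_carrier_update[OF K mods(1)] submodule_carrier_update[OF K' mods(2)]
  have \<alpha>K: "restrict \<alpha> K' \<in> mod_hom R (P'\<lparr>carrier := K'\<rparr>) (P\<lparr>carrier := K\<rparr>)"
    using mod_hom_restrict_domain[OF K' mods(2) 1(1)] 1(5)
    by (intro mod_hom_codomain_restrict) auto
  have "compose K' \<theta> (restrict \<alpha> K') \<in> mod_hom R (P'\<lparr>carrier := K'\<rparr>) B"
    using mod_hom_compose[OF PK(2) \<alpha>K \<theta>] by simp
  then obtain \<Theta> where \<Theta>: "\<Theta> \<in> mod_hom R P' B" "\<And>y. y \<in> K' \<Longrightarrow> \<Theta> y = \<theta> (\<alpha> y)"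
    using ext unfolding homs_extend_def by (force simp: compose_def)
  let ?\<Theta> = "\<lambda>x\<in>carrier P. compose (carrier P) \<Theta> \<beta> x \<oplus>\<^bsub>B\<^esub> compose (carrier P) \<theta> h x"
  have hK: "h \<in> mod_hom R P (P\<lparr>carrier := K\<rparr>)"
    by (rule mod_hom_codomain_restrict[OF 1(3,6)])
  have "?\<Theta> \<in> mod_hom R P B"
    by (rule mod_hom_sum[OF mods(1,3) mod_hom_compose[OF mods(1) 1(2) \<Theta>(1)]
          mod_hom_compose[OF mods(1) hK \<theta>]])
  moreover have "?\<Theta> x = \<theta> x" if x: "x \<in> K" for x
  proof -
    have xP: "x \<in> carrier P" and bK: "\<beta> x \<in> K'" using x Ksub 1(4) by auto
    have "\<theta> x = \<theta> (\<alpha> (\<beta> x) \<oplus>\<^bsub>P\<^esub> h x)" using 1(7)[OF x] by simp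
    also have "\<dots> = \<theta> (\<alpha> (\<beta> x)) \<oplus>\<^bsub>B\<^esub> \<theta> (h x)"
      using mod_hom_add[OF \<theta>, of "\<alpha> (\<beta> x)" "h x"] bK xP 1(5,6) by auto
    finally show ?thesis using xP \<Theta>(2)[OF bK] by (simp add: compose_def)
  qed
  ultimately show "\<exists>\<Theta>\<in>mod_hom R P B. \<forall>x\<in>K. \<Theta> x = \<theta> x" by blast
qed

lemma mod_hom_minus:
  assumes "module R A" "module R B" "h \<in> mod_hom R A B" "k \<in> mod_hom R A B"
  shows "(\<lambda>x\<in>carrier A. h x \<ominus>\<^bsub>B\<^esub> k x) \<in> mod_hom R A B"
proof -
  have "(\<lambda>x\<in>carrier A. h x \<oplus>\<^bsub>B\<^esub> (\<lambda>x\<in>carrier A. \<ominus>\<^bsub>B\<^esub> k x) x) \<in> mod_hom R A B"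
    by (intro mod_hom_sum mod_hom_uminus assms)
  also have "(\<lambda>x\<in>carrier A. h x \<oplus>\<^bsub>B\<^esub> (\<lambda>x\<in>carrier A. \<ominus>\<^bsub>B\<^esub> k x) x) = (\<lambda>x\<in>carrier A. h x \<ominus>\<^bsub>B\<^esub> k x)"
    by (auto simp: a_minus_def fun_eq_iff)
  finally show ?thesis .
qed

lemma mod_hom_map_minus:
  assumes "module R A" "module R B" "h \<in> mod_hom R A B" "x \<in> carrier A" "y \<in> carrier A"
  shows "h (x \<ominus>\<^bsub>A\<^esub> y) = h x \<ominus>\<^bsub>B\<^esub> h y"
proof -
  interpret A: module R A by fact
  show ?thesis
    using assms by (simp add: a_minus_def mod_hom_add[OF assms(3)] mod_hom_a_inv)
qed

lemma module_add_minus: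
  assumes "module R A" "x \<in> carrier A" "y \<in> carrier A"
  shows "x = y \<oplus>\<^bsub>A\<^esub> (x \<ominus>\<^bsub>A\<^esub> y)"
proof -
  interpret A: module R A by fact
  have "y \<oplus>\<^bsub>A\<^esub> (x \<ominus>\<^bsub>A\<^esub> y) = x \<oplus>\<^bsub>A\<^esub> (y \<oplus>\<^bsub>A\<^esub> \<ominus>\<^bsub>A\<^esub> y)"
    using assms by (simp add: a_minus_def A.a_lcomm)
  then show ?thesis using assms by (simp add: A.r_neg)
qed

lemma module_minus_self:
  assumes "module R A" "x \<in> carrier A"
  shows "x \<ominus>\<^bsub>A\<^esub> x = \<zero>\<^bsub>A\<^esub>"
proof -
  interpret A: module R A by fact
  show ?thesis using assms by (simp add: a_minus_def A.r_neg)
qed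

text \<open>The argument of Schanuel's lemma: the images agree, so e and e' lift along each other,
  and id - \<alpha> \<beta> maps P into Ker e because e \<alpha> \<beta> = e.\<close>

lemma stable_retract_covers:
  fixes T :: "('r, 't) module"
  assumes mods: "module R P" "module R P'" "module R T"
    and db: "dual_basis R P J x f" "dual_basis R P' J' x' f'"
    and e: "e \<in> mod_hom R P T" and e': "e' \<in> mod_hom R P' T"
    and im: "e ` carrier P = e' ` carrier P'"
  shows "stable_retract R P (a_kernel P T e) P' (a_kernel P' T e')"
proof -
  interpret P: module R P by fact
  obtain \<beta> where \<beta>: "\<beta> \<in> mod_hom R P P'" "\<And>p. p \<in> carrier P \<Longrightarrow> e' (\<beta> p) = e p"
    using dual_basis_lift[OF db(1) mods(1,2,3) e' e] im by auto
  obtain \<alpha> where \<alpha>: "\<alpha> \<in> mod_hom R P' P" "\<And>p. p \<in> carrier P' \<Longrightarrow> e (\<alpha> p) = e' p"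
    using dual_basis_lift[OF db(2) mods(2,1,3) e e'] im by auto
  note cl = mod_hom_closed[OF \<alpha>(1)] mod_hom_closed[OF \<beta>(1)] mod_hom_closed[OF e]
  let ?h = "\<lambda>x\<in>carrier P. (\<lambda>x\<in>carrier P. x) x \<ominus>\<^bsub>P\<^esub> compose (carrier P) \<alpha> \<beta> x"
  have h: "?h \<in> mod_hom R P P"
    by (intro mod_hom_minus mods mod_hom_id mod_hom_compose[OF mods(1) \<beta>(1) \<alpha>(1)])
  have hx: "?h x = x \<ominus>\<^bsub>P\<^esub> \<alpha> (\<beta> x)" if "x \<in> carrier P" for x
    using that by (simp add: compose_def)
  have hK: "?h ` carrier P \<subseteq> a_kernel P T e"
  proof
    fix y assume "y \<in> ?h ` carrier P"
    then obtain x where x: "x \<in> carrier P" "y = x \<ominus>\<^bsub>P\<^esub> \<alpha> (\<beta> x)" using hx by auto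
    then have "e y = e x \<ominus>\<^bsub>T\<^esub> e (\<alpha> (\<beta> x))"
      using cl by (auto intro: mod_hom_map_minus[OF mods(1,3) e])
    also have "\<dots> = \<zero>\<^bsub>T\<^esub>"
      using x cl module_minus_self[OF mods(3)] by (simp add: \<alpha> \<beta>)
    finally show "y \<in> a_kernel P T e" using x cl by (simp add: a_kernel_def')
  qed
  have bK: "\<beta> ` a_kernel P T e \<subseteq> a_kernel P' T e'" "\<alpha> ` a_kernel P' T e' \<subseteq> a_kernel P T e"
    using cl \<alpha>(2) \<beta>(2) by (auto simp: a_kernel_def')
  have "x = \<alpha> (\<beta> x) \<oplus>\<^bsub>P\<^esub> ?h x" if "x \<in> a_kernel P T e" for x
  proof -
    have "x \<in> carrier P" using that by (auto simp: a_kernel_def')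
    then show ?thesis using hx cl module_add_minus[OF mods(1)] by simp
  qed
  with bK hK h \<alpha>(1) \<beta>(1) show ?thesis by (intro stable_retractI)
qed

text \<open>The comparison maps and the error term h lift to \<alpha>2, \<beta>2 and \<tau>, with d
  \<tau> = h. Subtracting \<tau> d makes id - \<alpha>2 \<beta>2 - \<tau> d land in Ker d on all of
  \<open>P2\<close>; on Ker d the term \<tau> d vanishes, so there the identity is \<alpha>2
  \<beta>2 plus this map.\<close>

lemma stable_retract_syzygy:
  assumes mods: "module R P" "module R P2" "module R P'" "module R P2'"
    and db: "dual_basis R P J x f" "dual_basis R P2 J2 x2 f2" "dual_basis R P2' J2' x2' f2'"
    and d: "d \<in> mod_hom R P2 P" and d': "d' \<in> mod_hom R P2' P'"
    and sr: "stable_retract R P (d ` carrier P2) P' (d' ` carrier P2')"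
  shows "stable_retract R P2 (a_kernel P2 P d) P2' (a_kernel P2' P' d')"
proof -
  interpret P2: module R P2 by fact
  interpret P: module R P by fact
  let ?K = "d ` carrier P2" and ?K' = "d' ` carrier P2'"
  obtain \<alpha> \<beta> h where 1: "\<alpha> \<in> mod_hom R P' P" "\<beta> \<in> mod_hom R P P'" "h \<in> mod_hom R P P"
    "\<beta> ` ?K \<subseteq> ?K'" "\<alpha> ` ?K' \<subseteq> ?K" "h ` carrier P \<subseteq> ?K" "\<And>x. x \<in> ?K \<Longrightarrow> x = \<alpha> (\<beta> x) \<oplus>\<^bsub>P\<^esub> h x"
    by (rule stable_retractE[OF sr]) (rule that)
  have bd: "compose (carrier P2) \<beta> d \<in> mod_hom R P2 P'"
    by (rule mod_hom_compose[OF mods(2) d 1(2)])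
  have ad: "compose (carrier P2') \<alpha> d' \<in> mod_hom R P2' P"
    by (rule mod_hom_compose[OF mods(4) d' 1(1)])
  obtain \<beta>2 where \<beta>2: "\<beta>2 \<in> mod_hom R P2 P2'" "\<And>p. p \<in> carrier P2 \<Longrightarrow> d' (\<beta>2 p) = \<beta> (d p)"
    using dual_basis_lift[OF db(2) mods(2,4,3) d' bd] 1(4) by (auto simp: compose_def image_subset_iff)
  obtain \<alpha>2 where \<alpha>2: "\<alpha>2 \<in> mod_hom R P2' P2" "\<And>p. p \<in> carrier P2' \<Longrightarrow> d (\<alpha>2 p) = \<alpha> (d' p)"
    using dual_basis_lift[OF db(3) mods(4,2,1) d ad] 1(5) by (auto simp: compose_def image_subset_iff)
  obtain \<tau> where \<tau>: "\<tau> \<in> mod_hom R P P2" "\<And>p. p \<in> carrier P \<Longrightarrow> d (\<tau> p) = h p"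
    using dual_basis_lift[OF db(1) mods(1,2,1) d 1(3) 1(6)] by auto
  note cl = mod_hom_closed[OF 1(1)] mod_hom_closed[OF 1(2)] mod_hom_closed[OF 1(3)]
    mod_hom_closed[OF d] mod_hom_closed[OF d'] mod_hom_closed[OF \<alpha>2(1)] mod_hom_closed[OF \<beta>2(1)]
    mod_hom_closed[OF \<tau>(1)]
  let ?g = "\<lambda>x\<in>carrier P2. compose (carrier P2) \<alpha>2 \<beta>2 x \<oplus>\<^bsub>P2\<^esub> compose (carrier P2) \<tau> d x"
  let ?h = "\<lambda>x\<in>carrier P2. (\<lambda>x\<in>carrier P2. x) x \<ominus>\<^bsub>P2\<^esub> ?g x"
  have h: "?h \<in> mod_hom R P2 P2"
    by (intro mod_hom_minus mods mod_hom_id mod_hom_sum mod_hom_compose[OF mods(2) \<beta>2(1) \<alpha>2(1)]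
        mod_hom_compose[OF mods(2) d \<tau>(1)])
  have hx: "?h x = x \<ominus>\<^bsub>P2\<^esub> (\<alpha>2 (\<beta>2 x) \<oplus>\<^bsub>P2\<^esub> \<tau> (d x))" if "x \<in> carrier P2" for x
    using that by (simp add: compose_def)
  have hK: "?h ` carrier P2 \<subseteq> a_kernel P2 P d"
  proof
    fix y assume "y \<in> ?h ` carrier P2"
    then obtain x where x: "x \<in> carrier P2" "y = x \<ominus>\<^bsub>P2\<^esub> (\<alpha>2 (\<beta>2 x) \<oplus>\<^bsub>P2\<^esub> \<tau> (d x))"
      using hx by auto
    then have "d y = d x \<ominus>\<^bsub>P\<^esub> (d (\<alpha>2 (\<beta>2 x)) \<oplus>\<^bsub>P\<^esub> d (\<tau> (d x)))"
      using cl by (simp add: mod_hom_map_minus[OF mods(2,1) d] mod_hom_add[OF d])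
    also have "d (\<alpha>2 (\<beta>2 x)) \<oplus>\<^bsub>P\<^esub> d (\<tau> (d x)) = \<alpha> (\<beta> (d x)) \<oplus>\<^bsub>P\<^esub> h (d x)"
      using x cl by (simp add: \<alpha>2 \<beta>2 \<tau>)
    also have "\<dots> = d x" using 1(7)[of "d x"] x by auto
    finally show "y \<in> a_kernel P2 P d"
      using x cl module_minus_self[OF mods(1)] by (simp add: a_kernel_def')
  qed
  have bK: "\<beta>2 ` a_kernel P2 P d \<subseteq> a_kernel P2' P' d'" "\<alpha>2 ` a_kernel P2' P' d' \<subseteq> a_kernel P2 P d"
    using cl \<alpha>2(2) \<beta>2(2) mod_hom_zero[OF mods(1,3) 1(2)] mod_hom_zero[OF mods(3,1) 1(1)]
    by (auto simp: a_kernel_def')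
  have "x = \<alpha>2 (\<beta>2 x) \<oplus>\<^bsub>P2\<^esub> ?h x" if "x \<in> a_kernel P2 P d" for x
  proof -
    have x: "x \<in> carrier P2" "d x = \<zero>\<^bsub>P\<^esub>" using that by (auto simp: a_kernel_def')
    then have "\<tau> (d x) = \<zero>\<^bsub>P2\<^esub>" using mod_hom_zero[OF mods(1,2) \<tau>(1)] by simp
    then show ?thesis using x hx cl module_add_minus[OF mods(2)] by simp
  qed
  with bK hK h \<alpha>2(1) \<beta>2(1) show ?thesis by (intro stable_retractI)
qed

section \<open>Dualizing homomorphisms and presentations\<close>

lemma hom_map_eq:
  "h \<in> mod_hom R A' B \<Longrightarrow> hom_map R g A A' B h = compose (carrier A) h g"
  by (simp add: hom_map_def)

lemma hom_map_mod_hom: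
  assumes mods: "module R A" "module R A'" "module R B" and g: "g \<in> mod_hom R A A'"
  shows "hom_map R g A A' B \<in> mod_hom R (hom_module R A' B) (hom_module R A B)"
proof -
  note gc = mod_hom_closed[OF g]
  have "(\<lambda>h\<in>carrier (hom_module R A' B). compose (carrier A) h g)
      \<in> mod_hom R (hom_module R A' B) (hom_module R A B)"
    by (rule mod_hom_restrictI[OF module_hom_module[OF mods(2,3)]])
       (use mod_hom_compose[OF mods(1) g] gc in \<open>auto simp: compose_def fun_eq_iff\<close>)
  then show ?thesis by (simp add: hom_map_def)
qed

text \<open>
  Comparison maps between the presentations are dualized. Their composite differs from the identity
  of \<open>P1\<close> by \<open>h g\<close> for a homotopy \<open>h\<close> and a map into \<open>Ker g\<close>, and the dual of the latter kills
  the image of the dual of \<open>g\<close>.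
\<close>

lemma stable_retract_transpose:
  fixes A :: "('r, 'a) module" and P1 P0 :: "('r, 'p) module" and P1' P0' :: "('r, 'q) module"
  assumes A: "module R A"
    and pres: "fg_proj_presentation R A P1 P0 g p" "fg_proj_presentation R A P1' P0' g' p'"
  shows "stable_retract R (dual_module R P1)
      (hom_map R g P1 P0 (regular_module R) ` carrier (dual_module R P0))
    (dual_module R P1') (hom_map R g' P1' P0' (regular_module R) ` carrier (dual_module R P0'))"
proof -
  have p1: "module R P1" "module R P0" "projective R P1" "projective R P0"
    "g \<in> mod_hom R P1 P0" "p \<in> mod_hom R P0 A"
    "g ` carrier P1 = a_kernel P0 A p" "p ` carrier P0 = carrier A"
    and p2: "module R P1'" "module R P0'" "projective R P1'" "projective R P0'"
    "g' \<in> mod_hom R P1' P0'" "p' \<in> mod_hom R P0' A"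
    "g' ` carrier P1' = a_kernel P0' A p'" "p' ` carrier P0' = carrier A"
    using pres projective_module by (auto simp: fg_proj_presentation_def)
  obtain J0 :: "'p set" and x0 f0 where db0: "dual_basis R P0 J0 x0 f0"
    using projective_dual_basis[OF p1(4)] by blast
  obtain J1 :: "'p set" and x1 f1 where db1: "dual_basis R P1 J1 x1 f1"
    using projective_dual_basis[OF p1(3)] by blast
  obtain J0' :: "'q set" and x0' f0' where db0': "dual_basis R P0' J0' x0' f0'"
    using projective_dual_basis[OF p2(4)] by blast
  obtain J1' :: "'q set" and x1' f1' where db1': "dual_basis R P1' J1' x1' f1'"
    using projective_dual_basis[OF p2(3)] by blast
  note reg = module_regular[OF module_cring[OF A]]
  interpret P0: module R P0 by (rule p1(2))
  interpret reg: module R "regular_module R" by (rule reg)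
  obtain b0 where b0: "b0 \<in> mod_hom R P0 P0'" "\<And>x. x \<in> carrier P0 \<Longrightarrow> p' (b0 x) = p x"
    using dual_basis_lift[OF db0 p1(2) p2(2) A p2(6) p1(6)] p1(8) p2(8) by auto
  obtain a0 where a0: "a0 \<in> mod_hom R P0' P0" "\<And>x. x \<in> carrier P0' \<Longrightarrow> p (a0 x) = p' x"
    using dual_basis_lift[OF db0' p2(2) p1(2) A p1(6) p2(6)] p1(8) p2(8) by auto
  note cl = mod_hom_closed[OF a0(1)] mod_hom_closed[OF b0(1)] mod_hom_closed[OF p1(5)]
    mod_hom_closed[OF p2(5)] mod_hom_closed[OF p1(6)]
  have gk: "p (g x) = \<zero>\<^bsub>A\<^esub>" if "x \<in> carrier P1" for x
    using p1(7) that by (auto simp: a_kernel_def')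
  have gk': "p' (g' x) = \<zero>\<^bsub>A\<^esub>" if "x \<in> carrier P1'" for x
    using p2(7) that by (auto simp: a_kernel_def')
  have "compose (carrier P1) b0 g ` carrier P1 \<subseteq> g' ` carrier P1'"
    unfolding p2(7) using cl by (auto simp: compose_def a_kernel_def' b0 gk)
  then obtain b1 where b1: "b1 \<in> mod_hom R P1 P1'" "\<And>x. x \<in> carrier P1 \<Longrightarrow> g' (b1 x) = b0 (g x)"
    using dual_basis_lift[OF db1 p1(1) p2(1) p2(2) p2(5) mod_hom_compose[OF p1(1) p1(5) b0(1)]]
    by (auto simp: compose_def)
  have "compose (carrier P1') a0 g' ` carrier P1' \<subseteq> g ` carrier P1"
    unfolding p1(7) using cl by (auto simp: compose_def a_kernel_def' a0 gk')
  then obtain a1 where a1: "a1 \<in> mod_hom R P1' P1" "\<And>x. x \<in> carrier P1' \<Longrightarrow> g (a1 x) = a0 (g' x)"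
    using dual_basis_lift[OF db1' p2(1) p1(1) p1(2) p1(5) mod_hom_compose[OF p2(1) p2(5) a0(1)]]
    by (auto simp: compose_def)
  \<comment> \<open>On \<open>P0\<close> the composite of \<open>b0\<close> and \<open>a0\<close>
    agrees with the identity modulo Ker p = Im g, so the difference lifts along g to the homotopy
    h.\<close>
  let ?k = "\<lambda>x\<in>carrier P0. (\<lambda>x\<in>carrier P0. x) x \<ominus>\<^bsub>P0\<^esub> compose (carrier P0) a0 b0 x"
  have k: "?k \<in> mod_hom R P0 P0"
    by (intro mod_hom_minus p1 mod_hom_id mod_hom_compose[OF p1(2) b0(1) a0(1)])
  have "?k ` carrier P0 \<subseteq> g ` carrier P1"
    unfolding p1(7)
    using cl by (auto simp: compose_def a_kernel_def' mod_hom_map_minus[OF p1(2) A p1(6)] a0 b0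
      module_minus_self[OF A])
  then obtain h where h: "h \<in> mod_hom R P0 P1"
    "\<And>x. x \<in> carrier P0 \<Longrightarrow> g (h x) = x \<ominus>\<^bsub>P0\<^esub> a0 (b0 x)"
    using dual_basis_lift[OF db0 p1(2) p1(1) p1(2) p1(5) k] by (auto simp: compose_def)
  let ?B = "regular_module R"
  let ?D = "dual_module R"
  \<comment> \<open>Dualizing reverses arrows: the dual of \<open>b1\<close> leads from the dual of
    \<open>P1'\<close> back to that of \<open>P1\<close> and acts as \<alpha>, the dual of
    \<open>a1\<close> acts as \<beta>.\<close>
  let ?a = "hom_map R b1 P1 P1' ?B" and ?b = "hom_map R a1 P1' P1 ?B"
  let ?h = "hom_map R (compose (carrier P1) h g) P1 P1 ?B"
  have hg: "compose (carrier P1) h g \<in> mod_hom R P1 P1"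
    by (rule mod_hom_compose[OF p1(1) p1(5) h(1)])
  have homs: "?a \<in> mod_hom R (?D P1') (?D P1)" "?b \<in> mod_hom R (?D P1) (?D P1')"
    "?h \<in> mod_hom R (?D P1) (?D P1)"
    by (intro hom_map_mod_hom p1 p2 reg b1 a1 hg)+
  note cl = cl mod_hom_closed[OF h(1)] mod_hom_closed[OF a1(1)] mod_hom_closed[OF b1(1)]
  \<comment> \<open>By g a1 = a0 g', composing c g with \<open>a1\<close> is the same as composing c
    a0 with g', which lies in the image of the dual of g'.\<close>
  have "?b ` (hom_map R g P1 P0 ?B ` carrier (?D P0)) \<subseteq> hom_map R g' P1' P0' ?B ` carrier (?D P0')"
  proof -
    have "?b (hom_map R g P1 P0 ?B c) = hom_map R g' P1' P0' ?B (compose (carrier P0') c a0)"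
      "compose (carrier P0') c a0 \<in> carrier (?D P0')"
      if "c \<in> mod_hom R P0 ?B" for c
      using mod_hom_compose[OF p1(1) p1(5) that] mod_hom_compose[OF p2(2) a0(1) that] that cl
      by (auto simp: hom_map_eq fun_eq_iff compose_def a1)
    then show ?thesis by auto
  qed
  moreover have "?a ` (hom_map R g' P1' P0' ?B ` carrier (?D P0')) \<subseteq> hom_map R g P1 P0 ?B ` carrier (?D P0)"
  proof -
    have "?a (hom_map R g' P1' P0' ?B c) = hom_map R g P1 P0 ?B (compose (carrier P0) c b0)"
      "compose (carrier P0) c b0 \<in> carrier (?D P0)"
      if "c \<in> mod_hom R P0' ?B" for c
      using mod_hom_compose[OF p2(1) p2(5) that] mod_hom_compose[OF p1(2) b0(1) that] that cl
      by (auto simp: hom_map_eq fun_eq_iff compose_def b1)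
    then show ?thesis by auto
  qed
  moreover have "?h ` carrier (?D P1) \<subseteq> hom_map R g P1 P0 ?B ` carrier (?D P0)"
  proof -
    have "?h c = hom_map R g P1 P0 ?B (compose (carrier P0) c h)"
      "compose (carrier P0) c h \<in> carrier (?D P0)"
      if "c \<in> mod_hom R P1 ?B" for c
      using mod_hom_compose[OF p1(2) h(1) that] that cl
      by (auto simp: hom_map_eq fun_eq_iff compose_def)
    then show ?thesis by auto
  qed
  moreover have "x = ?a (?b x) \<oplus>\<^bsub>?D P1\<^esub> ?h x"
    if "x \<in> hom_map R g P1 P0 ?B ` carrier (?D P0)" for x
  proof -
    obtain c where c: "c \<in> mod_hom R P0 ?B" "x = compose (carrier P1) c g"
      using \<open>x \<in> hom_map R g P1 P0 ?B ` carrier (?D P0)\<close> by (auto simp: hom_map_eq)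
    have x: "x \<in> mod_hom R P1 ?B" unfolding c(2) by (rule mod_hom_compose[OF p1(1) p1(5) c(1)])
    note cc = mod_hom_closed[OF c(1)]
    have "?a (?b x) = compose (carrier P1) (compose (carrier P1') x a1) b1"
      using x mod_hom_compose[OF p2(1) a1(1) x] by (simp add: hom_map_eq)
    moreover have "?h x = compose (carrier P1) x (compose (carrier P1) h g)"
      using x by (simp add: hom_map_eq)
    \<comment> \<open>With x = c g, the relations g a1 b1 = a0 b0 g and g h = id - a0 b0 turn the
      two terms into c (a0 (b0 (g t))) and c (g t) - c (a0 (b0 (g t))).\<close>
    moreover have "x t = x (a1 (b1 t)) \<oplus>\<^bsub>?B\<^esub> x (h (g t))" if t: "t \<in> carrier P1" for t
    proof -
      have "x (a1 (b1 t)) = c (a0 (b0 (g t)))" using t cl by (simp add: c compose_def a1 b1)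
      moreover have "x (h (g t)) = c (g t) \<ominus>\<^bsub>?B\<^esub> c (a0 (b0 (g t)))"
        using t cl by (simp add: c compose_def h mod_hom_map_minus[OF p1(2) reg c(1)])
      moreover have "x t = c (g t)" using t by (simp add: c compose_def)
      ultimately show ?thesis using t cl cc by (simp add: module_add_minus[OF reg, symmetric] del: regular_module_simps)
    qed
    moreover have "x t = undefined" if "t \<notin> carrier P1" for t
      using that by (simp add: c compose_def)
    ultimately show ?thesis using mod_hom_closed[OF b1(1)]
      by (auto simp: compose_def fun_eq_iff)
  qed
  ultimately show ?thesis using homs by (intro stable_retractI)
qed


section \<open>Quotients\<close>

lemma submodule_abelian_subgroup:
  assumes "module R A" "submodule H R A"
  shows "abelian_subgroup H A"
proof -
  interpret A: module R A by fact
  have "additive_subgroup H A"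
    using assms(2) by (intro additive_subgroup.intro) (simp add: submodule_def)
  then show ?thesis by (rule abelian_subgroupI3) (rule A.abelian_group_axioms)
qed

lemma quot_module_simps:
  "carrier (quot_module A H) = (\<Union>a\<in>carrier A. {H +>\<^bsub>A\<^esub> a})"
  "zero (quot_module A H) = H"
  "add (quot_module A H) = set_add A"
  by (simp_all add: quot_module_def A_RCOSETS_def')

text \<open>All representatives y of the coset of x give the same coset of a y, so the union that
  defines scalar multiplication in \<open>quot_module\<close> is a union of equal sets.\<close>

lemma quot_module_smult:
  assumes A: "module R A" and H: "submodule H R A" and a: "a \<in> carrier R" and x: "x \<in> carrier A"
  shows "a \<odot>\<^bsub>quot_module A H\<^esub> (H +>\<^bsub>A\<^esub> x) = H +>\<^bsub>A\<^esub> (a \<odot>\<^bsub>A\<^esub> x)"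
proof -
  interpret A: module R A by fact
  interpret H: abelian_subgroup H A by (rule submodule_abelian_subgroup[OF A H])
  note Hsub = submodule_subset[OF H]
  have eq: "H +>\<^bsub>A\<^esub> (a \<odot>\<^bsub>A\<^esub> y) = H +>\<^bsub>A\<^esub> (a \<odot>\<^bsub>A\<^esub> x)" if y: "y \<in> H +>\<^bsub>A\<^esub> x" for y
  proof -
    obtain h where h: "h \<in> H" "y = h \<oplus>\<^bsub>A\<^esub> x" using y unfolding a_r_coset_def' by auto
    have ah: "a \<odot>\<^bsub>A\<^esub> h \<in> H" using A.submoduleE(4)[OF H a h(1)] .
    have "a \<odot>\<^bsub>A\<^esub> y = a \<odot>\<^bsub>A\<^esub> h \<oplus>\<^bsub>A\<^esub> a \<odot>\<^bsub>A\<^esub> x"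
      using h Hsub a x by (auto intro: A.smult_r_distr)
    also have "\<dots> \<in> H +>\<^bsub>A\<^esub> (a \<odot>\<^bsub>A\<^esub> x)"
      using ah unfolding a_r_coset_def' by auto
    finally show ?thesis
      using H.a_repr_independence'[of "a \<odot>\<^bsub>A\<^esub> y" "a \<odot>\<^bsub>A\<^esub> x"] a x by simp
  qed
  have "x \<in> H +>\<^bsub>A\<^esub> x" by (rule H.a_rcos_self[OF x])
  then have "(\<Union>y\<in>H +>\<^bsub>A\<^esub> x. H +>\<^bsub>A\<^esub> (a \<odot>\<^bsub>A\<^esub> y)) = (\<Union>y\<in>H +>\<^bsub>A\<^esub> x. H +>\<^bsub>A\<^esub> (a \<odot>\<^bsub>A\<^esub> x))"
    by (intro SUP_cong refl eq)
  also have "\<dots> = H +>\<^bsub>A\<^esub> (a \<odot>\<^bsub>A\<^esub> x)"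
    using \<open>x \<in> H +>\<^bsub>A\<^esub> x\<close> by blast
  finally show ?thesis by (simp add: quot_module_def)
qed

lemma module_quot:
  assumes A: "module R A" and H: "submodule H R A"
  shows "module R (quot_module A H)"
proof -
  interpret A: module R A by fact
  interpret H: abelian_subgroup H A by (rule submodule_abelian_subgroup[OF A H])
  let ?Q = "quot_module A H"
  have add: "(H +>\<^bsub>A\<^esub> x) \<oplus>\<^bsub>?Q\<^esub> (H +>\<^bsub>A\<^esub> y) = H +>\<^bsub>A\<^esub> (x \<oplus>\<^bsub>A\<^esub> y)"
    if "x \<in> carrier A" "y \<in> carrier A" for x y
    using H.a_rcos_sum[OF that] by (simp add: quot_module_simps)
  have zero: "\<zero>\<^bsub>?Q\<^esub> = H +>\<^bsub>A\<^esub> \<zero>\<^bsub>A\<^esub>"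
    using A.a_coset_add_zero[OF submodule_subset[OF H]] by (simp add: quot_module_simps)
  have rep: "\<exists>x. x \<in> carrier A \<and> U = H +>\<^bsub>A\<^esub> x" if "U \<in> carrier ?Q" for U
    using that unfolding quot_module_simps by blast
  have mem: "H +>\<^bsub>A\<^esub> a \<in> carrier ?Q" if "a \<in> carrier A" for a
    using that unfolding quot_module_simps by blast
  note sm = quot_module_smult[OF A H]
  show ?thesis
  proof (rule moduleI[OF A.R.cring_axioms])
    show "abelian_group ?Q"
    proof (rule abelian_groupI)
      fix U W T assume "U \<in> carrier ?Q" "W \<in> carrier ?Q" "T \<in> carrier ?Q"
      then obtain x y z where "x \<in> carrier A" "U = H +>\<^bsub>A\<^esub> x" "y \<in> carrier A" "W = H +>\<^bsub>A\<^esub> y"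
        "z \<in> carrier A" "T = H +>\<^bsub>A\<^esub> z" using rep by metis
      then show "U \<oplus>\<^bsub>?Q\<^esub> W \<oplus>\<^bsub>?Q\<^esub> T = U \<oplus>\<^bsub>?Q\<^esub> (W \<oplus>\<^bsub>?Q\<^esub> T)"
        by (simp add: add A.a_assoc)
    next
      fix U W assume "U \<in> carrier ?Q" "W \<in> carrier ?Q"
      then obtain x y where "x \<in> carrier A" "U = H +>\<^bsub>A\<^esub> x" "y \<in> carrier A" "W = H +>\<^bsub>A\<^esub> y"
        using rep by metis
      then show "U \<oplus>\<^bsub>?Q\<^esub> W \<in> carrier ?Q" "U \<oplus>\<^bsub>?Q\<^esub> W = W \<oplus>\<^bsub>?Q\<^esub> U"
        by (simp_all add: add mem A.a_comm)
    next
      fix U assume "U \<in> carrier ?Q"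
      then obtain x where x: "x \<in> carrier A" "U = H +>\<^bsub>A\<^esub> x" using rep by metis
      then show "\<zero>\<^bsub>?Q\<^esub> \<oplus>\<^bsub>?Q\<^esub> U = U" unfolding zero by (simp add: add)
      show "\<exists>W\<in>carrier ?Q. W \<oplus>\<^bsub>?Q\<^esub> U = \<zero>\<^bsub>?Q\<^esub>"
        by (rule bexI[of _ "H +>\<^bsub>A\<^esub> (\<ominus>\<^bsub>A\<^esub> x)"]) (use x in \<open>simp_all add: add mem zero A.l_neg\<close>)
    next
      show "\<zero>\<^bsub>?Q\<^esub> \<in> carrier ?Q" unfolding zero by (rule mem) simp
    qed
  next
    fix a b U W assume ab: "a \<in> carrier R" "b \<in> carrier R" and "U \<in> carrier ?Q" "W \<in> carrier ?Q"
    then obtain x y where "x \<in> carrier A" "U = H +>\<^bsub>A\<^esub> x" "y \<in> carrier A" "W = H +>\<^bsub>A\<^esub> y"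
      using rep by metis
    then show "a \<odot>\<^bsub>?Q\<^esub> (U \<oplus>\<^bsub>?Q\<^esub> W) = a \<odot>\<^bsub>?Q\<^esub> U \<oplus>\<^bsub>?Q\<^esub> a \<odot>\<^bsub>?Q\<^esub> W"
      using ab by (simp add: add sm A.smult_r_distr)
  next
    fix a b U assume ab: "a \<in> carrier R" "b \<in> carrier R" and "U \<in> carrier ?Q"
    then obtain x where "x \<in> carrier A" "U = H +>\<^bsub>A\<^esub> x" using rep by metis
    then show "(a \<oplus>\<^bsub>R\<^esub> b) \<odot>\<^bsub>?Q\<^esub> U = a \<odot>\<^bsub>?Q\<^esub> U \<oplus>\<^bsub>?Q\<^esub> b \<odot>\<^bsub>?Q\<^esub> U"
      "(a \<otimes>\<^bsub>R\<^esub> b) \<odot>\<^bsub>?Q\<^esub> U = a \<odot>\<^bsub>?Q\<^esub> (b \<odot>\<^bsub>?Q\<^esub> U)"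
      using ab by (simp_all add: add sm A.smult_l_distr A.smult_assoc1)
  next
    fix a U assume ab: "a \<in> carrier R" and "U \<in> carrier ?Q"
    then obtain x where "x \<in> carrier A" "U = H +>\<^bsub>A\<^esub> x" using rep by metis
    then show "a \<odot>\<^bsub>?Q\<^esub> U \<in> carrier ?Q" using ab by (simp add: mem sm)
  next
    fix U assume "U \<in> carrier ?Q"
    then obtain x where "x \<in> carrier A" "U = H +>\<^bsub>A\<^esub> x" using rep by metis
    then show "\<one>\<^bsub>R\<^esub> \<odot>\<^bsub>?Q\<^esub> U = U" by (simp add: sm)
  qed
qed

definition quot_map :: "('r, 'a) module \<Rightarrow> 'a set \<Rightarrow> 'a \<Rightarrow> 'a set" where
  "quot_map A H = (\<lambda>x\<in>carrier A. H +>\<^bsub>A\<^esub> x)"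

lemma quot_map:
  assumes A: "module R A" and H: "submodule H R A"
  shows "quot_map A H \<in> mod_hom R A (quot_module A H)"
    and "quot_map A H ` carrier A = carrier (quot_module A H)"
    and "a_kernel A (quot_module A H) (quot_map A H) = H"
proof -
  interpret A: module R A by fact
  interpret H: abelian_subgroup H A by (rule submodule_abelian_subgroup[OF A H])
  note Hsub = submodule_subset[OF H]
  show "quot_map A H \<in> mod_hom R A (quot_module A H)"
    unfolding quot_map_def
  proof (rule mod_hom_restrictI[OF A])
    show "H +>\<^bsub>A\<^esub> (x \<oplus>\<^bsub>A\<^esub> y) = (H +>\<^bsub>A\<^esub> x) \<oplus>\<^bsub>quot_module A H\<^esub> (H +>\<^bsub>A\<^esub> y)"
      if "x \<in> carrier A" "y \<in> carrier A" for x y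
      using H.a_rcos_sum[OF that] by (simp add: quot_module_simps)
    show "H +>\<^bsub>A\<^esub> x \<in> carrier (quot_module A H)" if "x \<in> carrier A" for x
      using that by (auto simp: quot_module_simps)
  qed (simp add: quot_module_smult[OF A H])
  show "quot_map A H ` carrier A = carrier (quot_module A H)"
    by (auto simp: quot_map_def quot_module_simps)
  have "x \<in> H" if "H +>\<^bsub>A\<^esub> x = H" "x \<in> carrier A" for x
    using H.a_rcos_self[OF that(2)] that(1) by simp
  moreover have "H +>\<^bsub>A\<^esub> x = H" if "x \<in> H" for x
    using that Hsub H by (intro A.a_coset_join2) (auto simp: H.a_subgroup)
  ultimately show "a_kernel A (quot_module A H) (quot_map A H) = H"
    using Hsub by (auto simp: a_kernel_def' quot_map_def quot_module_simps)
qed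

text \<open>Cosets are formed by the addition alone, so shrinking the carrier to K leaves them
  unchanged, and the coset of a is H exactly when a lies in H.\<close>

lemma quot_module_trivial_iff:
  assumes A: "module R A" and H: "submodule H R A" and HK: "H \<subseteq> K" and K: "K \<subseteq> carrier A"
  shows "carrier (quot_module (A\<lparr>carrier := K\<rparr>) H) = {zero (quot_module (A\<lparr>carrier := K\<rparr>) H)}
    \<longleftrightarrow> K \<subseteq> H"
proof -
  interpret A: module R A by fact
  interpret H: abelian_subgroup H A by (rule submodule_abelian_subgroup[OF A H])
  note Hsub = submodule_subset[OF H]
  have ne: "H \<noteq> {}" using H.zero_closed by blast
  have c: "carrier (quot_module (A\<lparr>carrier := K\<rparr>) H) = (\<Union>a\<in>K. {H +>\<^bsub>A\<^esub> a})"
    by (simp add: quot_module_simps a_r_coset_def')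
  have z: "zero (quot_module (A\<lparr>carrier := K\<rparr>) H) = H" by (simp add: quot_module_def)
  have 1: "H +>\<^bsub>A\<^esub> a = H" if "a \<in> H" for a
    using that Hsub H by (intro A.a_coset_join2) (auto simp: H.a_subgroup)
  have 2: "a \<in> H +>\<^bsub>A\<^esub> a" if "a \<in> carrier A" for a
    by (rule H.a_rcos_self[OF that])
  show ?thesis
  proof
    assume "K \<subseteq> H"
    then have "K = H" using HK by blast
    then show "carrier (quot_module (A\<lparr>carrier := K\<rparr>) H) = {zero (quot_module (A\<lparr>carrier := K\<rparr>) H)}"
      unfolding c z using 1 ne by auto
  next
    assume "carrier (quot_module (A\<lparr>carrier := K\<rparr>) H) = {zero (quot_module (A\<lparr>carrier := K\<rparr>) H)}"
    then have "H +>\<^bsub>A\<^esub> a = H" if "a \<in> K" for a using that unfolding c z by auto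
    then show "K \<subseteq> H" using 2 K by auto
  qed
qed


section \<open>Existence of projective resolutions\<close>

lemma lin_comb_std_vec:
  assumes A: "module R A" and y: "y \<in> S \<rightarrow> carrier A" and i: "i \<in> S"
  shows "lin_comb R A S (std_vec R S i) y = y i"
proof -
  interpret A: module R A by fact
  have "lin_comb R A S (std_vec R S i) y = (\<Oplus>\<^bsub>A\<^esub>j\<in>{i}. std_vec R S i j \<odot>\<^bsub>A\<^esub> y j)"
    by (rule lin_comb_superset[OF A])
       (use i y in \<open>auto simp: std_vec_def split: if_splits\<close>)
  also have "\<dots> = y i"
    using y i by (simp add: A.finsum_insert[of "{}"] std_vec_def Pi_iff)
  finally show ?thesis .
qed

text \<open>Every element serves as a generator; the injection k copies the carrier into the index
  type prescribed for the free module.\<close>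

lemma free_cover:
  fixes k :: "'a \<Rightarrow> 'i" and A :: "('r, 'a) module"
  assumes A: "module R A" and k: "inj_on k (carrier A)"
  shows "\<exists>(S :: 'i set) e. e \<in> mod_hom R (free_module R S) A \<and>
    e ` carrier (free_module R S) = carrier A"
proof (intro exI conjI)
  let ?S = "k ` carrier A"
  have y: "inv_into (carrier A) k \<in> ?S \<rightarrow> carrier A" by (auto intro: inv_into_into)
  let ?e = "\<lambda>u\<in>carrier (free_module R ?S). lin_comb R A ?S u (inv_into (carrier A) k)"
  show e: "?e \<in> mod_hom R (free_module R ?S) A" by (rule lin_comb_mod_hom[OF A y])
  show "?e ` carrier (free_module R ?S) = carrier A"
  proof
    show "?e ` carrier (free_module R ?S) \<subseteq> carrier A"
      using mod_hom_closed[OF e] by (rule image_subsetI)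
    show "carrier A \<subseteq> ?e ` carrier (free_module R ?S)"
    proof
      fix a assume a: "a \<in> carrier A"
      have "std_vec R ?S (k a) \<in> carrier (free_module R ?S)"
        by (rule std_vec_closed[OF module_cring[OF A]]) (use a in auto)
      moreover have "?e (std_vec R ?S (k a)) = a"
        using lin_comb_std_vec[OF A y, of "k a"] a k calculation by (simp del: free_module_simps)
      ultimately show "a \<in> ?e ` carrier (free_module R ?S)" by (metis imageI)
    qed
  qed
qed

text \<open>A self-delimiting code: each block announces the length of the word \<open>i\<close>,
  spells \<open>i\<close>, and then gives the value there. Reading from the left recovers the blocks
  one by one.\<close>

lemma concat_encode_inj:
  fixes u w :: "('a + 'r + nat) list \<Rightarrow> 'r"
  assumes "concat (map (\<lambda>i. Inr (Inr (length i)) # i @ [Inr (Inl (u i))]) xs)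
    = concat (map (\<lambda>i. Inr (Inr (length i)) # i @ [Inr (Inl (w i))]) ys)"
  shows "xs = ys \<and> (\<forall>i\<in>set xs. u i = w i)"
  using assms
proof (induction xs arbitrary: ys)
  case Nil
  then show ?case by (cases ys) auto
next
  case (Cons i xs)
  then show ?case by (cases ys) auto
qed

text \<open>Each kernel in the resolution lies in a free module on words and has to be covered by a
  free module on words again, so finitely supported functions must themselves be coded as words. A
  listing of the support together with the value at each index determines the function.\<close>

lemma free_module_encode:
  fixes S :: "('a + 'r + nat) list set" and R :: "('r, 'x) ring_scheme"
  shows "\<exists>k :: (('a + 'r + nat) list \<Rightarrow> 'r) \<Rightarrow> ('a + 'r + nat) list.
    inj_on k (carrier (free_module R S))"
proof -
  let ?supp = "\<lambda>u. {i \<in> S. u i \<noteq> \<zero>\<^bsub>R\<^esub>}"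
  define l where "l = (\<lambda>u :: ('a + 'r + nat) list \<Rightarrow> 'r. SOME xs. set xs = ?supp u)"
  have l: "set (l u) = ?supp u" if "u \<in> carrier (free_module R S)" for u
    unfolding l_def by (rule someI_ex) (use that finite_list in auto)
  define k where "k = (\<lambda>u :: ('a + 'r + nat) list \<Rightarrow> 'r.
    concat (map (\<lambda>i. Inr (Inr (length i)) # i @ [Inr (Inl (u i))]) (l u)))"
  have "inj_on k (carrier (free_module R S))"
  proof (rule inj_onI)
    fix u w assume u: "u \<in> carrier (free_module R S)" and w: "w \<in> carrier (free_module R S)"
      and "k u = k w"
    then have *: "l u = l w" "\<forall>i\<in>set (l u). u i = w i"
      using concat_encode_inj[of u "l u" w "l w"] by (auto simp: k_def)
    show "u = w"
    proof (rule extensionalityI[of u S w])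
      fix i assume "i \<in> S"
      then show "u i = w i"
        using * l[OF u] l[OF w] by (cases "i \<in> set (l u)") auto
    qed (use u w in \<open>auto simp: PiE_def\<close>)
  qed
  then show ?thesis by blast
qed

lemma inj_on_std_vec:
  assumes "\<one>\<^bsub>R\<^esub> \<noteq> \<zero>\<^bsub>R\<^esub>"
  shows "inj_on (std_vec R S) S"
proof (rule inj_onI)
  fix i j assume ij: "i \<in> S" "j \<in> S" "std_vec R S i = std_vec R S j"
  from fun_cong[OF ij(3), of i] show "i = j"
    using ij(1) assms by (simp add: std_vec_def split: if_splits)
qed

text \<open>The standard vectors copy the index set into the element type, as
  \<open>projective\<close> requires. They are distinct because 1 \<noteq> 0.\<close>

lemma projective_free:
  fixes S :: "'i set" and R :: "('r, 'x) ring_scheme"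
  assumes "cring R" "\<one>\<^bsub>R\<^esub> \<noteq> \<zero>\<^bsub>R\<^esub>"
  shows "projective R (free_module R S)"
proof (rule dual_basis_projective[OF dual_basis_free[OF assms(1)] module_free[OF assms(1)]])
  show "inj_on (std_vec R S) S" by (rule inj_on_std_vec[OF assms(2)])
qed

lemma proj_resolution_exists:
  fixes R :: "('r, 'x) ring_scheme" and A :: "('r, 'a) module"
  assumes A: "module R A" and nz: "\<one>\<^bsub>R\<^esub> \<noteq> \<zero>\<^bsub>R\<^esub>"
  shows "\<exists>(P :: nat \<Rightarrow> ('r, ('r, 'a) resolution_elt) module) d e. proj_resolution R A P d e"
proof -
  note cr = module_cring[OF A]
  let ?F = "free_module R :: ('a + 'r + nat) list set \<Rightarrow> ('r, ('r, 'a) resolution_elt) module"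
  note F = module_free[OF cr]
  \<comment> \<open>The recursion runs over pairs (S, K): S indexes the basis of the current free
    module, K is the kernel to be covered next. Only at n = 0 is K the kernel of a map onto A, hence
    the implication in \<open>?P\<close>.\<close>
  let ?C = "\<lambda>S K. \<exists>e. e \<in> mod_hom R (?F S) A \<and> e ` carrier (?F S) = carrier A \<and> K = a_kernel (?F S) A e"
  let ?P = "\<lambda>n (S, K). submodule K R (?F S) \<and> (n = (0 :: nat) \<longrightarrow> ?C S K)"
  let ?Q = "\<lambda>n :: nat. \<lambda>(S, K) (S', K'). \<exists>d. d \<in> mod_hom R (?F S') (?F S) \<and>
    d ` carrier (?F S') = K \<and> K' = a_kernel (?F S') (?F S) d"
  have "\<exists>f. \<forall>n. ?P n (f n) \<and> ?Q n (f n) (f (Suc n))"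
  proof (rule dependent_nat_choice)
    \<comment> \<open>The elements of A become words of length one. From the next stage on, the
      elements to be covered are functions on words, which \<open>free_module_encode\<close>
      codes.\<close>
    have "inj_on (\<lambda>a :: 'a. [Inl a :: 'a + 'r + nat]) (carrier A)" by (auto simp: inj_on_def)
    from free_cover[OF A this] obtain S e where
      "e \<in> mod_hom R (?F S) A" "e ` carrier (?F S) = carrier A" by blast
    then have "?P 0 (S, a_kernel (?F S) A e)"
      using submodule_kernel[OF F A] by auto
    then show "\<exists>x. ?P 0 x" by blast
  next
    fix x n assume Px: "?P n x"
    obtain S K where x: "x = (S, K)" by (cases x)
    then have K: "submodule K R (?F S)" using Px by simp
    let ?K = "(?F S)\<lparr>carrier := K\<rparr>"
    have mK: "module R ?K" by (rule submodule_carrier_update[OF K F])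
    obtain k :: "('r, 'a) resolution_elt \<Rightarrow> ('a + 'r + nat) list"
      where "inj_on k (carrier (?F S))" using free_module_encode by blast
    then have "inj_on k (carrier ?K)"
      using submodule_subset[OF K] inj_on_subset by fastforce
    from free_cover[OF mK this] obtain S' d where
      d: "d \<in> mod_hom R (?F S') ?K" "d ` carrier (?F S') = carrier ?K" by blast
    have d': "d \<in> mod_hom R (?F S') (?F S)"
      by (rule mod_hom_codomain[OF submodule_subset[OF K] d(1)])
    have "?P (Suc n) (S', a_kernel (?F S') (?F S) d)"
      using submodule_kernel[OF F F d'] by simp
    moreover have "?Q n (S, K) (S', a_kernel (?F S') (?F S) d)"
      unfolding prod.case using d' d(2) by (intro exI[of _ d] conjI refl) simp_all
    ultimately show "\<exists>y. ?P (Suc n) y \<and> ?Q n x y" unfolding x by blast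
  qed
  then obtain f where *: "\<forall>n. ?P n (f n) \<and> ?Q n (f n) (f (Suc n))" by (rule exE)
  have f: "?P n (f n)" "?Q n (f n) (f (Suc n))" for n
    using *[THEN spec, of n] by (rule conjunct1, rule conjunct2)
  define S where "S = (\<lambda>n. fst (f n))"
  define K where "K = (\<lambda>n. snd (f n))"
  have "?C (S 0) (K 0)" using f(1)[of 0] by (simp add: S_def K_def case_prod_unfold)
  then obtain e where e: "e \<in> mod_hom R (?F (S 0)) A" "e ` carrier (?F (S 0)) = carrier A"
    "K 0 = a_kernel (?F (S 0)) A e" by blast
  have "\<forall>n. \<exists>d. d \<in> mod_hom R (?F (S (Suc n))) (?F (S n)) \<and>
    d ` carrier (?F (S (Suc n))) = K n \<and> K (Suc n) = a_kernel (?F (S (Suc n))) (?F (S n)) d"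
    using f(2) by (simp add: S_def K_def case_prod_unfold)
  then obtain d where d: "\<And>n. d n \<in> mod_hom R (?F (S (Suc n))) (?F (S n))"
    "\<And>n. d n ` carrier (?F (S (Suc n))) = K n"
    "\<And>n. K (Suc n) = a_kernel (?F (S (Suc n))) (?F (S n)) (d n)" by metis
  have "proj_resolution R A (\<lambda>n. ?F (S n)) d e"
    unfolding proj_resolution_def
    by (intro conjI allI projective_free[OF cr nz] d(1) e(1,2)) (simp_all only: d e One_nat_def)
  then show ?thesis by blast
qed


section \<open>Vanishing of Ext\<close>

text \<open>The homomorphism theorem, with the image of d inside B in place of the quotient by the
  kernel. As h is constant on the fibres of d, the choice of preimages does not affect the
  map.\<close>

lemma mod_hom_factor:
  assumes mods: "module R A" "module R B" "module R C" and d: "d \<in> mod_hom R A B" and h: "h \<in> mod_hom R A C"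
    and ker: "\<And>x. x \<in> carrier A \<Longrightarrow> d x = \<zero>\<^bsub>B\<^esub> \<Longrightarrow> h x = \<zero>\<^bsub>C\<^esub>"
  shows "\<exists>\<theta>\<in>mod_hom R (B\<lparr>carrier := d ` carrier A\<rparr>) C. \<forall>x\<in>carrier A. \<theta> (d x) = h x"
proof -
  interpret A: module R A by fact
  interpret C: module R C by fact
  have eq: "h x = h y" if "x \<in> carrier A" "y \<in> carrier A" "d x = d y" for x y
  proof -
    have "d (x \<ominus>\<^bsub>A\<^esub> y) = \<zero>\<^bsub>B\<^esub>"
      using that mod_hom_map_minus[OF mods(1,2) d, of x y] module_minus_self[OF mods(2)] mod_hom_closed[OF d]
      by simp
    then have z: "h (x \<ominus>\<^bsub>A\<^esub> y) = \<zero>\<^bsub>C\<^esub>" using ker that by simp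
    have "h x = h (y \<oplus>\<^bsub>A\<^esub> (x \<ominus>\<^bsub>A\<^esub> y))" using module_add_minus[OF mods(1) that(1,2)] by simp
    also have "\<dots> = h y" using that z mod_hom_closed[OF h] by (simp add: mod_hom_add[OF h])
    finally show ?thesis .
  qed
  define s where "s = (\<lambda>y. SOME x. x \<in> carrier A \<and> d x = y)"
  have s: "s (d x) \<in> carrier A" "d (s (d x)) = d x" if "x \<in> carrier A" for x
    using someI[of "\<lambda>t. t \<in> carrier A \<and> d t = d x" x] that by (auto simp: s_def)
  let ?B = "B\<lparr>carrier := d ` carrier A\<rparr>"
  have hs: "h (s (d x)) = h x" if "x \<in> carrier A" for x using eq s that by blast
  have "(\<lambda>y\<in>carrier ?B. h (s y)) \<in> mod_hom R ?B C"
  proof (rule mod_hom_restrictI[OF submodule_carrier_update[OF submodule_image[OF mods(1,2) d] mods(2)]])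
    fix y assume "y \<in> carrier ?B"
    then obtain x where x: "x \<in> carrier A" "y = d x" by auto
    show "h (s y) \<in> carrier C" using x hs mod_hom_closed[OF h] by simp
    fix a assume a: "a \<in> carrier R"
    have "a \<odot>\<^bsub>B\<^esub> y = d (a \<odot>\<^bsub>A\<^esub> x)" using x a mod_hom_smult[OF d] by simp
    then show "h (s (a \<odot>\<^bsub>?B\<^esub> y)) = a \<odot>\<^bsub>C\<^esub> h (s y)"
      using x a hs mod_hom_smult[OF h] by simp
  next
    fix y y' assume "y \<in> carrier ?B" "y' \<in> carrier ?B"
    then obtain x x' where x: "x \<in> carrier A" "y = d x" "x' \<in> carrier A" "y' = d x'" by auto
    have "y \<oplus>\<^bsub>B\<^esub> y' = d (x \<oplus>\<^bsub>A\<^esub> x')" using x mod_hom_add[OF d] by simp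
    then show "h (s (y \<oplus>\<^bsub>?B\<^esub> y')) = h (s y) \<oplus>\<^bsub>C\<^esub> h (s y')"
      using x hs mod_hom_add[OF h] by simp
  qed
  then show ?thesis by (intro bexI) (auto simp: hs)
qed

lemma proj_resolutionD:
  assumes "proj_resolution R A P d e"
  shows "projective R (P n)" "d n \<in> mod_hom R (P (Suc n)) (P n)"
    "d (Suc n) ` carrier (P (Suc (Suc n))) = a_kernel (P (Suc n)) (P n) (d n)"
    "e \<in> mod_hom R (P 0) A" "e ` carrier (P 0) = carrier A"
    "d 0 ` carrier (P 1) = a_kernel (P 0) A e"
  using assms unfolding proj_resolution_def by simp_all

text \<open>By exactness a cocycle in degree j + 1 is a homomorphism on \<open>P (Suc j)\<close>
  that vanishes on the kernel of \<open>d j\<close>, that is, a homomorphism from the image of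
  \<open>d j\<close>. It is a coboundary exactly when this homomorphism extends to
  \<open>P j\<close>.\<close>

lemma cohomology_trivial_iff:
  fixes A :: "('r, 'a) module" and B :: "('r, 'b) module" and P :: "nat \<Rightarrow> ('r, 'p) module"
  assumes res: "proj_resolution R A P d e" and B: "module R B"
  shows "carrier (hom_complex_cohomology R P d B (Suc j)) = {zero (hom_complex_cohomology R P d B (Suc j))}
    \<longleftrightarrow> homs_extend R (P j) (d j ` carrier (P (Suc j))) B"
proof -
  note P = projective_module[OF proj_resolutionD(1)[OF res]]
    and d = proj_resolutionD(2)[OF res] and ex = proj_resolutionD(3)[OF res]
  note dc = mod_hom_closed[OF d]
  have dd: "d n (d (Suc n) x) = \<zero>\<^bsub>P n\<^esub>" if "x \<in> carrier (P (Suc (Suc n)))" for n x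
  proof -
    have "d (Suc n) x \<in> d (Suc n) ` carrier (P (Suc (Suc n)))" using that by blast
    then show ?thesis unfolding ex by (simp add: a_kernel_def')
  qed
  let ?C = "\<lambda>n. hom_module R (P n) B" and ?\<delta> = "\<lambda>n. hom_map R (d n) (P (Suc n)) (P n) B"
  let ?H = "?\<delta> j ` carrier (?C j)" and ?K = "a_kernel (?C (Suc j)) (?C (Suc (Suc j))) (?\<delta> (Suc j))"
  have \<delta>: "?\<delta> n \<in> mod_hom R (?C n) (?C (Suc n))" for n
    by (rule hom_map_mod_hom[OF P P B d])
  have C: "module R (?C n)" for n by (rule module_hom_module[OF P B])
  have K: "?K = {h \<in> mod_hom R (P (Suc j)) B. \<forall>x\<in>carrier (P (Suc j)). d j x = \<zero>\<^bsub>P j\<^esub> \<longrightarrow> h x = \<zero>\<^bsub>B\<^esub>}"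
  proof -
    have "(?\<delta> (Suc j) h = \<zero>\<^bsub>?C (Suc (Suc j))\<^esub>)
      \<longleftrightarrow> (\<forall>x\<in>carrier (P (Suc j)). d j x = \<zero>\<^bsub>P j\<^esub> \<longrightarrow> h x = \<zero>\<^bsub>B\<^esub>)"
      if h: "h \<in> mod_hom R (P (Suc j)) B" for h
    proof -
      have "(?\<delta> (Suc j) h = \<zero>\<^bsub>?C (Suc (Suc j))\<^esub>)
        \<longleftrightarrow> (\<forall>x\<in>carrier (P (Suc (Suc j))). h (d (Suc j) x) = \<zero>\<^bsub>B\<^esub>)"
        using h by (auto simp: hom_map_eq compose_def fun_eq_iff)
      also have "\<dots> \<longleftrightarrow> (\<forall>y\<in>d (Suc j) ` carrier (P (Suc (Suc j))). h y = \<zero>\<^bsub>B\<^esub>)" by blast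
      also have "\<dots> \<longleftrightarrow> (\<forall>x\<in>carrier (P (Suc j)). d j x = \<zero>\<^bsub>P j\<^esub> \<longrightarrow> h x = \<zero>\<^bsub>B\<^esub>)"
        unfolding ex by (auto simp: a_kernel_def')
      finally show ?thesis .
    qed
    then show ?thesis by (auto simp: a_kernel_def' simp del: hom_module_simps(2))
  qed
  have H: "?H = {h. \<exists>g\<in>mod_hom R (P j) B. h = compose (carrier (P (Suc j))) g (d j)}"
    by (auto simp: hom_map_eq image_iff)
  have HK: "?H \<subseteq> ?K"
    unfolding H K using mod_hom_compose[OF P d] mod_hom_zero[OF P B] dc
    by (auto simp: compose_def)
  have "carrier (hom_complex_cohomology R P d B (Suc j)) = {zero (hom_complex_cohomology R P d B (Suc j))}
    \<longleftrightarrow> ?K \<subseteq> ?H"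
    unfolding hom_complex_cohomology_def Let_def nat.case
    by (rule quot_module_trivial_iff[OF C submodule_image[OF C C \<delta>] HK])
       (auto simp: a_kernel_def')
  also have "\<dots> \<longleftrightarrow> homs_extend R (P j) (d j ` carrier (P (Suc j))) B"
  proof
    assume KH: "?K \<subseteq> ?H"
    show "homs_extend R (P j) (d j ` carrier (P (Suc j))) B"
      unfolding homs_extend_def
    proof
      fix \<theta> assume \<theta>: "\<theta> \<in> mod_hom R ((P j)\<lparr>carrier := d j ` carrier (P (Suc j))\<rparr>) B"
      have im: "module R ((P j)\<lparr>carrier := d j ` carrier (P (Suc j))\<rparr>)"
        by (rule submodule_carrier_update[OF submodule_image[OF P P d] P])
      have "d j \<in> mod_hom R (P (Suc j)) ((P j)\<lparr>carrier := d j ` carrier (P (Suc j))\<rparr>)"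
        by (rule mod_hom_codomain_restrict[OF d]) simp
      from mod_hom_compose[OF P this \<theta>]
      have "compose (carrier (P (Suc j))) \<theta> (d j) \<in> mod_hom R (P (Suc j)) B" .
      moreover have "\<theta> \<zero>\<^bsub>P j\<^esub> = \<zero>\<^bsub>B\<^esub>" using mod_hom_zero[OF im B \<theta>] by simp
      ultimately have "compose (carrier (P (Suc j))) \<theta> (d j) \<in> ?K"
        unfolding K by (auto simp: compose_def)
      then obtain g where g: "g \<in> mod_hom R (P j) B"
        "compose (carrier (P (Suc j))) \<theta> (d j) = compose (carrier (P (Suc j))) g (d j)"
        using KH unfolding H by blast
      have "g (d j x) = \<theta> (d j x)" if "x \<in> carrier (P (Suc j))" for x
        using fun_cong[OF g(2), of x] that by (simp add: compose_def)
      with g(1) show "\<exists>\<Theta>\<in>mod_hom R (P j) B. \<forall>x\<in>d j ` carrier (P (Suc j)). \<Theta> x = \<theta> x"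
        by blast
    qed
  next
    assume ext: "homs_extend R (P j) (d j ` carrier (P (Suc j))) B"
    show "?K \<subseteq> ?H"
    proof
      fix h assume "h \<in> ?K"
      then have h: "h \<in> mod_hom R (P (Suc j)) B"
        "\<And>x. x \<in> carrier (P (Suc j)) \<Longrightarrow> d j x = \<zero>\<^bsub>P j\<^esub> \<Longrightarrow> h x = \<zero>\<^bsub>B\<^esub>"
        unfolding K by auto
      obtain \<theta> where \<theta>: "\<theta> \<in> mod_hom R ((P j)\<lparr>carrier := d j ` carrier (P (Suc j))\<rparr>) B"
        "\<And>x. x \<in> carrier (P (Suc j)) \<Longrightarrow> \<theta> (d j x) = h x"
        using mod_hom_factor[OF P P B d h(1)] h(2) by blast
      obtain \<Theta> where \<Theta>: "\<Theta> \<in> mod_hom R (P j) B"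
        "\<And>x. x \<in> d j ` carrier (P (Suc j)) \<Longrightarrow> \<Theta> x = \<theta> x"
        using ext \<theta>(1) unfolding homs_extend_def by blast
      have "h = compose (carrier (P (Suc j))) \<Theta> (d j)"
        by (rule mod_hom_eqI[OF h(1) mod_hom_compose[OF P d \<Theta>(1)]]) (simp add: compose_def \<theta> \<Theta>)
      then show "h \<in> ?H" unfolding H using \<Theta>(1) by blast
    qed
  qed
  finally show ?thesis .
qed

lemma the_resolution_obtain:
  fixes R :: "('r, 'x) ring_scheme" and A :: "('r, 'a) module"
  assumes "module R A" "\<one>\<^bsub>R\<^esub> \<noteq> \<zero>\<^bsub>R\<^esub>"
  obtains P d e where "the_resolution R A = (P, d)" "proj_resolution R A P d e"
proof -
  obtain P d where Pd: "the_resolution R A = (P, d)" by fastforce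
  obtain P' d' e' where "proj_resolution R A (P' :: nat \<Rightarrow> ('r, ('r, 'a) resolution_elt) module) d' e'"
    using proj_resolution_exists[OF assms] by blast
  then have "\<exists>x. case x of (P :: nat \<Rightarrow> ('r, ('r, 'a) resolution_elt) module, d) \<Rightarrow>
      \<exists>e. proj_resolution R A P d e" by auto
  from someI_ex[OF this] have "\<exists>e. proj_resolution R A P d e"
    using Pd unfolding the_resolution_def by simp
  then show ?thesis using Pd that by blast
qed

text \<open>The choice in \<open>the_presentation\<close> ranges over modules carried by
  \<open>nat \<Rightarrow> 'r\<close>, hence the types of \<open>F1\<close> and \<open>F0\<close>: a
  presentation by such modules makes it satisfiable.\<close>

lemma the_presentation_obtain:
  fixes R :: "('r, 'x) ring_scheme" and F1 F0 :: "('r, nat \<Rightarrow> 'r) module"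
  assumes "fg_proj_presentation R A F1 F0 g p"
  obtains P1 P0 g' p' where "the_presentation R A = (P1, P0, g')" "fg_proj_presentation R A P1 P0 g' p'"
proof -
  obtain P1 P0 g' where P: "the_presentation R A = (P1, P0, g')"
    by (metis prod.exhaust)
  have "\<exists>x. case x of (P1 :: ('r, nat \<Rightarrow> 'r) module, P0 :: ('r, nat \<Rightarrow> 'r) module, g) \<Rightarrow>
      \<exists>p. fg_proj_presentation R A P1 P0 g p" using assms by auto
  from someI_ex[OF this] have "\<exists>p. fg_proj_presentation R A P1 P0 g' p"
    using P unfolding the_presentation_def by simp
  then show ?thesis using P that by blast
qed

text \<open>
  The choices in the definitions of \<open>Tr\<close> and \<open>Ext\<close> are eliminated here: up to projective summands,
  the first syzygy of \<open>Tr A\<close> is the image of the dual of any given presentation of \<open>A\<close>.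
\<close>

lemma Tr_resolution_obtain:
  fixes R :: "('r, 'x) ring_scheme" and A :: "('r, 'a) module" and F1 F0 :: "('r, nat \<Rightarrow> 'r) module"
  assumes A: "module R A" and nz: "\<one>\<^bsub>R\<^esub> \<noteq> \<zero>\<^bsub>R\<^esub>"
    and pres: "fg_proj_presentation R A F1 F0 g p"
  obtains P :: "nat \<Rightarrow> ('r, ('r, ((nat \<Rightarrow> 'r) \<Rightarrow> 'r) set) resolution_elt) module" and d e
  where "proj_resolution R (Tr R A) P d e"
    "\<forall>j. carrier (Ext R (Suc j) (Tr R A) (regular_module R)) =
        {zero (Ext R (Suc j) (Tr R A) (regular_module R))}
      \<longleftrightarrow> homs_extend R (P j) (d j ` carrier (P (Suc j))) (regular_module R)"
    "stable_retract R (P 0) (d 0 ` carrier (P 1)) (dual_module R F1)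
      (hom_map R g F1 F0 (regular_module R) ` carrier (dual_module R F0))"
    "stable_retract R (dual_module R F1) (hom_map R g F1 F0 (regular_module R) ` carrier (dual_module R F0))
      (P 0) (d 0 ` carrier (P 1))"
proof -
  note reg = module_regular[OF module_cring[OF A]]
  obtain P1 P0 g' p' where the: "the_presentation R A = (P1, P0, g')"
    and pres': "fg_proj_presentation R A P1 P0 g' p'"
    by (rule the_presentation_obtain[OF pres])
  have pr: "projective R P1" "fin_gen R P1" "module R P1" "module R P0" "g' \<in> mod_hom R P1 P0"
    "module R F1" "module R F0" "g \<in> mod_hom R F1 F0"
    using pres' pres projective_module unfolding fg_proj_presentation_def by auto
  let ?D = "dual_module R"
  let ?H = "hom_map R g' P1 P0 (regular_module R) ` carrier (?D P0)"
  let ?L = "hom_map R g F1 F0 (regular_module R) ` carrier (?D F0)"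
  have D: "module R (?D P1)" "module R (?D P0)" "module R (?D F1)" "module R (?D F0)"
    by (intro module_hom_module pr reg)+
  have H: "submodule ?H R (?D P1)" and L: "submodule ?L R (?D F1)"
    using submodule_image[OF D(2,1) hom_map_mod_hom[OF pr(3,4) reg pr(5)]]
      submodule_image[OF D(4,3) hom_map_mod_hom[OF pr(6,7) reg pr(8)]] by auto
  have Tr: "Tr R A = quot_module (?D P1) ?H" by (simp add: Tr_def the coker_def)
  have T: "module R (Tr R A)" unfolding Tr by (rule module_quot[OF D(1) H])
  obtain P d e where res: "the_resolution R (Tr R A) = (P, d)" "proj_resolution R (Tr R A) P d e"
    by (rule the_resolution_obtain[OF T nz])
  note P = proj_resolutionD(1)[OF res(2)] projective_module[OF proj_resolutionD(1)[OF res(2)]]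
    and d = proj_resolutionD(2,3)[OF res(2)] and e = proj_resolutionD(4-6)[OF res(2)]
  have Ext: "Ext R i (Tr R A) (regular_module R) = hom_complex_cohomology R P d (regular_module R) i" for i
    by (simp add: Ext_def res(1))
  \<comment> \<open>Lifting out of the dual of \<open>P1\<close> needs a dual basis for it. Since
    \<open>P1\<close> is finitely generated, its own dual basis can be made finite and then
    dualized.\<close>
  obtain J :: "((nat \<Rightarrow> 'r)) set" and x f where "dual_basis R P1 J x f"
    using projective_dual_basis[OF pr(1)] by blast
  then obtain J' where "finite J'" "dual_basis R P1 J' x f"
    by (rule fin_gen_dual_basis_finite[OF _ pr(3,2)])
  note dbD = dual_basis_dual[OF this(2) pr(3) this(1)]
  obtain K :: "('r, ((nat \<Rightarrow> 'r) \<Rightarrow> 'r) set) resolution_elt set" and y h where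
    dbP: "dual_basis R (P 0) K y h"
    using projective_dual_basis[OF P(1)] by blast
  note q = quot_map[OF D(1) H, folded Tr]
  have sub0: "submodule (d 0 ` carrier (P 1)) R (P 0)"
    using submodule_image[OF P(2) P(2) d(1)[of 0]] by simp
  \<comment> \<open>Both \<open>P 0\<close> and the dual of \<open>P1\<close> map onto the
    transpose, the latter by the quotient map, so the Schanuel argument compares the two
    kernels.\<close>
  have 1: "stable_retract R (P 0) (d 0 ` carrier (P 1)) (?D P1) ?H"
    using stable_retract_covers[OF P(2) D(1) T dbP dbD e(1) q(1)] e(2) q(2)
    unfolding e(3) q(3) by simp
  have 2: "stable_retract R (?D P1) ?H (P 0) (d 0 ` carrier (P 1))"
    using stable_retract_covers[OF D(1) P(2) T dbD dbP q(1) e(1)] e(2) q(2)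
    unfolding e(3) q(3) by simp
  \<comment> \<open>The chosen presentation is now exchanged for the given one. Both directions are
    recorded, because extendability passes from K' to K only: one direction proves vanishing of Ext,
    the other refutes it.\<close>
  note 3 = stable_retract_transpose[OF A pres' pres] and 4 = stable_retract_transpose[OF A pres pres']
  show ?thesis
  proof (rule that)
    show "stable_retract R (P 0) (d 0 ` carrier (P 1)) (?D F1) ?L"
      by (rule stable_retract_trans[OF P(2) D(1) D(3) sub0 submodule_subset[OF H] submodule_subset[OF L] 1 3])
    show "stable_retract R (?D F1) ?L (P 0) (d 0 ` carrier (P 1))"
      by (rule stable_retract_trans[OF D(3) D(1) P(2) L submodule_subset[OF H] submodule_subset[OF sub0] 4 2])
    show "\<forall>j. carrier (Ext R (Suc j) (Tr R A) (regular_module R)) =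
        {zero (Ext R (Suc j) (Tr R A) (regular_module R))}
      \<longleftrightarrow> homs_extend R (P j) (d j ` carrier (P (Suc j))) (regular_module R)"
      unfolding Ext by (intro allI cohomology_trivial_iff[OF res(2) reg])
  qed (fact res(2))
qed


section \<open>The ring in coordinates\<close>

text \<open>The coordinates refer to the basis \<open>1, v, x, y, z, vz, xz, yz\<close> of \<open>R\<close> over the rationals.\<close>

datatype alg = Alg rat rat rat rat rat rat rat rat

instantiation alg :: comm_ring_1
begin

definition "0 = Alg 0 0 0 0 0 0 0 0"
definition "1 = Alg 1 0 0 0 0 0 0 0"

fun plus_alg where
  "Alg a0 a1 a2 a3 a4 a5 a6 a7 + Alg b0 b1 b2 b3 b4 b5 b6 b7 =
     Alg (a0 + b0) (a1 + b1) (a2 + b2) (a3 + b3) (a4 + b4) (a5 + b5) (a6 + b6) (a7 + b7)"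

fun minus_alg where
  "Alg a0 a1 a2 a3 a4 a5 a6 a7 - Alg b0 b1 b2 b3 b4 b5 b6 b7 =
     Alg (a0 - b0) (a1 - b1) (a2 - b2) (a3 - b3) (a4 - b4) (a5 - b5) (a6 - b6) (a7 - b7)"

fun uminus_alg where
  "- Alg a0 a1 a2 a3 a4 a5 a6 a7 = Alg (- a0) (- a1) (- a2) (- a3) (- a4) (- a5) (- a6) (- a7)"

text \<open>The structure constants come from the relations v^2 = z^2 = xy = 0, vx = -2xz, vy = -yz,
  x^2 = vy = -yz and y^2 = -vx = 2xz. Every product of three of v, x, y, z is zero, so vz, xz and yz
  meet only constant terms.\<close>

fun times_alg where
  "Alg a0 a1 a2 a3 a4 a5 a6 a7 * Alg b0 b1 b2 b3 b4 b5 b6 b7 =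
     Alg (a0 * b0) (a0 * b1 + a1 * b0) (a0 * b2 + a2 * b0) (a0 * b3 + a3 * b0) (a0 * b4 + a4 * b0)
       (a0 * b5 + a5 * b0 + a1 * b4 + a4 * b1)
       (a0 * b6 + a6 * b0 + a2 * b4 + a4 * b2 - 2 * (a1 * b2 + a2 * b1) + 2 * (a3 * b3))
       (a0 * b7 + a7 * b0 + a3 * b4 + a4 * b3 - (a1 * b3 + a3 * b1) - a2 * b2)"

instance
proof
  fix a b c :: alg
  show "a + b + c = a + (b + c)" by (cases a; cases b; cases c) simp
  show "a + b = b + a" by (cases a; cases b) simp
  show "0 + a = a" by (cases a) (simp add: zero_alg_def)
  show "- a + a = 0" by (cases a) (simp add: zero_alg_def)
  show "a - b = a + - b" by (cases a; cases b) simp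
  show "a * b * c = a * (b * c)" by (cases a; cases b; cases c) (simp add: algebra_simps)
  show "a * b = b * a" by (cases a; cases b) (simp add: algebra_simps)
  show "1 * a = a" by (cases a) (simp add: one_alg_def)
  show "(a + b) * c = a * c + b * c" by (cases a; cases b; cases c) (simp add: algebra_simps)
  show "0 \<noteq> (1 :: alg)" by (simp add: zero_alg_def one_alg_def)
qed

end

definition aV :: alg where "aV = Alg 0 1 0 0 0 0 0 0"
definition aX :: alg where "aX = Alg 0 0 1 0 0 0 0 0"
definition aY :: alg where "aY = Alg 0 0 0 1 0 0 0 0"
definition aZ :: alg where "aZ = Alg 0 0 0 0 1 0 0 0"
definition scalar :: "rat \<Rightarrow> alg" where "scalar c = Alg c 0 0 0 0 0 0 0"

lemmas alg_defs = aV_def aX_def aY_def aZ_def scalar_def zero_alg_def one_alg_def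

text \<open>The numeral is an iterated sum of 1, so its coordinates are computed once for the
  product rule to apply.\<close>

lemma two_alg: "(2 :: alg) = Alg 2 0 0 0 0 0 0 0"
proof -
  have "(2 :: alg) = 1 + 1" by simp
  then show ?thesis by (simp only: one_alg_def plus_alg.simps) simp
qed

lemma scalar_hom:
  "scalar (c + d) = scalar c + scalar d" "scalar (c * d) = scalar c * scalar d"
  "scalar 0 = 0" "scalar 1 = 1"
  by (simp_all add: alg_defs)

section \<open>Evaluation of polynomials in the eight-dimensional algebra\<close>

definition monom_value :: "(indet \<Rightarrow>\<^sub>0 nat) \<Rightarrow> alg" where
  "monom_value m = aV ^ Poly_Mapping.lookup m Ind_V * aX ^ Poly_Mapping.lookup m Ind_X *
     aY ^ Poly_Mapping.lookup m Ind_Y * aZ ^ Poly_Mapping.lookup m Ind_Z"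

text \<open>The evaluation homomorphism that sends the indeterminates to \<open>aV\<close>,
  \<open>aX\<close>, \<open>aY\<close> and \<open>aZ\<close>; \<open>ideal_I_iff\<close> identifies
  its kernel.\<close>

definition poly_value :: "rat_poly \<Rightarrow> alg" where
  "poly_value p = (\<Sum>m\<in>Poly_Mapping.keys p. scalar (Poly_Mapping.lookup p m) * monom_value m)"

lemma monom_value_add: "monom_value (m + n) = monom_value m * monom_value n"
  by (simp add: monom_value_def lookup_add power_add algebra_simps)

lemma poly_value_superset:
  assumes "finite S" "Poly_Mapping.keys p \<subseteq> S"
  shows "poly_value p = (\<Sum>m\<in>S. scalar (Poly_Mapping.lookup p m) * monom_value m)"
  unfolding poly_value_def
  by (rule sum.mono_neutral_left) (use assms in \<open>auto simp: in_keys_iff scalar_hom\<close>)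

lemma poly_value_add: "poly_value (p + q) = poly_value p + poly_value q"
proof -
  let ?S = "Poly_Mapping.keys p \<union> Poly_Mapping.keys q"
  have "poly_value (p + q) = (\<Sum>m\<in>?S. scalar (Poly_Mapping.lookup (p + q) m) * monom_value m)"
    by (rule poly_value_superset) (use keys_add[of p q] in auto)
  also have "\<dots> = poly_value p + poly_value q"
    by (simp add: lookup_add scalar_hom distrib_right sum.distrib poly_value_superset[of ?S])
  finally show ?thesis .
qed

lemma poly_value_zero: "poly_value 0 = 0"
  by (simp add: poly_value_def)

lemma poly_value_single: "poly_value (Poly_Mapping.single m c) = scalar c * monom_value m"
  by (subst poly_value_superset[of "{m}"]) (auto split: if_splits)

lemma rat_poly_induct [case_names zero single add]:
  fixes p :: rat_poly
  assumes "P 0" "\<And>m c. P (Poly_Mapping.single m c)" "\<And>p q. P p \<Longrightarrow> P q \<Longrightarrow> P (p + q)"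
  shows "P p"
proof -
  have "p = (\<Sum>m\<in>Poly_Mapping.keys p. Poly_Mapping.single m (Poly_Mapping.lookup p m))"
    by (rule poly_mapping_eqI)
       (auto simp: lookup_sum lookup_single when_def in_keys_iff if_distrib sum.delta cong: if_cong)
  moreover have "P (\<Sum>m\<in>S. Poly_Mapping.single m (Poly_Mapping.lookup p m))" if "finite S" for S
    using that by induction (auto intro: assms)
  ultimately show ?thesis by (metis finite_keys)
qed

lemma poly_value_mult: "poly_value (p * q) = poly_value p * poly_value q"
proof (induction p rule: rat_poly_induct)
  case (single m c)
  show ?case
  proof (induction q rule: rat_poly_induct)
    case (single n d)
    show ?case by (simp add: mult_single poly_value_single monom_value_add scalar_hom)
  qed (simp_all add: poly_value_add distrib_left poly_value_zero)
qed (simp_all add: poly_value_add distrib_right poly_value_zero)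

definition const_poly :: "rat \<Rightarrow> rat_poly" where
  "const_poly c = Poly_Mapping.single 0 c"

lemma const_poly_hom:
  "const_poly (c + d) = const_poly c + const_poly d" "const_poly (c - d) = const_poly c - const_poly d"
  "const_poly (- c) = - const_poly c" "const_poly (c * d) = const_poly c * const_poly d"
  "const_poly 0 = 0" "const_poly 1 = 1" "const_poly 2 = 2"
  by (simp_all add: const_poly_def single_add single_diff single_uminus mult_single)

lemma poly_value_simps:
  "poly_value pV = aV" "poly_value pX = aX" "poly_value pY = aY" "poly_value pZ = aZ"
  "poly_value (const_poly c) = scalar c" "poly_value 0 = 0" "poly_value 1 = 1" "poly_value 2 = 2"
  "poly_value (p - q) = poly_value p - poly_value q" "poly_value (p ^ n) = poly_value p ^ n"
proof -
  show v: "poly_value pV = aV" "poly_value pX = aX" "poly_value pY = aY" "poly_value pZ = aZ"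
    by (simp_all add: indet_poly_def poly_value_single monom_value_def lookup_single scalar_hom)
  show c: "poly_value (const_poly c) = scalar c" for c
    by (simp add: const_poly_def poly_value_single monom_value_def)
  show z: "poly_value 0 = 0" and o: "poly_value 1 = 1"
    using c[of 0] c[of 1] by (simp_all add: const_poly_hom scalar_hom)
  show "poly_value 2 = 2" using poly_value_add[of 1 1] o by simp
  have "poly_value (p - q) + poly_value q = poly_value p" by (simp flip: poly_value_add)
  then show "poly_value (p - q) = poly_value p - poly_value q" by (simp add: algebra_simps)
  show "poly_value (p ^ n) = poly_value p ^ n"
    by (induction n) (simp_all add: o poly_value_mult)
qed

text \<open>An additive section of \<open>poly_value\<close> with values in the span of the eight
  basis monomials.\<close>

fun normal_form :: "alg \<Rightarrow> rat_poly" where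
  "normal_form (Alg a0 a1 a2 a3 a4 a5 a6 a7) =
     const_poly a0 + const_poly a1 * pV + const_poly a2 * pX + const_poly a3 * pY + const_poly a4 * pZ +
     const_poly a5 * (pV * pZ) + const_poly a6 * (pX * pZ) + const_poly a7 * (pY * pZ)"

lemma poly_value_normal_form: "poly_value (normal_form a) = a"
  by (cases a) (simp add: poly_value_add poly_value_mult poly_value_simps, simp add: alg_defs)

lemma normal_form_add: "normal_form (a + b) = normal_form a + normal_form b"
  by (cases a; cases b) (simp add: const_poly_hom algebra_simps)

lemma poly_ring_simps:
  "carrier poly_ring_VXYZ = UNIV" "monoid.mult poly_ring_VXYZ = (*)" "one poly_ring_VXYZ = 1"
  "zero poly_ring_VXYZ = 0" "add poly_ring_VXYZ = (+)"
  by (simp_all add: poly_ring_VXYZ_def ring_of_type_algebra_def)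

section \<open>The ideal as the kernel of evaluation\<close>

lemma cring_poly_ring: "cring poly_ring_VXYZ"
  unfolding poly_ring_VXYZ_def by (rule cring_from_type_algebra)

lemma ideal_ideal_I: "ideal ideal_I poly_ring_VXYZ"
proof -
  interpret cring poly_ring_VXYZ by (rule cring_poly_ring)
  show ?thesis unfolding ideal_I_def by (rule genideal_ideal) (simp add: poly_ring_simps)
qed

lemma ideal_I_closed:
  "p \<in> ideal_I \<Longrightarrow> q \<in> ideal_I \<Longrightarrow> p + q \<in> ideal_I"
  "p \<in> ideal_I \<Longrightarrow> r * p \<in> ideal_I"
  "p \<in> ideal_I \<Longrightarrow> q \<in> ideal_I \<Longrightarrow> p - q \<in> ideal_I"
  "0 \<in> ideal_I"
proof -
  interpret ideal ideal_I poly_ring_VXYZ by (rule ideal_ideal_I)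
  show add: "p + q \<in> ideal_I" if "p \<in> ideal_I" "q \<in> ideal_I" for p q
    using additive_subgroup.a_closed[OF is_additive_subgroup that] by (simp add: poly_ring_simps)
  show mult: "r * p \<in> ideal_I" if "p \<in> ideal_I" for r p
    using I_l_closed[OF that, of r] by (simp add: poly_ring_simps)
  show "p - q \<in> ideal_I" if "p \<in> ideal_I" "q \<in> ideal_I" for p q
    using add[OF that(1) mult[OF that(2), of "- 1"]] by simp
  show "0 \<in> ideal_I" using additive_subgroup.zero_closed[OF is_additive_subgroup] by (simp add: poly_ring_simps)
qed

lemma ideal_I_generators:
  "pV ^ 2 \<in> ideal_I" "pZ ^ 2 \<in> ideal_I" "pX * pY \<in> ideal_I" "pV * pX + 2 * pX * pZ \<in> ideal_I"
  "pV * pY + pY * pZ \<in> ideal_I" "pV * pX + pY ^ 2 \<in> ideal_I" "pV * pY - pX ^ 2 \<in> ideal_I"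
proof -
  interpret cring poly_ring_VXYZ by (rule cring_poly_ring)
  have "{pV ^ 2, pZ ^ 2, pX * pY, pV * pX + 2 * pX * pZ, pV * pY + pY * pZ,
      pV * pX + pY ^ 2, pV * pY - pX ^ 2} \<subseteq> ideal_I"
    unfolding ideal_I_def by (rule genideal_self) (simp add: poly_ring_simps)
  then show "pV ^ 2 \<in> ideal_I" "pZ ^ 2 \<in> ideal_I" "pX * pY \<in> ideal_I"
    "pV * pX + 2 * pX * pZ \<in> ideal_I" "pV * pY + pY * pZ \<in> ideal_I" "pV * pX + pY ^ 2 \<in> ideal_I"
    "pV * pY - pX ^ 2 \<in> ideal_I" by auto
qed

text \<open>Explicit certificates of membership: the cofactors record how the product of each basis
  monomial with an indeterminate is rewritten by the generators. The subtracted multiples of Z^2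
  remove cubic remainders such as XZ^2.\<close>

lemma normal_form_mult_indet:
  "normal_form a * pV - normal_form (a * aV) \<in> ideal_I"
  "normal_form a * pX - normal_form (a * aX) \<in> ideal_I"
  "normal_form a * pY - normal_form (a * aY) \<in> ideal_I"
  "normal_form a * pZ - normal_form (a * aZ) \<in> ideal_I"
proof -
  obtain a0 a1 a2 a3 a4 a5 a6 a7 where a: "a = Alg a0 a1 a2 a3 a4 a5 a6 a7" by (cases a)
  let ?c = const_poly
  note simps = a alg_defs const_poly_hom power2_eq_square algebra_simps
  have "normal_form a * pV - normal_form (a * aV) =
      (?c a1 + ?c a5 * pZ) * pV ^ 2 + (?c a2 + ?c a6 * pZ) * (pV * pX + 2 * pX * pZ) +
      (?c a3 + ?c a7 * pZ) * (pV * pY + pY * pZ) - (2 * ?c a6 * pX + ?c a7 * pY) * pZ ^ 2"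
    by (simp add: simps)
  also have "\<dots> \<in> ideal_I" by (intro ideal_I_closed ideal_I_generators)
  finally show "normal_form a * pV - normal_form (a * aV) \<in> ideal_I" .
  \<comment> \<open>X^2 is rewritten as -YZ by way of VY, which takes the two generators VY - X^2
    and VY + YZ.\<close>
  have "normal_form a * pX - normal_form (a * aX) =
      (?c a1 + ?c a5 * pZ) * (pV * pX + 2 * pX * pZ) + (?c a3 + ?c a7 * pZ) * (pX * pY) +
      (?c a2 + ?c a6 * pZ) * (pV * pY + pY * pZ) - (?c a2 + ?c a6 * pZ) * (pV * pY - pX ^ 2)
      - (2 * ?c a5 * pX + ?c a6 * pY) * pZ ^ 2"
    by (simp add: simps)
  also have "\<dots> \<in> ideal_I" by (intro ideal_I_closed ideal_I_generators)
  finally show "normal_form a * pX - normal_form (a * aX) \<in> ideal_I" .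
  \<comment> \<open>Y^2 is rewritten as 2XZ by way of VX, which takes the two generators VX + Y^2
    and VX + 2XZ.\<close>
  have "normal_form a * pY - normal_form (a * aY) =
      (?c a1 + ?c a5 * pZ) * (pV * pY + pY * pZ) + (?c a2 + ?c a6 * pZ) * (pX * pY) +
      (?c a3 + ?c a7 * pZ) * (pV * pX + pY ^ 2) - (?c a3 + ?c a7 * pZ) * (pV * pX + 2 * pX * pZ)
      - (?c a5 * pY - 2 * ?c a7 * pX) * pZ ^ 2"
    by (simp add: simps)
  also have "\<dots> \<in> ideal_I" by (intro ideal_I_closed ideal_I_generators)
  finally show "normal_form a * pY - normal_form (a * aY) \<in> ideal_I" .
  have "normal_form a * pZ - normal_form (a * aZ) =
      (?c a4 + ?c a5 * pV + ?c a6 * pX + ?c a7 * pY) * pZ ^ 2"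
    by (simp add: simps)
  also have "\<dots> \<in> ideal_I" by (intro ideal_I_closed ideal_I_generators)
  finally show "normal_form a * pZ - normal_form (a * aZ) \<in> ideal_I" .
qed

lemma single_eq_prod:
  "Poly_Mapping.single m c =
     const_poly c * pV ^ Poly_Mapping.lookup m Ind_V * pX ^ Poly_Mapping.lookup m Ind_X *
     pY ^ Poly_Mapping.lookup m Ind_Y * pZ ^ Poly_Mapping.lookup m Ind_Z"
proof -
  have pow: "indet_poly i ^ n = Poly_Mapping.single (Poly_Mapping.single i n) 1" for i n
    by (induction n) (simp_all add: indet_poly_def mult_single flip: single_add)
  have "m = Poly_Mapping.single Ind_V (Poly_Mapping.lookup m Ind_V) +
      Poly_Mapping.single Ind_X (Poly_Mapping.lookup m Ind_X) +
      Poly_Mapping.single Ind_Y (Poly_Mapping.lookup m Ind_Y) +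
      Poly_Mapping.single Ind_Z (Poly_Mapping.lookup m Ind_Z)"
  proof (rule poly_mapping_eqI)
    fix k
    show "Poly_Mapping.lookup m k = Poly_Mapping.lookup (Poly_Mapping.single Ind_V (Poly_Mapping.lookup m Ind_V) +
      Poly_Mapping.single Ind_X (Poly_Mapping.lookup m Ind_X) +
      Poly_Mapping.single Ind_Y (Poly_Mapping.lookup m Ind_Y) +
      Poly_Mapping.single Ind_Z (Poly_Mapping.lookup m Ind_Z)) k"
      by (cases k) (simp_all add: lookup_add lookup_single)
  qed
  then show ?thesis by (simp add: pow const_poly_def mult_single)
qed

text \<open>A monomial is a constant times powers of the indeterminates, so it is reached by
  multiplying with one indeterminate at a time, and \<open>normal_form_mult_indet\<close> reduces
  each step.\<close>

lemma diff_normal_form_mem: "p - normal_form (poly_value p) \<in> ideal_I"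
proof (induction p rule: rat_poly_induct)
  case zero
  show ?case by (simp add: poly_value_simps zero_alg_def const_poly_hom ideal_I_closed)
next
  case (add p q)
  have "p + q - normal_form (poly_value (p + q)) =
      (p - normal_form (poly_value p)) + (q - normal_form (poly_value q))"
    by (simp add: poly_value_add normal_form_add)
  also have "\<dots> \<in> ideal_I" by (rule ideal_I_closed(1)[OF add])
  finally show ?case .
next
  case (single m c)
  \<comment> \<open>The product is reduced in two stages: p to its normal form, then the product of
    that normal form with t.\<close>
  have mult: "p * t - normal_form (poly_value (p * t)) \<in> ideal_I"
    if "p - normal_form (poly_value p) \<in> ideal_I"
      and "\<And>a. normal_form a * t - normal_form (a * poly_value t) \<in> ideal_I" for p t
  proof -
    have "p * t - normal_form (poly_value (p * t)) = t * (p - normal_form (poly_value p)) +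
        (normal_form (poly_value p) * t - normal_form (poly_value p * poly_value t))"
      by (simp add: poly_value_mult algebra_simps)
    then show ?thesis using ideal_I_closed(1)[OF ideal_I_closed(2)[OF that(1)] that(2)] by simp
  qed
  have pow: "p * t ^ n - normal_form (poly_value (p * t ^ n)) \<in> ideal_I"
    if "p - normal_form (poly_value p) \<in> ideal_I"
      and "\<And>a. normal_form a * t - normal_form (a * poly_value t) \<in> ideal_I" for p t n
  proof (induction n)
    case (Suc n)
    from mult[OF this that(2)] show ?case by (simp add: ac_simps)
  qed (use that(1) in simp)
  have c: "const_poly c - normal_form (poly_value (const_poly c)) \<in> ideal_I"
    by (simp add: poly_value_simps scalar_def const_poly_hom ideal_I_closed)
  show ?case unfolding single_eq_prod
    by (intro pow c; unfold poly_value_simps; rule normal_form_mult_indet)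
qed

text \<open>The kernel of evaluation is an ideal that contains the generators, which bounds
  \<open>ideal_I\<close> from above. Conversely p differs from the normal form of its value by a
  member of the ideal. Together with \<open>poly_value_normal_form\<close> this makes the eight
  monomials a basis of the quotient.\<close>

lemma ideal_I_iff: "p \<in> ideal_I \<longleftrightarrow> poly_value p = 0"
proof
  assume "poly_value p = 0"
  then show "p \<in> ideal_I"
    using diff_normal_form_mem[of p] by (simp add: zero_alg_def const_poly_hom)
next
  interpret cring poly_ring_VXYZ by (rule cring_poly_ring)
  let ?K = "{p. poly_value p = 0}"
  have "ideal ?K poly_ring_VXYZ"
  proof (rule idealI)
    show "subgroup ?K (add_monoid poly_ring_VXYZ)"
    proof
      fix p assume "p \<in> ?K"
      have "inv\<^bsub>add_monoid poly_ring_VXYZ\<^esub> p = - p"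
        using minus_equality[of "- p" p] unfolding a_inv_def by (simp add: poly_ring_simps)
      then show "inv\<^bsub>add_monoid poly_ring_VXYZ\<^esub> p \<in> ?K"
        using \<open>p \<in> ?K\<close> poly_value_simps(9)[of 0 p] by (simp add: poly_value_simps)
    qed (auto simp: poly_ring_simps poly_value_add poly_value_simps)
  qed (auto simp: poly_ring_simps poly_value_mult ring_axioms)
  then have "ideal_I \<subseteq> ?K"
    unfolding ideal_I_def
    by (rule genideal_minimal)
       (simp add: poly_value_add poly_value_mult poly_value_simps, simp add: two_alg alg_defs power2_eq_square)
  then show "poly_value p = 0" if "p \<in> ideal_I" using that by blast
qed

text \<open>The isomorphism from \<open>alg\<close> onto the quotient ring; through it an equation
  in \<open>ring_R\<close> becomes a system of equations between rational coordinates.\<close>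

definition rc :: "alg \<Rightarrow> rat_poly set" where
  "rc a = residue_class (normal_form a)"

lemma residue_class_eq_iff: "residue_class p = residue_class q \<longleftrightarrow> poly_value p = poly_value q"
proof -
  interpret ideal ideal_I poly_ring_VXYZ by (rule ideal_ideal_I)
  have rc: "residue_class p = {h + p | h. h \<in> ideal_I}" for p
    by (auto simp: residue_class_def a_r_coset_def' poly_ring_simps)
  have mem: "r \<in> residue_class p \<longleftrightarrow> poly_value r = poly_value p" for r p
  proof -
    have "r \<in> residue_class p \<longleftrightarrow> r - p \<in> ideal_I"
      unfolding rc by (auto intro!: exI[of _ "r - p"])
    then show ?thesis by (simp add: ideal_I_iff poly_value_simps)
  qed
  show ?thesis using mem by (auto simp: set_eq_iff)
qed

lemma residue_class_rc: "residue_class p = rc (poly_value p)"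
  by (simp add: rc_def residue_class_eq_iff poly_value_normal_form)

lemma cring_ring_R: "cring ring_R"
  unfolding ring_R_def by (rule ideal.quotient_is_cring[OF ideal_ideal_I cring_poly_ring])

lemma rc_hom:
  "rc a \<oplus>\<^bsub>ring_R\<^esub> rc b = rc (a + b)" "rc a \<otimes>\<^bsub>ring_R\<^esub> rc b = rc (a * b)"
  "\<zero>\<^bsub>ring_R\<^esub> = rc 0" "\<one>\<^bsub>ring_R\<^esub> = rc 1"
proof -
  interpret ideal ideal_I poly_ring_VXYZ by (rule ideal_ideal_I)
  have "residue_class p \<oplus>\<^bsub>ring_R\<^esub> residue_class q = residue_class (p + q)" for p q
    using a_rcos_sum[of p q] by (simp add: ring_R_def FactRing_def residue_class_def poly_ring_simps)
  then show "rc a \<oplus>\<^bsub>ring_R\<^esub> rc b = rc (a + b)"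
    by (simp add: rc_def residue_class_eq_iff poly_value_add poly_value_normal_form)
  have "residue_class p \<otimes>\<^bsub>ring_R\<^esub> residue_class q = residue_class (p * q)" for p q
    using rcoset_mult_add[of p q] by (simp add: ring_R_def FactRing_def residue_class_def poly_ring_simps)
  then show "rc a \<otimes>\<^bsub>ring_R\<^esub> rc b = rc (a * b)"
    by (simp add: rc_def residue_class_eq_iff poly_value_mult poly_value_normal_form)
  have "\<one>\<^bsub>ring_R\<^esub> = residue_class 1"
    by (simp add: ring_R_def FactRing_def residue_class_def poly_ring_simps)
  then show "\<one>\<^bsub>ring_R\<^esub> = rc 1" by (simp add: residue_class_rc poly_value_simps)
  have "\<zero>\<^bsub>ring_R\<^esub> = residue_class 0"
    using a_coset_add_zero[of ideal_I]
    by (simp add: ring_R_def FactRing_def residue_class_def poly_ring_simps)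
  then show "\<zero>\<^bsub>ring_R\<^esub> = rc 0" by (simp add: residue_class_rc poly_value_simps)
qed

lemma rc_eq_iff: "rc a = rc b \<longleftrightarrow> a = b"
  by (simp add: rc_def residue_class_eq_iff poly_value_normal_form)

lemma carrier_ring_R: "carrier ring_R = range rc"
proof -
  have "carrier ring_R = range residue_class"
    by (auto simp: ring_R_def FactRing_def A_RCOSETS_def' residue_class_def poly_ring_simps)
  also have "\<dots> = range rc"
    by (auto simp: residue_class_rc) (metis poly_value_normal_form rangeI residue_class_rc)
  finally show ?thesis .
qed


section \<open>The two modules\<close>

definition vec2 :: "alg \<Rightarrow> alg \<Rightarrow> nat \<Rightarrow> rat_poly set" where
  "vec2 a b = (\<lambda>i\<in>{..<2}. rc (if i = 0 then a else b))"

text \<open>The matrices of the acyclic complex: \<open>f\<close> is the one with \<open>c = 2\<close>.\<close>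

definition matrix_c :: "rat \<Rightarrow> (nat \<Rightarrow> rat_poly set) \<Rightarrow> nat \<Rightarrow> rat_poly set" where
  "matrix_c c = matrix_map ring_R 2 2
     (\<lambda>i j. [[rc aV, rc (scalar c * aX)], [rc aY, rc aZ]] ! i ! j)"

lemma map_f_eq: "map_f = matrix_c 2"
  by (simp add: map_f_def matrix_c_def residue_class_rc poly_value_simps poly_value_mult,
      simp add: two_alg scalar_def)

lemma lessThan_2: "{..<2 :: nat} = {0, 1}"
  by auto

lemma vec2_eq_iff: "vec2 a b = vec2 a' b' \<longleftrightarrow> a = a' \<and> b = b'"
proof
  assume *: "vec2 a b = vec2 a' b'"
  show "a = a' \<and> b = b'"
    using fun_cong[OF *, of 0] fun_cong[OF *, of 1] by (simp add: vec2_def rc_eq_iff)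
qed simp

lemma carrier_R_squared: "carrier R_squared = {vec2 a b | a b. True}"
proof (intro equalityI subsetI)
  fix u assume "u \<in> carrier R_squared"
  then have u: "u \<in> {..<2} \<rightarrow>\<^sub>E range rc" by (auto simp: R_squared_def carrier_ring_R)
  have "u 0 \<in> range rc" "u 1 \<in> range rc" using PiE_mem[OF u] by simp_all
  then obtain a b where ab: "u 0 = rc a" "u 1 = rc b" by blast
  have "u = vec2 a b"
    by (rule extensionalityI[of u "{..<2}"])
       (use u ab in \<open>auto simp: vec2_def PiE_def less_2_cases_iff\<close>)
  then show "u \<in> {vec2 a b | a b. True}" by blast
qed (auto simp: R_squared_def vec2_def carrier_ring_R)

lemma vec2_mem [simp]: "vec2 a b \<in> carrier R_squared"
  by (auto simp: carrier_R_squared)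

lemma R_squared_cases:
  assumes "u \<in> carrier R_squared"
  obtains a b where "u = vec2 a b"
  using assms by (auto simp: carrier_R_squared)

lemma vec2_add: "vec2 a b \<oplus>\<^bsub>R_squared\<^esub> vec2 a' b' = vec2 (a + a') (b + b')"
  by (auto simp: R_squared_def vec2_def fun_eq_iff rc_hom)

lemma vec2_smult: "rc r \<odot>\<^bsub>R_squared\<^esub> vec2 a b = vec2 (r * a) (r * b)"
  by (auto simp: R_squared_def vec2_def fun_eq_iff rc_hom)

lemma vec2_zero: "\<zero>\<^bsub>R_squared\<^esub> = vec2 0 0"
  by (auto simp: R_squared_def vec2_def fun_eq_iff rc_hom)

lemma rc_mem [simp]: "rc a \<in> carrier ring_R"
  by (simp add: carrier_ring_R)

lemma ring_R_cases:
  assumes "r \<in> carrier ring_R"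
  obtains a where "r = rc a"
  using assms by (auto simp: carrier_ring_R)

lemma matrix_c_vec2: "matrix_c c (vec2 a b) = vec2 (aV * a + scalar c * aX * b) (aY * a + aZ * b)"
proof -
  interpret R: cring ring_R by (rule cring_ring_R)
  have fs: "(\<Oplus>\<^bsub>ring_R\<^esub>j\<in>{..<2}. rc (g j)) = rc (g 0 + g (1 :: nat))" for g
    unfolding lessThan_2 by (simp add: R.finsum_insert Pi_iff rc_hom)
  have u: "vec2 a b \<in> carrier (free_module ring_R {..<2})"
    using vec2_mem[of a b] by (simp only: R_squared_def)
  have "matrix_c c (vec2 a b) i = vec2 (aV * a + scalar c * aX * b) (aY * a + aZ * b) i" for i
  proof (cases "i < 2")
    case False
    then show ?thesis unfolding matrix_c_def matrix_map_def restrict_apply'[OF u] by (simp add: vec2_def)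
  next
    case True
    let ?A = "\<lambda>i j. [[aV, scalar c * aX], [aY, aZ]] ! i ! j"
    have A: "[[rc aV, rc (scalar c * aX)], [rc aY, rc aZ]] ! i ! j = rc (?A i j)" if "j < 2" for j
      using True that by (auto simp: less_2_cases_iff)
    have "(\<Oplus>\<^bsub>ring_R\<^esub>j\<in>{..<2}. [[rc aV, rc (scalar c * aX)], [rc aY, rc aZ]] ! i ! j
          \<otimes>\<^bsub>ring_R\<^esub> vec2 a b j)
        = (\<Oplus>\<^bsub>ring_R\<^esub>j\<in>{..<2}. rc (?A i j * (if j = 0 then a else b)))"
      by (rule R.finsum_cong') (auto simp: A vec2_def rc_hom)
    also have "\<dots> = rc (?A i 0 * a + ?A i 1 * b)" by (simp add: fs)
    finally show ?thesis
      unfolding matrix_c_def matrix_map_def restrict_apply'[OF u]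
      using True by (auto simp: vec2_def less_2_cases_iff)
  qed
  then show ?thesis by blast
qed

lemma one_neq_zero_ring_R: "\<one>\<^bsub>ring_R\<^esub> \<noteq> \<zero>\<^bsub>ring_R\<^esub>"
  by (simp add: rc_hom rc_eq_iff)

lemma module_R_squared: "module ring_R R_squared"
  unfolding R_squared_def by (rule module_free[OF cring_ring_R])

lemma matrix_c_mod_hom: "matrix_c c \<in> mod_hom ring_R R_squared R_squared"
proof -
  have "(\<lambda>u\<in>carrier R_squared. matrix_c c u) \<in> mod_hom ring_R R_squared R_squared"
    by (rule mod_hom_restrictI[OF module_R_squared])
       (auto elim!: R_squared_cases ring_R_cases
         simp: matrix_c_vec2 vec2_add vec2_smult vec2_eq_iff algebra_simps)
  also have "(\<lambda>u\<in>carrier R_squared. matrix_c c u) = matrix_c c"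
    by (simp add: matrix_c_def matrix_map_def R_squared_def fun_eq_iff)
  finally show ?thesis .
qed

text \<open>Comparing coordinates gives a rational linear system. Two factors must not vanish: 4c -
  1, which forces the coefficient of y in a to be zero, and 2c - 1, the denominator in the preimage.
  Both are nonzero for c \<ge> 1.\<close>

lemma matrix_c_exact_alg:
  assumes "1 \<le> c"
  shows "aV * a + scalar (2 * c) * aX * b = 0 \<and> aY * a + aZ * b = 0 \<longleftrightarrow>
    (\<exists>a' b'. a = aV * a' + scalar c * aX * b' \<and> b = aY * a' + aZ * b')"
proof
  assume *: "aV * a + scalar (2 * c) * aX * b = 0 \<and> aY * a + aZ * b = 0"
  obtain a0 a1 a2 a3 a4 a5 a6 a7 where a: "a = Alg a0 a1 a2 a3 a4 a5 a6 a7" by (cases a)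
  obtain b0 b1 b2 b3 b4 b5 b6 b7 where b: "b = Alg b0 b1 b2 b3 b4 b5 b6 b7" by (cases b)
  \<comment> \<open>The matrix entries annihilate vz, xz and yz, so the conditions involve only the
    coordinates 0 to 4 of a and b.\<close>
  have eqs: "a0 = 0" "b0 = 0" "a4 = 0" "b1 = 0" "- 2 * a2 + 2 * c * b4 = 0" "a3 + 2 * c * b2 = 0"
    "2 * a3 + b2 = 0" "b3 = a1"
    using * assms by (auto simp: a b alg_defs algebra_simps)
  have "b2 = - 2 * a3" using eqs(7) by simp
  then have "a3 * (4 * c - 1) = 0" using eqs(6) by (simp add: algebra_simps)
  then have "a3 = 0" using assms by auto
  then have z: "a3 = 0" "b2 = 0" "a2 = c * b4" using eqs by auto
  \<comment> \<open>This is the coefficient of y in a'. The yz-coordinate of the first equation and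
    the xz-coordinate of the second, with the coefficient of x in b' eliminated, give (2c - 1) s3 =
    a7 + c b6.\<close>
  define s3 where "s3 = (a7 + c * b6) / (2 * c - 1)"
  have s3: "s3 * (2 * c - 1) = a7 + c * b6" using assms by (simp add: s3_def)
  have "a = aV * Alg a1 0 (- a6 / 2 - c * b5) s3 a5 0 0 0 +
        scalar c * aX * Alg b4 b5 (b6 - 2 * s3) (b7 - a5) 0 0 0 0"
    "b = aY * Alg a1 0 (- a6 / 2 - c * b5) s3 a5 0 0 0 +
        aZ * Alg b4 b5 (b6 - 2 * s3) (b7 - a5) 0 0 0 0"
    using eqs z s3 by (simp_all add: a b alg_defs algebra_simps)
  then show "\<exists>a' b'. a = aV * a' + scalar c * aX * b' \<and> b = aY * a' + aZ * b'" by blast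
next
  assume "\<exists>a' b'. a = aV * a' + scalar c * aX * b' \<and> b = aY * a' + aZ * b'"
  then obtain a' b' where ab: "a = aV * a' + scalar c * aX * b'" "b = aY * a' + aZ * b'" by blast
  show "aV * a + scalar (2 * c) * aX * b = 0 \<and> aY * a + aZ * b = 0"
    unfolding ab by (cases a'; cases b') (simp add: alg_defs algebra_simps)
qed

text \<open>Here the equations b3 = a2 and b3 = c a2 leave the factor c - 1, so c = 1 has to be
  excluded: there a2 = b3 is free, and (x, y) is a solution. The other factor, 2 (2c - 1), is the
  denominator of s2.\<close>

lemma matrix_c_transpose_exact_alg:
  assumes "2 \<le> c"
  shows "p * aV + q * aY = 0 \<and> p * scalar c * aX + q * aZ = 0 \<longleftrightarrow>
    (\<exists>p' q'. p = p' * aV + q' * aY \<and> q = p' * scalar (2 * c) * aX + q' * aZ)"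
proof
  assume *: "p * aV + q * aY = 0 \<and> p * scalar c * aX + q * aZ = 0"
  obtain a0 a1 a2 a3 a4 a5 a6 a7 where a: "p = Alg a0 a1 a2 a3 a4 a5 a6 a7" by (cases p)
  obtain b0 b1 b2 b3 b4 b5 b6 b7 where b: "q = Alg b0 b1 b2 b3 b4 b5 b6 b7" by (cases q)
  have eqs: "a0 = 0" "b0 = 0" "a4 = 0" "b1 = 0" "b3 = a2" "b4 = a3" "b2 = 2 * c * a1" "b3 = c * a2"
    using * assms by (auto simp: a b alg_defs algebra_simps)
  have "a2 * (c - 1) = 0" using eqs(5,8) by (simp add: algebra_simps)
  then have z: "a2 = 0" "b3 = 0" using assms eqs(5) by auto
  \<comment> \<open>This is the coefficient of x in p'. It results from the xz-coordinate of p and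
    the yz-coordinate of q when the coefficient of y in q' is eliminated.\<close>
  define s2 where "s2 = (a6 - 2 * b7) / (2 * (2 * c - 1))"
  have "s2 * (2 * (2 * c - 1)) = a6 - 2 * b7" using assms by (simp add: s2_def)
  then have s2: "c * (s2 * 4) = a6 - 2 * b7 + 2 * s2" by (simp add: algebra_simps)
  have "p = Alg a1 0 s2 (- a7 - b5) a5 0 0 0 * aV + Alg a3 b5 (b6 - 2 * c * a5) (b7 + 2 * c * s2) 0 0 0 0 * aY"
    "q = Alg a1 0 s2 (- a7 - b5) a5 0 0 0 * scalar (2 * c) * aX +
      Alg a3 b5 (b6 - 2 * c * a5) (b7 + 2 * c * s2) 0 0 0 0 * aZ"
    using eqs z s2 by (simp_all add: a b alg_defs algebra_simps)
  then show "\<exists>p' q'. p = p' * aV + q' * aY \<and> q = p' * scalar (2 * c) * aX + q' * aZ" by blast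
next
  assume "\<exists>p' q'. p = p' * aV + q' * aY \<and> q = p' * scalar (2 * c) * aX + q' * aZ"
  then obtain p' q' where pq: "p = p' * aV + q' * aY" "q = p' * scalar (2 * c) * aX + q' * aZ" by blast
  show "p * aV + q * aY = 0 \<and> p * scalar c * aX + q * aZ = 0"
    unfolding pq by (cases p'; cases q') (simp add: alg_defs algebra_simps)
qed

lemma matrix_c_exact:
  assumes "1 \<le> c"
  shows "matrix_c c ` carrier R_squared = a_kernel R_squared R_squared (matrix_c (2 * c))"
proof (intro equalityI subsetI)
  fix u assume "u \<in> matrix_c c ` carrier R_squared"
  then obtain w where "w \<in> carrier R_squared" "u = matrix_c c w" by blast
  then obtain a b where "u = matrix_c c (vec2 a b)" by (metis R_squared_cases)
  then show "u \<in> a_kernel R_squared R_squared (matrix_c (2 * c))"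
    using matrix_c_exact_alg[OF assms]
    by (auto simp: a_kernel_def' matrix_c_vec2 vec2_zero vec2_eq_iff)
next
  fix u assume u: "u \<in> a_kernel R_squared R_squared (matrix_c (2 * c))"
  then obtain a b where ab: "u = vec2 a b" by (auto simp: a_kernel_def' elim: R_squared_cases)
  then obtain a' b' where "a = aV * a' + scalar c * aX * b'" "b = aY * a' + aZ * b'"
    using u matrix_c_exact_alg[OF assms]
    by (auto simp: a_kernel_def' matrix_c_vec2 vec2_zero vec2_eq_iff)
  then have "u = matrix_c c (vec2 a' b')" by (simp add: ab matrix_c_vec2)
  then show "u \<in> matrix_c c ` carrier R_squared" by simp
qed

section \<open>Row vectors and the transposed matrices\<close>

abbreviation dual_R2 :: "(rat_poly set, (nat \<Rightarrow> rat_poly set) \<Rightarrow> rat_poly set) module" where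
  "dual_R2 \<equiv> dual_module ring_R R_squared"

abbreviation matrix_c_dual :: "rat \<Rightarrow> ((nat \<Rightarrow> rat_poly set) \<Rightarrow> rat_poly set) \<Rightarrow>
    ((nat \<Rightarrow> rat_poly set) \<Rightarrow> rat_poly set)" where
  "matrix_c_dual c \<equiv> hom_map ring_R (matrix_c c) R_squared R_squared (regular_module ring_R)"

text \<open>The functional given by the row (p, q); in these terms \<open>matrix_c_dual\<close> is
  multiplication of rows by the matrix from the right.\<close>

definition covec2 :: "alg \<Rightarrow> alg \<Rightarrow> (nat \<Rightarrow> rat_poly set) \<Rightarrow> rat_poly set" where
  "covec2 p q = (\<lambda>u\<in>carrier R_squared. rc p \<otimes>\<^bsub>ring_R\<^esub> u 0 \<oplus>\<^bsub>ring_R\<^esub> rc q \<otimes>\<^bsub>ring_R\<^esub> u 1)"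

lemma covec2_vec2: "covec2 p q (vec2 a b) = rc (p * a + q * b)"
  using vec2_mem[of a b] by (simp add: covec2_def rc_hom, simp add: vec2_def rc_hom)

lemma covec2_mod_hom: "covec2 p q \<in> mod_hom ring_R R_squared (regular_module ring_R)"
proof -
  have "(\<lambda>u\<in>carrier R_squared. covec2 p q u) \<in> mod_hom ring_R R_squared (regular_module ring_R)"
    by (rule mod_hom_restrictI[OF module_R_squared])
       (auto elim!: R_squared_cases ring_R_cases
         simp: covec2_vec2 vec2_add vec2_smult rc_hom rc_eq_iff algebra_simps)
  also have "(\<lambda>u\<in>carrier R_squared. covec2 p q u) = covec2 p q"
    by (simp add: covec2_def fun_eq_iff)
  finally show ?thesis .
qed

lemma mod_hom_R2_eqI:
  assumes "h \<in> mod_hom ring_R R_squared B" "k \<in> mod_hom ring_R R_squared B"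
    and "\<And>a b. h (vec2 a b) = k (vec2 a b)"
  shows "h = k"
  by (rule mod_hom_eqI[OF assms(1,2)]) (auto elim!: R_squared_cases simp: assms(3))

lemma covec2_cases:
  assumes h: "h \<in> mod_hom ring_R R_squared (regular_module ring_R)"
  obtains p q where "h = covec2 p q"
proof -
  obtain p where p: "h (vec2 1 0) = rc p"
    using mod_hom_closed[OF h, of "vec2 1 0"] by (auto elim: ring_R_cases)
  obtain q where q: "h (vec2 0 1) = rc q"
    using mod_hom_closed[OF h, of "vec2 0 1"] by (auto elim: ring_R_cases)
  have "h (vec2 a b) = covec2 p q (vec2 a b)" for a b
  proof -
    have "h (vec2 a b) = h (rc a \<odot>\<^bsub>R_squared\<^esub> vec2 1 0 \<oplus>\<^bsub>R_squared\<^esub> rc b \<odot>\<^bsub>R_squared\<^esub> vec2 0 1)"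
      by (simp add: vec2_smult vec2_add)
    also have "\<dots> = h (rc a \<odot>\<^bsub>R_squared\<^esub> vec2 1 0) \<oplus>\<^bsub>ring_R\<^esub> h (rc b \<odot>\<^bsub>R_squared\<^esub> vec2 0 1)"
      using mod_hom_add[OF h, of "rc a \<odot>\<^bsub>R_squared\<^esub> vec2 1 0" "rc b \<odot>\<^bsub>R_squared\<^esub> vec2 0 1"]
      by (simp add: vec2_smult)
    also have "\<dots> = rc (a * p + b * q)"
      using mod_hom_smult[OF h, of "rc a" "vec2 1 0"] mod_hom_smult[OF h, of "rc b" "vec2 0 1"]
      by (simp add: p q rc_hom)
    finally show ?thesis by (simp add: covec2_vec2 mult.commute)
  qed
  then show ?thesis using that mod_hom_R2_eqI[OF h covec2_mod_hom] by blast
qed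

lemma covec2_eq_iff: "covec2 p q = covec2 p' q' \<longleftrightarrow> p = p' \<and> q = q'"
proof
  assume *: "covec2 p q = covec2 p' q'"
  show "p = p' \<and> q = q'"
    using fun_cong[OF *, of "vec2 1 0"] fun_cong[OF *, of "vec2 0 1"]
    by (simp add: covec2_vec2 rc_eq_iff)
qed simp

lemma module_dual_R2: "module ring_R dual_R2"
  by (rule module_hom_module[OF module_R_squared module_regular[OF cring_ring_R]])

lemma covec2_mem [simp]: "covec2 p q \<in> carrier dual_R2"
  using covec2_mod_hom by simp

lemma covec2_add: "covec2 p q \<oplus>\<^bsub>dual_R2\<^esub> covec2 p' q' = covec2 (p + p') (q + q')"
proof (rule mod_hom_R2_eqI[OF _ covec2_mod_hom])
  interpret module ring_R dual_R2 by (rule module_dual_R2)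
  show "covec2 p q \<oplus>\<^bsub>dual_R2\<^esub> covec2 p' q' \<in> mod_hom ring_R R_squared (regular_module ring_R)"
    using M.a_closed[OF covec2_mem covec2_mem] by simp
qed (simp add: covec2_vec2 rc_hom rc_eq_iff algebra_simps)

lemma covec2_smult: "rc r \<odot>\<^bsub>dual_R2\<^esub> covec2 p q = covec2 (r * p) (r * q)"
proof (rule mod_hom_R2_eqI[OF _ covec2_mod_hom])
  interpret module ring_R dual_R2 by (rule module_dual_R2)
  show "rc r \<odot>\<^bsub>dual_R2\<^esub> covec2 p q \<in> mod_hom ring_R R_squared (regular_module ring_R)"
    using smult_closed[OF rc_mem covec2_mem] by simp
qed (simp add: covec2_vec2 rc_hom rc_eq_iff algebra_simps)

lemma covec2_zero: "\<zero>\<^bsub>dual_R2\<^esub> = covec2 0 0"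
proof (rule mod_hom_R2_eqI[OF _ covec2_mod_hom])
  interpret module ring_R dual_R2 by (rule module_dual_R2)
  show "\<zero>\<^bsub>dual_R2\<^esub> \<in> mod_hom ring_R R_squared (regular_module ring_R)"
    using M.zero_closed by simp
qed (simp add: covec2_vec2 rc_hom)

lemma matrix_c_dual_covec2:
  "matrix_c_dual c (covec2 p q) = covec2 (p * aV + q * aY) (p * scalar c * aX + q * aZ)"
  unfolding hom_map_eq[OF covec2_mod_hom]
  by (rule mod_hom_R2_eqI[OF mod_hom_compose[OF module_R_squared matrix_c_mod_hom covec2_mod_hom]
        covec2_mod_hom])
     (simp add: compose_def matrix_c_vec2 covec2_vec2 algebra_simps)

lemma dual_R2_cases:
  assumes "h \<in> carrier dual_R2"
  obtains p q where "h = covec2 p q"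
  using assms by (auto elim: covec2_cases)

lemma matrix_c_dual_mod_hom: "matrix_c_dual c \<in> mod_hom ring_R dual_R2 dual_R2"
  by (rule hom_map_mod_hom[OF module_R_squared module_R_squared module_regular[OF cring_ring_R]
        matrix_c_mod_hom])

lemma matrix_c_dual_exact:
  assumes "2 \<le> c"
  shows "matrix_c_dual (2 * c) ` carrier dual_R2 = a_kernel dual_R2 dual_R2 (matrix_c_dual c)"
proof (intro equalityI subsetI)
  fix h assume "h \<in> matrix_c_dual (2 * c) ` carrier dual_R2"
  then obtain k where k: "h = matrix_c_dual (2 * c) k" "k \<in> carrier dual_R2" by (rule imageE)
  obtain p q where pq: "k = covec2 p q" by (rule dual_R2_cases[OF k(2)])
  let ?p = "p * aV + q * aY" and ?q = "p * scalar (2 * c) * aX + q * aZ"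
  have h: "h = covec2 ?p ?q" by (simp only: k pq matrix_c_dual_covec2)
  have "?p * aV + ?q * aY = 0 \<and> ?p * scalar c * aX + ?q * aZ = 0"
    unfolding matrix_c_transpose_exact_alg[OF assms] by blast
  then have "matrix_c_dual c h = \<zero>\<^bsub>dual_R2\<^esub>"
    by (simp only: h matrix_c_dual_covec2 covec2_zero)
  then show "h \<in> a_kernel dual_R2 dual_R2 (matrix_c_dual c)"
    using covec2_mem[of ?p ?q] by (simp only: a_kernel_def' mem_Collect_eq h)
next
  fix h assume h: "h \<in> a_kernel dual_R2 dual_R2 (matrix_c_dual c)"
  then have h': "h \<in> carrier dual_R2" "matrix_c_dual c h = \<zero>\<^bsub>dual_R2\<^esub>"
    by (simp_all only: a_kernel_def' mem_Collect_eq)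
  obtain p q where pq: "h = covec2 p q" by (rule dual_R2_cases[OF h'(1)])
  have "matrix_c_dual c (covec2 p q) = covec2 0 0"
    using h'(2) by (simp only: pq covec2_zero)
  then have "p * aV + q * aY = 0 \<and> p * scalar c * aX + q * aZ = 0"
    by (simp add: matrix_c_dual_covec2 covec2_eq_iff)
  then obtain p' q' where "p = p' * aV + q' * aY" "q = p' * scalar (2 * c) * aX + q' * aZ"
    unfolding matrix_c_transpose_exact_alg[OF assms] by blast
  then have hpq: "h = matrix_c_dual (2 * c) (covec2 p' q')" by (simp only: pq matrix_c_dual_covec2)
  show "h \<in> matrix_c_dual (2 * c) ` carrier dual_R2" unfolding hpq by (rule imageI) (rule covec2_mem)
qed

text \<open>R^2 is reflexive: the values of h at the two unit rows form the vector (a, b) at which h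
  evaluates.\<close>

lemma dual_R2_hom:
  assumes h: "h \<in> mod_hom ring_R dual_R2 (regular_module ring_R)"
  shows "\<exists>a b. \<forall>p q. h (covec2 p q) = rc (p * a + q * b)"
proof -
  obtain a where a: "h (covec2 1 0) = rc a"
    using mod_hom_closed[OF h covec2_mem[of 1 0]] by (auto elim: ring_R_cases)
  obtain b where b: "h (covec2 0 1) = rc b"
    using mod_hom_closed[OF h covec2_mem[of 0 1]] by (auto elim: ring_R_cases)
  have "h (covec2 p q) = rc (p * a + q * b)" for p q
  proof -
    have "h (covec2 p q) = h (rc p \<odot>\<^bsub>dual_R2\<^esub> covec2 1 0 \<oplus>\<^bsub>dual_R2\<^esub> rc q \<odot>\<^bsub>dual_R2\<^esub> covec2 0 1)"
      unfolding covec2_smult covec2_add by simp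
    also have "\<dots> = h (rc p \<odot>\<^bsub>dual_R2\<^esub> covec2 1 0) \<oplus>\<^bsub>ring_R\<^esub> h (rc q \<odot>\<^bsub>dual_R2\<^esub> covec2 0 1)"
      unfolding covec2_smult using mod_hom_add[OF h covec2_mem covec2_mem] by simp
    also have "\<dots> = rc (p * a + q * b)"
      using mod_hom_smult[OF h rc_mem covec2_mem, of p 1 0] mod_hom_smult[OF h rc_mem covec2_mem, of q 0 1]
      by (simp add: a b rc_hom del: hom_module_simps)
    finally show ?thesis .
  qed
  then show ?thesis by blast
qed

lemma evaluation_mod_hom:
  "(\<lambda>h\<in>carrier dual_R2. h (vec2 a b)) \<in> mod_hom ring_R dual_R2 (regular_module ring_R)"
proof (rule mod_hom_restrictI[OF module_dual_R2])
  show "h (vec2 a b) \<in> carrier (regular_module ring_R)" if "h \<in> carrier dual_R2" for h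
    using that mod_hom_closed[of h ring_R R_squared "regular_module ring_R"] by simp
qed simp_all

section \<open>Extending homomorphisms from transposed images and kernels\<close>

lemma homs_extend_image_matrix_c_dual:
  assumes "2 \<le> c"
  shows "homs_extend ring_R dual_R2 (matrix_c_dual c ` carrier dual_R2) (regular_module ring_R)"
  \<comment> \<open>\<open>\<theta>\<close> composed with the dual map is evaluation at a vector \<open>w\<close>. It vanishes on the kernel, which is
     the image for \<open>2 c\<close>, so the matrix for \<open>2 c\<close> kills \<open>w\<close>, and \<open>w\<close> is an image under the one for \<open>c\<close>.\<close>
  unfolding homs_extend_def
proof
  let ?E = "matrix_c_dual c ` carrier dual_R2"
  fix \<theta> assume \<theta>: "\<theta> \<in> mod_hom ring_R (dual_R2\<lparr>carrier := ?E\<rparr>) (regular_module ring_R)"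
  have "matrix_c_dual c \<in> mod_hom ring_R dual_R2 (dual_R2\<lparr>carrier := ?E\<rparr>)"
    by (rule mod_hom_codomain_restrict[OF matrix_c_dual_mod_hom]) simp
  from dual_R2_hom[OF mod_hom_compose[OF module_dual_R2 this \<theta>]] obtain w0 w1 where
    w': "\<And>p q. compose (carrier dual_R2) \<theta> (matrix_c_dual c) (covec2 p q) = rc (p * w0 + q * w1)"
    by blast
  have w: "\<theta> (covec2 (p * aV + q * aY) (p * scalar c * aX + q * aZ)) = rc (p * w0 + q * w1)" for p q
    using w'[of p q] unfolding compose_eq[OF covec2_mem] matrix_c_dual_covec2 .
  have zero: "p * w0 + q * w1 = 0"
    if "\<exists>p' q'. p = p' * aV + q' * aY \<and> q = p' * scalar (2 * c) * aX + q' * aZ" for p q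
  proof -
    have "p * aV + q * aY = 0 \<and> p * scalar c * aX + q * aZ = 0"
      using that matrix_c_transpose_exact_alg[OF assms] by blast
    then have "rc (p * w0 + q * w1) = \<theta> (covec2 0 0)" using w[of p q] by simp
    moreover have "rc 0 = \<theta> (covec2 0 0)" using w[of 0 0] by simp
    ultimately show ?thesis by (metis rc_eq_iff)
  qed
  \<comment> \<open>The unit rows (1, 0) and (0, 1) select the rows of the matrix for 2c, so the two
    equations say that this matrix kills w.\<close>
  have 1: "aV * w0 + (scalar (2 * c) * aX) * w1 = 0"
    by (rule zero) (rule exI[of _ 1], rule exI[of _ 0], simp)
  have 2: "aY * w0 + aZ * w1 = 0"
    by (rule zero) (rule exI[of _ 0], rule exI[of _ 1], simp)
  from 1 2 assms obtain a b where ab: "w0 = aV * a + scalar c * aX * b" "w1 = aY * a + aZ * b"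
    using matrix_c_exact_alg[of c w0 w1] by auto
  show "\<exists>\<Theta>\<in>mod_hom ring_R dual_R2 (regular_module ring_R). \<forall>h\<in>?E. \<Theta> h = \<theta> h"
  proof (rule bexI[OF _ evaluation_mod_hom], rule ballI)
    fix h assume "h \<in> ?E"
    then obtain k where k: "h = matrix_c_dual c k" "k \<in> carrier dual_R2" by (rule imageE)
    obtain p q where pq: "k = covec2 p q" by (rule dual_R2_cases[OF k(2)])
    have h: "h = covec2 (p * aV + q * aY) (p * scalar c * aX + q * aZ)"
      by (simp only: k pq matrix_c_dual_covec2)
    have "(\<lambda>h\<in>carrier dual_R2. h (vec2 a b)) h = h (vec2 a b)"
      unfolding h by (rule restrict_apply') (rule covec2_mem)
    also have "\<dots> = \<theta> h"
      unfolding h w by (simp add: covec2_vec2 ab rc_eq_iff algebra_simps)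
    finally show "(\<lambda>h\<in>carrier dual_R2. h (vec2 a b)) h = \<theta> h" .
  qed
qed

lemma carrier_update_simps:
  fixes A :: "('r, 'a) module"
  shows "carrier (A\<lparr>carrier := K\<rparr>) = K" "add (A\<lparr>carrier := K\<rparr>) = add A"
    "module.smult (A\<lparr>carrier := K\<rparr>) = module.smult A"
  by simp_all

text \<open>
  For \<open>c = 1\<close> the kernel of the dual has an additional generator \<open>(x, y)\<close>. Sending it to \<open>xz\<close> and
  the other generators \<open>(v, 2x)\<close> and \<open>(y, z)\<close> to \<open>0\<close> is a homomorphism \<open>\<theta>\<close>, given by the coefficient
  of \<open>x\<close> in the first component. An extension of \<open>\<theta>\<close> is evaluation at a vector \<open>w\<close> which is killed by
  \<open>(v, 2x)\<close> and \<open>(y, z)\<close>, so \<open>w\<close> lies in the image of the matrix, and then \<open>(x, y)\<close> kills it too.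
\<close>

lemma not_homs_extend_kernel_matrix_c_dual:
  "\<not> homs_extend ring_R dual_R2 (a_kernel dual_R2 dual_R2 (matrix_c_dual 1)) (regular_module ring_R)"
proof
  let ?K = "a_kernel dual_R2 dual_R2 (matrix_c_dual 1)"
  \<comment> \<open>The coefficient of x becomes that of xz. The target lies in the socle, being
    annihilated by v, x, y and z, which keeps the map linear on the kernel although the other
    coordinates are discarded.\<close>
  let ?socle = "\<lambda>a. case a of Alg a0 a1 a2 a3 a4 a5 a6 a7 \<Rightarrow> Alg 0 0 0 0 0 0 a2 0"
  let ?\<theta> = "\<lambda>h. rc (?socle (inv_into UNIV rc (h (vec2 1 0))))"
  assume ext: "homs_extend ring_R dual_R2 ?K (regular_module ring_R)"
  have inv: "inv_into UNIV rc (rc a) = a" for a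
    by (rule inv_f_f) (simp add: inj_def rc_eq_iff)
  have \<theta>_eq: "?\<theta> (covec2 p q) = rc (?socle p)" for p q
    by (simp add: covec2_vec2 inv)
  have scalar1: "p * scalar 1 * aX = p * aX" for p by (simp add: scalar_hom)
  have K: "covec2 p q \<in> ?K \<longleftrightarrow> p * aV + q * aY = 0 \<and> p * aX + q * aZ = 0" for p q
    by (simp only: a_kernel_def' mem_Collect_eq matrix_c_dual_covec2 covec2_zero covec2_eq_iff
        covec2_mem simp_thms scalar1)
  have K_cases: "\<exists>p q. h = covec2 p q \<and> p * aV + q * aY = 0 \<and> p * aX + q * aZ = 0" if h: "h \<in> ?K" for h
  proof -
    from h have "h \<in> carrier dual_R2" by (simp only: a_kernel_def' mem_Collect_eq)
    then obtain p q where "h = covec2 p q" by (rule dual_R2_cases)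
    then show ?thesis using h K by blast
  qed
  have sub: "submodule ?K ring_R dual_R2"
    by (rule submodule_kernel[OF module_dual_R2 module_dual_R2 matrix_c_dual_mod_hom])
  have "(\<lambda>h\<in>carrier (dual_R2\<lparr>carrier := ?K\<rparr>). ?\<theta> h)
      \<in> mod_hom ring_R (dual_R2\<lparr>carrier := ?K\<rparr>) (regular_module ring_R)"
  proof (rule mod_hom_restrictI[OF submodule_carrier_update[OF sub module_dual_R2]])
    fix h k assume "h \<in> carrier (dual_R2\<lparr>carrier := ?K\<rparr>)" "k \<in> carrier (dual_R2\<lparr>carrier := ?K\<rparr>)"
    then have hk: "h \<in> ?K" "k \<in> ?K" by (simp_all only: carrier_update_simps)
    obtain p q where h: "h = covec2 p q" using K_cases[OF hk(1)] by blast
    obtain p' q' where k: "k = covec2 p' q'" using K_cases[OF hk(2)] by blast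
    have "?\<theta> (h \<oplus>\<^bsub>dual_R2\<^esub> k) = rc (?socle (p + p'))"
      unfolding h k covec2_add \<theta>_eq ..
    also have "\<dots> = rc (?socle p + ?socle p')" by (cases p; cases p') simp
    finally show "?\<theta> (h \<oplus>\<^bsub>dual_R2\<lparr>carrier := ?K\<rparr>\<^esub> k) = ?\<theta> h \<oplus>\<^bsub>regular_module ring_R\<^esub> ?\<theta> k"
      unfolding h k \<theta>_eq by (simp only: carrier_update_simps regular_module_simps rc_hom)
  next
    fix r h assume r: "r \<in> carrier ring_R" and "h \<in> carrier (dual_R2\<lparr>carrier := ?K\<rparr>)"
    then have hK: "h \<in> ?K" by (simp only: carrier_update_simps)
    obtain p q where h: "h = covec2 p q" and pq: "p * aV + q * aY = 0" using K_cases[OF hK] by blast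
    obtain s where s: "r = rc s" using r by (rule ring_R_cases)
    have "?\<theta> (r \<odot>\<^bsub>dual_R2\<^esub> h) = rc (?socle (s * p))"
      unfolding h s covec2_smult \<theta>_eq ..
    \<comment> \<open>The equation p v + q y = 0 makes the constant term of p zero, so the
      coefficient of x in s p is the constant term of s times that in p; the other terms of s
      annihilate xz.\<close>
    also have "\<dots> = rc (s * ?socle p)"
      using pq by (cases s; cases p; cases q) (auto simp: alg_defs)
    finally show "?\<theta> (r \<odot>\<^bsub>dual_R2\<lparr>carrier := ?K\<rparr>\<^esub> h) = r \<odot>\<^bsub>regular_module ring_R\<^esub> ?\<theta> h"
      unfolding h s \<theta>_eq by (simp only: carrier_update_simps regular_module_simps rc_hom)
  qed simp
  from ext[unfolded homs_extend_def, rule_format, OF this] obtain \<Theta> where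
    \<Theta>: "\<Theta> \<in> mod_hom ring_R dual_R2 (regular_module ring_R)"
    "\<And>h. h \<in> ?K \<Longrightarrow> \<Theta> h = ?\<theta> h" by auto
  obtain w0 w1 where w: "\<And>p q. \<Theta> (covec2 p q) = rc (p * w0 + q * w1)"
    using dual_R2_hom[OF \<Theta>(1)] by blast
  have val: "p * w0 + q * w1 = ?socle p" if "p * aV + q * aY = 0 \<and> p * aX + q * aZ = 0" for p q
  proof -
    have "rc (p * w0 + q * w1) = rc (?socle p)"
      using \<Theta>(2)[of "covec2 p q"] that unfolding K w \<theta>_eq by blast
    then show ?thesis by (simp only: rc_eq_iff)
  qed
  have "aV * w0 + (scalar (2 * 1) * aX) * w1 = 0"
    by (subst val) (simp_all add: alg_defs)
  moreover have "aY * w0 + aZ * w1 = 0"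
    by (subst val) (simp_all add: alg_defs)
  ultimately obtain a b where ab: "w0 = aV * a + scalar 1 * aX * b" "w1 = aY * a + aZ * b"
    using matrix_c_exact_alg[of 1 w0 w1] by auto
  have "aX * w0 + aY * w1 = Alg 0 0 0 0 0 0 1 0"
    by (subst val) (simp_all add: alg_defs)
  \<comment> \<open>x (v a + x b) + y (y a + z b) = (vx + y^2) a + (x^2 + yz) b, and both
    coefficients vanish in R.\<close>
  moreover have "aX * w0 + aY * w1 = 0"
    unfolding ab by (cases a; cases b) (simp add: alg_defs)
  ultimately show False by (simp add: zero_alg_def)
qed

section \<open>Presentations of the two modules and their torsionfreeness\<close>

lemma submodule_image_matrix_c: "submodule (matrix_c c ` carrier R_squared) ring_R R_squared"
  by (rule submodule_image[OF module_R_squared module_R_squared matrix_c_mod_hom])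

lemma module_M_eq: "module_M = quot_module R_squared (matrix_c 2 ` carrier R_squared)"
  by (simp add: module_M_def coker_def map_f_eq)

lemma module_N_eq: "module_N = R_squared\<lparr>carrier := matrix_c 2 ` carrier R_squared\<rparr>"
  by (simp add: module_N_def image_module_def map_f_eq)

lemma module_module_M: "module ring_R module_M"
  unfolding module_M_eq by (rule module_quot[OF module_R_squared submodule_image_matrix_c])

lemma module_module_N: "module ring_R module_N"
  unfolding module_N_eq by (rule submodule_carrier_update[OF submodule_image_matrix_c module_R_squared])

lemma projective_R_squared: "projective ring_R R_squared"
  unfolding R_squared_def
proof (rule dual_basis_projective[OF dual_basis_free[OF cring_ring_R] module_free[OF cring_ring_R]])
  show "inj_on (std_vec ring_R {..<2 :: nat}) {..<2}"
    by (rule inj_on_std_vec[OF one_neq_zero_ring_R])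
qed

lemma fin_gen_R_squared: "fin_gen ring_R R_squared"
  unfolding R_squared_def
  by (rule dual_basis_fin_gen[OF dual_basis_free[OF cring_ring_R] module_free[OF cring_ring_R] _
        inj_on_std_vec[OF one_neq_zero_ring_R]]) simp

lemma presentation_M:
  "fg_proj_presentation ring_R module_M R_squared R_squared (matrix_c 2)
     (quot_map R_squared (matrix_c 2 ` carrier R_squared))"
  unfolding fg_proj_presentation_def module_M_eq
  using quot_map[OF module_R_squared submodule_image_matrix_c[of 2]]
  by (simp add: projective_R_squared fin_gen_R_squared matrix_c_mod_hom)

text \<open>The map \<open>matrix_c 2\<close> itself is the augmentation, with its codomain cut down
  to \<open>module_N\<close>; its kernel stays the same and is the image for c = 1.\<close>

lemma presentation_N:
  "fg_proj_presentation ring_R module_N R_squared R_squared (matrix_c 1) (matrix_c 2)"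
proof -
  have "matrix_c 2 \<in> mod_hom ring_R R_squared module_N"
    unfolding module_N_eq by (rule mod_hom_codomain_restrict[OF matrix_c_mod_hom]) simp
  moreover have "matrix_c 1 ` carrier R_squared = a_kernel R_squared module_N (matrix_c 2)"
    using matrix_c_exact[of 1] by (simp add: a_kernel_def' module_N_eq)
  moreover have "matrix_c 2 ` carrier R_squared = carrier module_N" by (simp add: module_N_eq)
  ultimately show ?thesis
    unfolding fg_proj_presentation_def
    by (simp add: projective_R_squared fin_gen_R_squared matrix_c_mod_hom)
qed

lemma ses_N_M:
  "ses ring_R module_N R_squared module_M (\<lambda>x\<in>carrier module_N. x)
     (quot_map R_squared (matrix_c 2 ` carrier R_squared))"
proof -
  note q = quot_map[OF module_R_squared submodule_image_matrix_c[of 2], folded module_M_eq]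
  have N: "carrier module_N = matrix_c 2 ` carrier R_squared" by (simp add: module_N_eq)
  have "(\<lambda>x\<in>carrier module_N. x) \<in> mod_hom ring_R module_N R_squared"
    using mod_hom_restrict_domain[OF submodule_image_matrix_c[of 2] module_R_squared
        mod_hom_id[OF module_R_squared]] submodule_subset[OF submodule_image_matrix_c[of 2]]
    by (simp add: module_N_eq restrict_restrict Int_absorb1)
  then show ?thesis
    unfolding ses_def using q N
    by (simp add: module_module_M module_module_N module_R_squared inj_on_def)
qed

text \<open>The form in which projectivity of the dual of R^2 enters the comparison of
  syzygies.\<close>

lemma dual_basis_dual_R2:
  "\<exists>x f. dual_basis ring_R dual_R2 {..<2 :: nat} x f"
proof -
  have "dual_basis ring_R R_squared {..<2 :: nat} (std_vec ring_R {..<2})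
      (\<lambda>i. \<lambda>u\<in>carrier R_squared. u i)"
    unfolding R_squared_def by (rule dual_basis_free[OF cring_ring_R])
  from dual_basis_dual[OF this module_R_squared] show ?thesis by blast
qed

type_synonym Tr_resolution_elt =
  "(rat_poly set, ((nat \<Rightarrow> rat_poly set) \<Rightarrow> rat_poly set) set) resolution_elt"

lemma infinity_torsionfree_M: "infinity_torsionfree ring_R module_M"
proof -
  obtain P :: "nat \<Rightarrow> (rat_poly set, Tr_resolution_elt) module" and d e where res: "proj_resolution ring_R (Tr ring_R module_M) P d e"
    and ext: "\<forall>j. carrier (Ext ring_R (Suc j) (Tr ring_R module_M) (regular_module ring_R)) =
        {zero (Ext ring_R (Suc j) (Tr ring_R module_M) (regular_module ring_R))}
      \<longleftrightarrow> homs_extend ring_R (P j) (d j ` carrier (P (Suc j))) (regular_module ring_R)"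
    and sr: "stable_retract ring_R (P 0) (d 0 ` carrier (P 1)) dual_R2
      (matrix_c_dual 2 ` carrier dual_R2)"
    and "stable_retract ring_R dual_R2 (matrix_c_dual 2 ` carrier dual_R2) (P 0) (d 0 ` carrier (P 1))"
    by (rule Tr_resolution_obtain[OF module_module_M one_neq_zero_ring_R presentation_M])
  note P = proj_resolutionD(1-3)[OF res]
  note mP = projective_module[OF P(1)]
  obtain x f where db: "dual_basis ring_R dual_R2 {..<2 :: nat} x f"
    using dual_basis_dual_R2 by blast
  have ge: "(2 :: rat) \<le> 2 ^ Suc j" for j using one_le_power[of "2 :: rat" j] by simp
  \<comment> \<open>The exponent is shifted because the first syzygy, at j = 0, belongs to f, with c
    = 2. Each further syzygy replaces the image for c by the kernel of that dual map, which is the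
    image for 2c; all these values are at least 2.\<close>
  have sr': "stable_retract ring_R (P j) (d j ` carrier (P (Suc j))) dual_R2
      (matrix_c_dual (2 ^ Suc j) ` carrier dual_R2)" for j
  proof (induction j)
    case 0
    show ?case using sr by (simp del: hom_module_simps)
  next
    case (Suc j)
    obtain K :: "Tr_resolution_elt set" and y g where 1: "dual_basis ring_R (P j) K y g"
      using projective_dual_basis[OF P(1)] by blast
    obtain K' :: "Tr_resolution_elt set" and y' g' where 2: "dual_basis ring_R (P (Suc j)) K' y' g'"
      using projective_dual_basis[OF P(1)] by blast
    have eq: "(2 :: rat) ^ Suc (Suc j) = 2 * 2 ^ Suc j" by simp
    show ?case
      unfolding P(3) eq matrix_c_dual_exact[OF ge]
      by (rule stable_retract_syzygy[OF mP mP module_dual_R2 module_dual_R2 1 2 db P(2)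
            matrix_c_dual_mod_hom Suc])
  qed
  have "homs_extend ring_R (P j) (d j ` carrier (P (Suc j))) (regular_module ring_R)" for j
    by (rule homs_extend_stable_retract[OF mP module_dual_R2 module_regular[OF cring_ring_R]
        submodule_image[OF mP mP P(2)] submodule_image[OF module_dual_R2 module_dual_R2
        matrix_c_dual_mod_hom] sr' homs_extend_image_matrix_c_dual[OF ge]])
  then have *: "carrier (Ext ring_R (Suc j) (Tr ring_R module_M) (regular_module ring_R)) =
      {zero (Ext ring_R (Suc j) (Tr ring_R module_M) (regular_module ring_R))}" for j
    by (simp only: ext)
  show ?thesis
    unfolding infinity_torsionfree_def n_torsionfree_def
  proof (intro allI impI)
    fix n i :: nat assume "1 \<le> i \<and> i \<le> n"
    then obtain j where "i = Suc j" by (cases i) auto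
    then show "carrier (Ext ring_R i (Tr ring_R module_M) (regular_module ring_R)) =
        {\<zero>\<^bsub>Ext ring_R i (Tr ring_R module_M) (regular_module ring_R)\<^esub>}"
      using * by simp
  qed
qed

lemma not_torsionfree_N:
  assumes "n \<ge> 2"
  shows "\<not> n_torsionfree ring_R n module_N"
proof
  assume tf: "n_torsionfree ring_R n module_N"
  obtain P :: "nat \<Rightarrow> (rat_poly set, Tr_resolution_elt) module" and d e where res: "proj_resolution ring_R (Tr ring_R module_N) P d e"
    and ext: "\<forall>j. carrier (Ext ring_R (Suc j) (Tr ring_R module_N) (regular_module ring_R)) =
        {zero (Ext ring_R (Suc j) (Tr ring_R module_N) (regular_module ring_R))}
      \<longleftrightarrow> homs_extend ring_R (P j) (d j ` carrier (P (Suc j))) (regular_module ring_R)"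
    and "stable_retract ring_R (P 0) (d 0 ` carrier (P 1)) dual_R2 (matrix_c_dual 1 ` carrier dual_R2)"
    and sr: "stable_retract ring_R dual_R2 (matrix_c_dual 1 ` carrier dual_R2) (P 0) (d 0 ` carrier (P 1))"
    by (rule Tr_resolution_obtain[OF module_module_N one_neq_zero_ring_R presentation_N])
  note P = proj_resolutionD(1-3)[OF res]
  note mP = projective_module[OF P(1)]
  obtain x f where db: "dual_basis ring_R dual_R2 {..<2 :: nat} x f"
    using dual_basis_dual_R2 by blast
  obtain K :: "Tr_resolution_elt set" and y g where dbP: "dual_basis ring_R (P (Suc 0)) K y g"
    using projective_dual_basis[OF P(1)] by blast
  \<comment> \<open>The index \<open>Suc 0\<close> stands for Ext^2, since \<open>ext\<close> speaks
    of degree \<open>Suc j\<close>; n \<ge> 2 ensures that this degree is covered.\<close>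
  have ext1: "homs_extend ring_R (P (Suc 0)) (d (Suc 0) ` carrier (P (Suc (Suc 0)))) (regular_module ring_R)"
    using tf assms ext[rule_format, of "Suc 0"] unfolding n_torsionfree_def by simp
  \<comment> \<open>Up to stable retracts, the first syzygy of the transpose of N is the image of
    the dual map for c = 1, so the second is the kernel of that map.\<close>
  have sr1: "stable_retract ring_R dual_R2 (a_kernel dual_R2 dual_R2 (matrix_c_dual 1))
      (P (Suc 0)) (d (Suc 0) ` carrier (P (Suc (Suc 0))))"
    unfolding P(3)
    by (rule stable_retract_syzygy[OF module_dual_R2 module_dual_R2 mP mP db db dbP
          matrix_c_dual_mod_hom P(2) sr[unfolded One_nat_def]])
  have "homs_extend ring_R dual_R2 (a_kernel dual_R2 dual_R2 (matrix_c_dual 1))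
      (regular_module ring_R)"
    by (rule homs_extend_stable_retract[OF module_dual_R2 mP module_regular[OF cring_ring_R]
        submodule_kernel[OF module_dual_R2 module_dual_R2 matrix_c_dual_mod_hom]
        submodule_image[OF mP mP P(2)] sr1 ext1])
  then show False using not_homs_extend_kernel_matrix_c_dual by blast
qed

theorem mainTheorem7:
  shows "(\<exists>i p. ses ring_R module_N R_squared module_M i p) \<and>
         infinity_torsionfree ring_R module_M \<and>
         (\<forall>n\<ge>2. \<not> n_torsionfree ring_R n module_N)"
  using ses_N_M infinity_torsionfree_M not_torsionfree_N by blast

end
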